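(* Let $n\ge 2$ and $G=SL(n,\mathbb R)$. For $(\alpha,\beta;\varpi;\lambda,\nu)\in\{\pm\}^2\times \mathrm{Irr}(SL(n-1,\mathbb R))_{\mathrm{fin}}\times\mathbb C^2$ the following three conditions are equivalent. (i) $\mathrm{Diff}_G(I(\mathrm{triv},\lambda)^\alpha, I(\varpi,\nu)^\beta)\neq\{0\}$. (ii) $\dim \mathrm{Diff}_G(I(\mathrm{triv},\lambda)^\alpha, I(\varpi,\nu)^\beta)=1$. (iii) One of the following two conditions holds: (iii-a) $(\beta,\varpi,\nu)=(\alpha,\mathrm{triv},\lambda)$; (iii-b) $(\alpha,\beta;\varpi;\lambda,\nu)\in\Lambda^n_G$.
   Context: Groups. Let $n\ge2$, $G=SL(n,\mathbb R)$; $E_{i,j}$ are the matrix units, $N_j^+=E_{1,j+1}$ for $1\le j\le n-1$, and $\widetilde H_0=\frac1{n-1}\mathrm{diag}(n-1,-1,\dots,-1)$. $P=MAN_+$ is the maximal parabolic subgroup of block upper triangular matrices in $G$ for the partition $n=1+(n-1)$ (so $G/P\cong\mathbb{RP}^{n-1}$), with $M=\{\mathrm{diag}(\det(g)^{-1},g): g\in SL^{\pm}(n-1,\mathbb R)\}\cong SL^\pm(n-1,\mathbb R)$, $A=\exp(\mathbb R\widetilde H_0)$, $N_+=\exp(\mathrm{span}_{\mathbb R}\{N_j^+\})$. Here $SL^\pm(m,\mathbb R)$ is the group of real $m\times m$ matrices of determinant $\pm1$; $SL^\pm(1,\mathbb R)=\{\pm1\}$ and $SL(1,\mathbb R)=\{1\}$.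 Representations. For $\lambda\in\mathbb C$, $\mathbb C_\lambda$ is the character $\exp(t\widetilde H_0)\mapsto e^{\lambda t}$ of $A$. For $\alpha\in\{\pm\}$, $\mathbb C_\alpha$ is the character of $M$ sending $\mathrm{diag}(\det(g)^{-1},g)$ to $1$ if $\alpha=+$ and to $\mathrm{sgn}(\det g)$ if $\alpha=-$. $\mathrm{Irr}(SL(n-1,\mathbb R))_{\mathrm{fin}}$ is the set of equivalence classes of finite-dimensional irreducible complex representations of $SL(n-1,\mathbb R)$, and $\mathrm{triv}$ is the trivial one. The irreducible finite-dimensional representations of $M$ are written $\mathbb C_\alpha\otimes\varpi$ with $\alpha\in\{\pm\}$ and $\varpi\in\mathrm{Irr}(SL(n-1,\mathbb R))_{\mathrm{fin}}$; for $n\ge3$ the representation $\mathrm{poly}^k_{n-1}$ below is here extended to $SL^\pm(n-1,\mathbb R)$ by the natural action on $\mathrm{Pol}^k(\mathbb C^{n-1})$ (for other $\varpi$ fix any extension). Induced representations. $I(\varpi,\lambda)^\alpha=\mathrm{Ind}_P^G((\mathbb C_\alpha\otimes\varpi)\boxtimes\mathbb C_\lambda)$ (unnormalized, $N_+$ acting trivially) is the space of smooth $f:G\to W$ ($W$ the space of $\varpi$) with $f(gp)=\tau(p)^{-1}f(g)$ for $p\in P$, where $\tau=(\mathbb C_\alpha\otimes\varpi)\boxtimes\mathbb C_\lambda\boxtimes\mathrm{triv}$, with $G$ acting by left translation; equivalently, smooth sections of the $G$-equivariant vector bundle $G\times_PW\to G/P$. $\mathrm{Diff}_G(I,I')$ denotes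 the space of $G$-intertwining differential operators $I\to I'$. Parameters. For $\alpha\in\{\pm\}\equiv\{\pm1\}$ and $k\in\mathbb Z_{\ge0}$, $\alpha+k\in\{\pm\}$ is $+$ if $\alpha=(-1)^k$ and $-$ if $\alpha=(-1)^{k+1}$. $\mathrm{poly}^k_{n-1}$ is the irreducible representation of $SL(n-1,\mathbb R)$ on $\mathrm{Pol}^k(\mathbb C^{n-1})=S^k((\mathbb C^{n-1})^\vee)$ (homogeneous polynomials of degree $k$) induced by the standard action on $\mathbb C^{n-1}$; $\mathrm{poly}^k_1$ is regarded as $\mathrm{triv}$ for all $k\in\mathbb Z_{\ge0}$. For $n\ge2$, $\Lambda^n_G=\{(\alpha,\alpha+k;\mathrm{poly}^k_{n-1};1-k,1+\frac{k}{n-1}):\alpha\in\{\pm\},\,k\in\mathbb Z_{\ge0}\}$.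
   Formalization: For n=2, (iii-b) is read with poly^k_1 carrying the natural action of SL^±(1,R) on Pol^k(C), so it says β=α, λ=1-k, ν=1+k; with poly^k_1=triv and β=α+k the claim fails for odd k, since -I acts on source and target by different signs. *)

theory Defs
  imports "HOL-Analysis.Analysis" "HOL-Library.Function_Algebras"
begin

(* The index type of R^(n-1) is an arbitrary finite type 'm, that of R^n is 'm option, with None
   as the first index.  So n = CARD('m option) = CARD('m) + 1, and n >= 2 holds automatically. *)

section \<open>Groups\<close>

definition SL :: "(real^'n^'n) set" where
  "SL = {A. det A = 1}"

definition SLpm :: "(real^'n^'n) set" where
  "SLpm = {A. det A = 1 \<or> det A = - 1}"

definition block_mat ::
  "real \<Rightarrow> real^'m \<Rightarrow> real^'m \<Rightarrow> real^'m^'m \<Rightarrow> real^('m option)^('m option)" where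
  "block_mat a r c D = (\<chi> i j. case i of
      None \<Rightarrow> (case j of None \<Rightarrow> a | Some j' \<Rightarrow> r $ j')
    | Some i' \<Rightarrow> (case j of None \<Rightarrow> c $ i' | Some j' \<Rightarrow> D $ i' $ j'))"

definition M_elt :: "real^'m^'m \<Rightarrow> real^('m option)^('m option)" where
  "M_elt g = block_mat (inverse (det g)) 0 0 g"

(* exp (t H) for H = diag (n-1, -1, ..., -1) / (n-1) *)
definition A_elt :: "real \<Rightarrow> real^('m::finite option)^('m option)" where
  "A_elt t = block_mat (exp t) 0 0 (mat (exp (- t / real CARD('m))))"

(* exp (\<Sum>j. y_j E_{1,j+1}) *)
definition N_plus_elt :: "real^'m \<Rightarrow> real^('m option)^('m option)" where
  "N_plus_elt y = block_mat 1 y 0 (mat 1)"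

(* The opposite unipotent group.  The maps x \<mapsto> g ** N_minus_elt x, for g in G, are local sections
   of G \<rightarrow> G/P, hence an atlas of G/P together with trivializations of G-equivariant bundles. *)
definition N_minus_elt :: "real^'m \<Rightarrow> real^('m option)^('m option)" where
  "N_minus_elt x = block_mat 1 0 x (mat 1)"


section \<open>Signs\<close>

datatype sign = Plus | Minus

fun sign_val :: "sign \<Rightarrow> int" where
  "sign_val Plus = 1"
| "sign_val Minus = - 1"

definition sign_shift :: "sign \<Rightarrow> nat \<Rightarrow> sign" where
  "sign_shift \<alpha> k = (if sign_val \<alpha> = (- 1) ^ k then Plus else Minus)"

fun sign_char :: "sign \<Rightarrow> real^'m^'m \<Rightarrow> complex" where
  "sign_char Plus g = 1"
| "sign_char Minus g = complex_of_real (sgn (det g))"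


section \<open>Finite-dimensional representations\<close>

definition mat_rep :: "(real^'m^'m) set \<Rightarrow> (real^'m^'m \<Rightarrow> complex^'d^'d) \<Rightarrow> bool" where
  "mat_rep H \<rho> \<longleftrightarrow> continuous_on H \<rho> \<and> \<rho> (mat 1) = mat 1 \<and>
     (\<forall>g\<in>H. \<forall>h\<in>H. \<rho> (g ** h) = \<rho> g ** \<rho> h)"

(* complex^'d is never the zero space *)
definition irreducible_rep :: "(real^'m^'m) set \<Rightarrow> (real^'m^'m \<Rightarrow> complex^'d^'d) \<Rightarrow> bool" where
  "irreducible_rep H \<rho> \<longleftrightarrow> mat_rep H \<rho> \<and>
     (\<forall>U. vec.subspace U \<and> (\<forall>g\<in>H. \<forall>u\<in>U. \<rho> g *v u \<in> U) \<longrightarrow> U = {0} \<or> U = UNIV)"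

(* Equivalence, over the group H, of a matrix representation with an action a on the subspace V of
   a complex vector space with scalar multiplication s. *)
definition rep_equiv ::
  "(real^'m^'m) set \<Rightarrow> (real^'m^'m \<Rightarrow> complex^'d^'d) \<Rightarrow>
   (complex \<Rightarrow> 'v::ab_group_add \<Rightarrow> 'v) \<Rightarrow> 'v set \<Rightarrow> (real^'m^'m \<Rightarrow> 'v \<Rightarrow> 'v) \<Rightarrow> bool" where
  "rep_equiv H \<rho> s V a \<longleftrightarrow>
     (\<exists>T. Vector_Spaces.linear (*s) s T \<and> bij_betw T UNIV V \<and>
          (\<forall>g\<in>H. \<forall>v. T (\<rho> g *v v) = a g (T v)))"

definition is_triv :: "(real^'m^'m) set \<Rightarrow> (real^'m^'m \<Rightarrow> complex^'d^'d) \<Rightarrow> bool" where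
  "is_triv H \<rho> \<longleftrightarrow> rep_equiv H \<rho> ((*) :: complex \<Rightarrow> complex \<Rightarrow> complex) UNIV (\<lambda>g z. z)"

definition triv_rep :: "real^'m^'m \<Rightarrow> complex^1^1" where
  "triv_rep g = mat 1"

definition Pol :: "nat \<Rightarrow> (complex^'m \<Rightarrow> complex) set" where
  "Pol k = {p. \<exists>c. p = (\<lambda>z. \<Sum>e | (\<Sum>i\<in>UNIV. e i) = k. c e * (\<Prod>i\<in>UNIV. (z $ i) ^ e i))}"

definition fun_scale :: "complex \<Rightarrow> (complex^'m \<Rightarrow> complex) \<Rightarrow> complex^'m \<Rightarrow> complex" where
  "fun_scale c p = (\<lambda>z. c * p z)"

definition pol_act :: "real^'m^'m \<Rightarrow> (complex^'m \<Rightarrow> complex) \<Rightarrow> complex^'m \<Rightarrow> complex" where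
  "pol_act g p = (\<lambda>z. p (map_matrix complex_of_real (matrix_inv g) *v z))"

definition is_poly ::
  "(real^'m^'m) set \<Rightarrow> nat \<Rightarrow> (real^'m^'m \<Rightarrow> complex^'d^'d) \<Rightarrow> bool" where
  "is_poly H k \<rho> \<longleftrightarrow> rep_equiv H \<rho> fun_scale (Pol k) pol_act"

(* \<rho>' is an admissible choice of the extension of the irreducible representation \<rho> of SL(n-1,R)
   to SL^\<plusminus>(n-1,R): the natural action if n >= 3 and \<rho> is poly^k, the trivial one if n = 2 (where
   \<rho> can only be triv), and otherwise arbitrary. *)
definition extension_of ::
  "(real^'m^'m \<Rightarrow> complex^'d^'d) \<Rightarrow> (real^'m^'m \<Rightarrow> complex^'d^'d) \<Rightarrow> bool" where
  "extension_of \<rho> \<rho>' \<longleftrightarrow> mat_rep SLpm \<rho>' \<and> (\<forall>g\<in>SL. \<rho>' g = \<rho> g) \<and>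
     (CARD('m) \<ge> 2 \<longrightarrow> (\<forall>k. is_poly SL k \<rho> \<longrightarrow> is_poly SLpm k \<rho>')) \<and>
     (CARD('m) = 1 \<longrightarrow> (\<forall>g\<in>SLpm. \<rho>' g = mat 1))"


section \<open>Smooth functions\<close>

primrec Ck_on ::
  "nat \<Rightarrow> ('a::real_normed_vector \<Rightarrow> 'b::real_normed_vector) \<Rightarrow> 'a set \<Rightarrow> bool" where
  "Ck_on 0 f S = continuous_on S f"
| "Ck_on (Suc k) f S =
     (f differentiable_on S \<and> (\<forall>v. Ck_on k (\<lambda>x. frechet_derivative f (at x) v) S))"

(* only used for open S *)
definition smooth_on :: "('a::real_normed_vector \<Rightarrow> 'b::real_normed_vector) \<Rightarrow> 'a set \<Rightarrow> bool" where
  "smooth_on f S \<longleftrightarrow> (\<forall>k. Ck_on k f S)"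

(* smoothness on the closed submanifold SL(n,R) of the space of matrices *)
definition smooth_on_SL :: "(real^'n^'n \<Rightarrow> complex^'d) \<Rightarrow> bool" where
  "smooth_on_SL f \<longleftrightarrow>
     (\<forall>g\<in>SL. \<exists>U F. open U \<and> g \<in> U \<and> smooth_on F U \<and> (\<forall>h\<in>U \<inter> SL. F h = f h))"

primrec partials ::
  "'m list \<Rightarrow> (real^'m::finite \<Rightarrow> 'b::real_normed_vector) \<Rightarrow> real^'m \<Rightarrow> 'b" where
  "partials [] F = F"
| "partials (j # js) F =
     (\<lambda>x. vector_derivative (\<lambda>t. partials js F (x + t *\<^sub>R axis j 1)) (at 0))"


section \<open>Induced representations\<close>

(* \<tau>(p) for p = M_elt g ** A_elt t ** N_plus_elt y; it does not depend on y. *)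
definition ind_char ::
  "sign \<Rightarrow> (real^'m^'m \<Rightarrow> complex^'d^'d) \<Rightarrow> complex \<Rightarrow> real^'m^'m \<Rightarrow> real \<Rightarrow> complex^'d^'d" where
  "ind_char \<alpha> \<rho> lam g t = mat (sign_char \<alpha> g * exp (lam * complex_of_real t)) ** \<rho> g"

(* I(\<rho>,lam)^\<alpha>.  Functions on G are represented by functions on all matrices that vanish off G. *)
definition Ind ::
  "sign \<Rightarrow> (real^'m^'m \<Rightarrow> complex^'d^'d) \<Rightarrow> complex \<Rightarrow>
   (real^('m option)^('m option) \<Rightarrow> complex^'d) set" where
  "Ind \<alpha> \<rho> lam = {f. (\<forall>x. x \<notin> SL \<longrightarrow> f x = 0) \<and> smooth_on_SL f \<and>
     (\<forall>x\<in>SL. \<forall>g\<in>SLpm. \<forall>t y.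
        f (x ** (M_elt g ** A_elt t ** N_plus_elt y)) = matrix_inv (ind_char \<alpha> \<rho> lam g t) *v f x)}"

definition left_trans :: "real^'n^'n \<Rightarrow> (real^'n^'n \<Rightarrow> 'b) \<Rightarrow> real^'n^'n \<Rightarrow> 'b" where
  "left_trans g f = (\<lambda>x. f (matrix_inv g ** x))"

definition linear_op_on ::
  "('g \<Rightarrow> complex^'a) set \<Rightarrow> (('g \<Rightarrow> complex^'a) \<Rightarrow> 'g \<Rightarrow> complex^'b) \<Rightarrow> bool" where
  "linear_op_on I D \<longleftrightarrow>
     (\<forall>f\<in>I. \<forall>h\<in>I. D (\<lambda>x. f x + h x) = (\<lambda>x. D f x + D h x)) \<and>
     (\<forall>f\<in>I. \<forall>c. D (\<lambda>x. c *s f x) = (\<lambda>x. c *s D f x))"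

(* In each chart and trivialization x \<mapsto> g ** N_minus_elt x, D is a linear partial differential
   operator with smooth matrix coefficients, of order at most N.  Lists of indices are used
   instead of multi-indices. *)
definition diff_op_on ::
  "(real^('m option)^('m option) \<Rightarrow> complex^'a) set \<Rightarrow>
   ((real^('m option)^('m option) \<Rightarrow> complex^'a) \<Rightarrow>
     real^('m::finite option)^('m option) \<Rightarrow> complex^'b) \<Rightarrow> bool" where
  "diff_op_on I D \<longleftrightarrow> (\<exists>N. \<forall>g\<in>SL. \<exists>a :: 'm list \<Rightarrow> real^'m \<Rightarrow> complex^'a^'b.
     (\<forall>js. smooth_on (a js) UNIV) \<and>
     (\<forall>f\<in>I. \<forall>x. D f (g ** N_minus_elt x) =
        (\<Sum>js | length js \<le> N. a js x *v partials js (\<lambda>y. f (g ** N_minus_elt y)) x)))"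

(* The operators are normalized to be zero outside of I, so that they are determined by their
   values on I. *)
definition Diff_G ::
  "(real^('m option)^('m option) \<Rightarrow> complex^'a) set \<Rightarrow>
   (real^('m option)^('m option) \<Rightarrow> complex^'b) set \<Rightarrow>
   ((real^('m::finite option)^('m option) \<Rightarrow> complex^'a) \<Rightarrow>
     real^('m option)^('m option) \<Rightarrow> complex^'b) set" where
  "Diff_G I I' = {D. (\<forall>f. f \<notin> I \<longrightarrow> D f = 0) \<and> (\<forall>f\<in>I. D f \<in> I') \<and>
     linear_op_on I D \<and> diff_op_on I D \<and>
     (\<forall>g\<in>SL. \<forall>f\<in>I. D (left_trans g f) = left_trans g (D f))}"

definition op_scale :: "complex \<Rightarrow> ('f \<Rightarrow> 'g \<Rightarrow> complex^'b) \<Rightarrow> 'f \<Rightarrow> 'g \<Rightarrow> complex^'b" where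
  "op_scale c D = (\<lambda>f x. c *s D f x)"

interpretation ops: vector_space op_scale
  by unfold_locales
    (simp_all add: op_scale_def fun_eq_iff vec.scale_right_distrib vec.scale_left_distrib)

abbreviation op_dim :: "('f \<Rightarrow> 'g \<Rightarrow> complex^'b) set \<Rightarrow> nat" where
  "op_dim \<equiv> vector_space.dim op_scale"


section \<open>The parameter set\<close>

(* (\<alpha>, \<beta>; \<rho>; lam, \<nu>) is in \<Lambda>^n_G, that is, equal to (\<alpha>, \<alpha>+k; poly^k; 1-k, 1+k/(n-1)) for some k.
   For n >= 3 the equality is componentwise.  For n = 2 it is read as equality of the labelled
   representations of M, with poly^k carrying the natural action of SL^\<plusminus>(1,R) = {1,-1} on
   Pol^k(C): the label (\<beta>, poly^k) for \<beta> = \<alpha>+k stands for C_\<beta> \<otimes> Pol^k(C).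
   Since -1 acts there by (-1)^k, this representation is C_\<alpha>.  With the trivial action instead,
   the central element -1 of SL(2,R) would act by different signs on the source and the target
   whenever k is odd. *)
definition in_Lambda ::
  "sign \<Rightarrow> sign \<Rightarrow> (real^'m^'m \<Rightarrow> complex^'d^'d) \<Rightarrow> (real^'m^'m \<Rightarrow> complex^'d^'d) \<Rightarrow>
   complex \<Rightarrow> complex \<Rightarrow> bool" where
  "in_Lambda \<alpha> \<beta> \<rho> \<rho>' lam \<nu> \<longleftrightarrow> (\<exists>k::nat.
     (if CARD('m) \<ge> 2 then \<beta> = sign_shift \<alpha> k \<and> is_poly SL k \<rho>
      else rep_equiv SLpm (\<lambda>g. mat (sign_char \<beta> g) ** \<rho>' g) fun_scale (Pol k)
             (\<lambda>g p. fun_scale (sign_char (sign_shift \<alpha> k) g) (pol_act g p))) \<and>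
     lam = 1 - of_nat k \<and> \<nu> = 1 + of_nat k / of_nat CARD('m))"

end

theory Submission
  imports Defs
begin

text \<open>
  Write \<open>m = n - 1\<close>. An element \<open>f\<close> of the source representation depends only on the first column of its argument
  (\<open>Ind_triv_col0\<close>): it is a smooth function on \<open>\<real>\<^sup>n\<close> without the origin that is homogeneous of degree \<open>-lam\<close>, up to the
  sign \<open>\<alpha>\<close>. A differential operator \<open>D\<close> commuting with translations is determined by the functional \<open>f \<mapsto> D f 1\<close>,
  and in the chart \<open>y \<mapsto> f (N_minus_elt y)\<close> this functional is a finite combination of partial derivatives at the origin.
  Equivariance under the parabolic subgroup \<open>P = M A N\<^sub>+\<close> then restricts it step by step.

  \<^item> \<open>A\<close> acts on the jets of order \<open>j\<close> by a character that depends on \<open>j\<close>. Hence only one order \<open>k\<close> occurs, and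
    \<open>\<nu> = lam + k (1 + 1/m)\<close>. By Schwarz's theorem the \<open>k\<close>-jet is a homogeneous polynomial, the Taylor form, so that
    \<open>D f x = S (taylor_form k (chart f x))\<close> for a linear map \<open>S\<close> from \<open>Pol k\<close> to the fibre.
  \<^item> \<open>M\<close> forces \<open>S\<close> to intertwine \<open>Pol k\<close>, twisted by a sign, with the given representation.
  \<^item> \<open>N\<^sub>+\<close> forces \<open>k = 0\<close> or \<open>lam = 1 - k\<close>: moving a test function with leading term \<open>q\<close> of degree \<open>k - 1\<close> creates the
    term \<open>(1 - k - lam) z\<^sub>i q\<close> of degree \<open>k\<close>, which \<open>S\<close> must kill.

  These three points are \<open>Diff_imp_taylor_op\<close>. The last two need functions in the representation with a prescribed leading
  Taylor coefficient; \<open>test_fun\<close> supplies them as homogeneous polynomials times a power of the norm, so no bump functions occur.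

  Conversely let \<open>S\<close> be such a map. If \<open>k > 0\<close> and \<open>lam = 1 - k\<close>, then \<open>f\<close> is homogeneous of degree \<open>k - 1\<close>, and along each line
  the element of \<open>N\<^sub>+\<close> acts by \<open>h(s) \<mapsto> (1 + c s)\<^sup>k\<^sup>-\<^sup>1 h(s / (1 + c s))\<close>. Bol's lemma says that this does not change the
  \<open>k\<close>-th derivative at \<open>0\<close>, so the Taylor form of order \<open>k\<close> is a section of the target bundle (\<open>taylor_op_in_Diff\<close>).

  It remains to understand \<open>S\<close>. The polynomial \<open>z\<^sub>i\<^sup>k\<close> is a highest weight vector: suitable diagonal matrices contract every
  polynomial to a multiple of it (\<open>highest_weight_vector\<close>), and its orbit spans \<open>Pol k\<close> (\<open>highest_weight_vector_zero\<close>). Therefore a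
  nonzero equivariant \<open>S\<close> is injective, and two of them are proportional, which gives dimension one. Since the target is
  irreducible, \<open>S\<close> is bijective, so the target is \<open>Pol k\<close> with the sign twist; comparing with the chosen extension of the
  representation to \<open>SL\<^sup>\<plusminus>\<close> turns this into the parameters of the theorem (\<open>ex_admissible_iff\<close>).
\<close>

section \<open>Calculus of smooth maps\<close>

lemma Ck_on_cong:
  assumes "open S" "\<And>x. x \<in> S \<Longrightarrow> f x = g x"
  shows "Ck_on k f S \<longleftrightarrow> Ck_on k g S"
  using assms(2)
proof (induction k arbitrary: f g)
  case 0
  then show ?case by (auto cong: continuous_on_cong)
next
  case (Suc k)
  have hd: "(f has_derivative D) (at x) \<longleftrightarrow> (g has_derivative D) (at x)" if "x \<in> S" for x D
    using has_derivative_transform_within_open[of f D x UNIV S g]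
      has_derivative_transform_within_open[of g D x UNIV S f] Suc.prems that assms(1) by auto
  have "frechet_derivative f (at x) = frechet_derivative g (at x)" if "x \<in> S" for x
    unfolding frechet_derivative_def using hd[OF that] by simp
  then have *: "Ck_on k (\<lambda>x. frechet_derivative f (at x) v) S
      \<longleftrightarrow> Ck_on k (\<lambda>x. frechet_derivative g (at x) v) S" for v
    by (intro Suc.IH) simp
  have "f differentiable_on S \<longleftrightarrow> g differentiable_on S"
    using hd assms(1) by (simp add: differentiable_on_eq_differentiable_at differentiable_def)
  with * show ?case by simp
qed

text \<open>The recursive clause of \<open>Ck_on\<close> speaks of \<open>frechet_derivative\<close>, which is inconvenient to compute with. This rule accepts any
  function that is known to be the derivative.\<close>

lemma Ck_on_SucI:
  assumes "open S" "\<And>x. x \<in> S \<Longrightarrow> (f has_derivative f' x) (at x)"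
    and "\<And>v. Ck_on k (\<lambda>x. f' x v) S"
  shows "Ck_on (Suc k) f S"
proof -
  have "f differentiable_on S"
    using assms(1,2) by (auto simp: differentiable_on_eq_differentiable_at differentiable_def)
  moreover have "Ck_on k (\<lambda>x. frechet_derivative f (at x) v) S" for v
    by (rule iffD1[OF Ck_on_cong[OF assms(1)] assms(3)])
      (use frechet_derivative_at[OF assms(2)] in simp)
  ultimately show ?thesis by simp
qed

lemma Ck_on_SucD:
  assumes "open S" "Ck_on (Suc k) f S" "x \<in> S"
  shows "(f has_derivative frechet_derivative f (at x)) (at x)"
  using assms by (auto simp: differentiable_on_eq_differentiable_at frechet_derivative_works)

lemma Ck_on_Suc_imp: "Ck_on (Suc k) f S \<Longrightarrow> Ck_on k f S"
proof (induction k arbitrary: f)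
  case 0
  then show ?case by (auto intro: differentiable_imp_continuous_on)
next
  case (Suc k)
  then show ?case by (metis Ck_on.simps(2))
qed

lemma Ck_on_subset:
  assumes "Ck_on k f S" "T \<subseteq> S"
  shows "Ck_on k f T"
  using assms(1)
proof (induction k arbitrary: f)
  case 0
  then show ?case using assms(2) continuous_on_subset by auto
next
  case (Suc k)
  then show ?case using assms(2) differentiable_on_subset by auto
qed

lemma Ck_on_local:
  assumes "\<And>x. x \<in> S \<Longrightarrow> \<exists>U. open U \<and> x \<in> U \<and> Ck_on k f U" "open S"
  shows "Ck_on k f S"
  using assms(1)
proof (induction k arbitrary: f)
  case 0
  then show ?case using assms(2)
    by (auto simp: continuous_on_eq_continuous_at) (metis continuous_on_eq_continuous_at)
next
  case (Suc k)
  have "f differentiable_on S"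
    using Suc.prems assms(2)
    by (auto simp: differentiable_on_eq_differentiable_at) (metis differentiable_on_eq_differentiable_at)
  moreover have "Ck_on k (\<lambda>x. frechet_derivative f (at x) v) S" for v
    using Suc.prems by (intro Suc.IH) (metis Ck_on.simps(2))
  ultimately show ?case by simp
qed

lemma Ck_on_const: "open S \<Longrightarrow> Ck_on k (\<lambda>x. c) S"
proof (induction k arbitrary: c)
  case (Suc k)
  show ?case
    by (rule Ck_on_SucI[where f' = "\<lambda>x v. 0"]) (use Suc in auto)
qed simp

lemma Ck_on_bounded_linear:
  assumes "open S" "bounded_linear h"
  shows "Ck_on k h S"
proof (cases k)
  case 0
  then show ?thesis by (simp add: assms linear_continuous_on)
next
  case (Suc n)
  then show ?thesis
    using assms by (auto intro: Ck_on_SucI Ck_on_const bounded_linear_imp_has_derivative simp del: Ck_on.simps)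
qed

lemma Ck_on_add:
  assumes "open S"
  shows "Ck_on k f S \<Longrightarrow> Ck_on k g S \<Longrightarrow> Ck_on k (\<lambda>x. f x + g x) S"
proof (induction k arbitrary: f g)
  case 0
  then show ?case by (auto intro: continuous_intros)
next
  case (Suc k)
  show ?case
  proof (rule Ck_on_SucI[OF assms])
    show "((\<lambda>x. f x + g x) has_derivative
        (\<lambda>v. frechet_derivative f (at x) v + frechet_derivative g (at x) v)) (at x)" if "x \<in> S" for x
      using Suc.prems that by (intro has_derivative_add) (auto intro: Ck_on_SucD[OF assms])
    show "Ck_on k (\<lambda>x. frechet_derivative f (at x) v + frechet_derivative g (at x) v) S" for v
      using Suc by simp
  qed
qed

lemma Ck_on_bilinear:
  assumes "open S" "bounded_bilinear B"
  shows "Ck_on k f S \<Longrightarrow> Ck_on k g S \<Longrightarrow> Ck_on k (\<lambda>x. B (f x) (g x)) S"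
proof (induction k arbitrary: f g)
  case 0
  then show ?case using bounded_bilinear.continuous_on[OF assms(2)] by simp
next
  case (Suc k)
  note fg = Ck_on_Suc_imp[OF Suc.prems(1)] Ck_on_Suc_imp[OF Suc.prems(2)]
  show ?case
  proof (rule Ck_on_SucI[OF assms(1)])
    show "((\<lambda>x. B (f x) (g x)) has_derivative
        (\<lambda>v. B (f x) (frechet_derivative g (at x) v) + B (frechet_derivative f (at x) v) (g x))) (at x)"
      if "x \<in> S" for x
      using Suc.prems that
      by (intro bounded_bilinear.FDERIV[OF assms(2)]) (auto intro: Ck_on_SucD[OF assms(1)])
    show "Ck_on k (\<lambda>x. B (f x) (frechet_derivative g (at x) v) + B (frechet_derivative f (at x) v) (g x)) S" for v
      using Suc fg by (intro Ck_on_add assms(1) Suc.IH) auto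
  qed
qed

lemma Ck_on_sum:
  assumes "open S" "\<And>i. i \<in> A \<Longrightarrow> Ck_on k (f i) S"
  shows "Ck_on k (\<lambda>x. \<Sum>i\<in>A. f i x) S"
  using assms(2)
proof (induction A rule: infinite_finite_induct)
  case (insert i A)
  then show ?case by (simp add: Ck_on_add assms(1))
qed (simp_all add: Ck_on_const assms(1))

text \<open>The chain rule gives \<open>f' (g x) (g' x v)\<close>, in which the direction depends on \<open>x\<close>, while \<open>Ck_on\<close> only knows derivatives in
  fixed directions. Expanding \<open>g' x v\<close> in a basis turns it into a finite sum of products to which the induction applies.\<close>

lemma Ck_on_compose:
  fixes f :: "'b::euclidean_space \<Rightarrow> 'c::real_normed_vector"
    and g :: "'a::real_normed_vector \<Rightarrow> 'b"
  assumes "open S" "open T" "g ` S \<subseteq> T"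
  shows "Ck_on k f T \<Longrightarrow> Ck_on k g S \<Longrightarrow> Ck_on k (\<lambda>x. f (g x)) S"
proof (induction k arbitrary: f)
  case 0
  then show ?case
    using continuous_on_compose2[OF _ _ assms(3)] by simp
next
  case (Suc k)
  note g = Ck_on_Suc_imp[OF Suc.prems(2)]
  define f' where "f' x = frechet_derivative f (at x)" for x
  define g' where "g' x = frechet_derivative g (at x)" for x
  show ?case
  proof (rule Ck_on_SucI[OF assms(1)])
    show "((\<lambda>x. f (g x)) has_derivative (\<lambda>v. \<Sum>b\<in>Basis. (g' x v \<bullet> b) *\<^sub>R f' (g x) b)) (at x)"
      if "x \<in> S" for x
    proof -
      have d: "(f has_derivative f' (g x)) (at (g x))"
        using Ck_on_SucD[OF assms(2) Suc.prems(1)] that assms(3) by (auto simp: f'_def)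
      interpret f': bounded_linear "f' (g x)"
        using d by (rule has_derivative_bounded_linear)
      have **: "((\<lambda>x. f (g x)) has_derivative (\<lambda>v. f' (g x) (g' x v))) (at x)"
        unfolding g'_def using has_derivative_compose[OF Ck_on_SucD[OF assms(1) Suc.prems(2) that] d] .
      have *: "f' (g x) w = (\<Sum>b\<in>Basis. (w \<bullet> b) *\<^sub>R f' (g x) b)" for w
      proof -
        have "f' (g x) (\<Sum>b\<in>Basis. (w \<bullet> b) *\<^sub>R b) = (\<Sum>b\<in>Basis. (w \<bullet> b) *\<^sub>R f' (g x) b)"
          by (simp only: f'.sum f'.scaleR)
        then show ?thesis by (simp only: euclidean_representation)
      qed
      have "(\<lambda>v. f' (g x) (g' x v)) = (\<lambda>v. \<Sum>b\<in>Basis. (g' x v \<bullet> b) *\<^sub>R f' (g x) b)"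
        by (rule ext, rule *)
      with ** show ?thesis by simp
    qed
    show "Ck_on k (\<lambda>x. \<Sum>b\<in>Basis. (g' x v \<bullet> b) *\<^sub>R f' (g x) b) S" for v
    proof (intro Ck_on_sum Ck_on_bilinear[OF _ bounded_bilinear_scaleR]
        Ck_on_bilinear[OF _ bounded_bilinear_inner] Ck_on_const assms(1))
      show "Ck_on k (\<lambda>x. g' x v) S" using Suc.prems(2) by (simp add: g'_def)
      show "Ck_on k (\<lambda>x. f' (g x) b) S" for b
        using Suc.IH[of "\<lambda>y. f' y b"] Suc.prems(1) g by (simp add: f'_def)
    qed
  qed
qed

lemma smooth_on_cong: "open S \<Longrightarrow> (\<And>x. x \<in> S \<Longrightarrow> f x = g x) \<Longrightarrow> smooth_on f S \<longleftrightarrow> smooth_on g S"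
  using Ck_on_cong unfolding smooth_on_def by metis

lemma smooth_on_subset: "smooth_on f S \<Longrightarrow> T \<subseteq> S \<Longrightarrow> smooth_on f T"
  using Ck_on_subset unfolding smooth_on_def by metis

lemma smooth_on_local:
  "open S \<Longrightarrow> (\<And>x. x \<in> S \<Longrightarrow> \<exists>U. open U \<and> x \<in> U \<and> smooth_on f U) \<Longrightarrow> smooth_on f S"
  unfolding smooth_on_def by (metis Ck_on_local)

lemma smooth_on_const: "open S \<Longrightarrow> smooth_on (\<lambda>x. c) S"
  using Ck_on_const unfolding smooth_on_def by metis

lemma smooth_on_bounded_linear: "open S \<Longrightarrow> bounded_linear h \<Longrightarrow> smooth_on h S"
  using Ck_on_bounded_linear unfolding smooth_on_def by metis

lemma smooth_on_id: "open S \<Longrightarrow> smooth_on (\<lambda>x. x) S"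
  by (simp add: smooth_on_bounded_linear bounded_linear_ident)

lemma smooth_on_add: "open S \<Longrightarrow> smooth_on f S \<Longrightarrow> smooth_on g S \<Longrightarrow> smooth_on (\<lambda>x. f x + g x) S"
  using Ck_on_add unfolding smooth_on_def by metis

lemma smooth_on_bilinear:
  "open S \<Longrightarrow> bounded_bilinear B \<Longrightarrow> smooth_on f S \<Longrightarrow> smooth_on g S \<Longrightarrow>
    smooth_on (\<lambda>x. B (f x) (g x)) S"
  using Ck_on_bilinear unfolding smooth_on_def by metis

lemma smooth_on_mult:
  fixes f g :: "'a::real_normed_vector \<Rightarrow> 'b::real_normed_algebra"
  shows "open S \<Longrightarrow> smooth_on f S \<Longrightarrow> smooth_on g S \<Longrightarrow> smooth_on (\<lambda>x. f x * g x) S"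
  using smooth_on_bilinear[OF _ bounded_bilinear_mult] by blast

lemma smooth_on_power:
  fixes f :: "'a::real_normed_vector \<Rightarrow> 'b::real_normed_algebra_1"
  shows "open S \<Longrightarrow> smooth_on f S \<Longrightarrow> smooth_on (\<lambda>x. f x ^ n) S"
  by (induction n) (simp_all add: smooth_on_const smooth_on_mult)

lemma smooth_on_sum:
  "open S \<Longrightarrow> (\<And>i. i \<in> A \<Longrightarrow> smooth_on (f i) S) \<Longrightarrow> smooth_on (\<lambda>x. \<Sum>i\<in>A. f i x) S"
  using Ck_on_sum unfolding smooth_on_def by metis

lemma smooth_on_prod:
  fixes f :: "'i \<Rightarrow> 'a::real_normed_vector \<Rightarrow> 'b::{real_normed_algebra_1, comm_ring_1}"
  assumes "open S" "\<And>i. i \<in> A \<Longrightarrow> smooth_on (f i) S"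
  shows "smooth_on (\<lambda>x. \<Prod>i\<in>A. f i x) S"
  using assms(2)
  by (induction A rule: infinite_finite_induct) (simp_all add: smooth_on_const smooth_on_mult assms(1))

lemma smooth_on_compose:
  fixes f :: "'b::euclidean_space \<Rightarrow> 'c::real_normed_vector"
  shows "open S \<Longrightarrow> open T \<Longrightarrow> smooth_on f T \<Longrightarrow> smooth_on g S \<Longrightarrow> g ` S \<subseteq> T \<Longrightarrow>
    smooth_on (\<lambda>x. f (g x)) S"
  using Ck_on_compose unfolding smooth_on_def by metis

lemma smooth_on_compose_linear:
  fixes f :: "'a::real_normed_vector \<Rightarrow> 'b::euclidean_space"
  assumes "open S" "bounded_linear h" "smooth_on f S"
  shows "smooth_on (\<lambda>x. h (f x)) S"
  by (rule smooth_on_compose[OF assms(1) open_UNIV smooth_on_bounded_linear[OF open_UNIV assms(2)] assms(3)]) simp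

lemma smooth_on_has_derivative:
  assumes "open S" "smooth_on f S" "x \<in> S"
  shows "(f has_derivative frechet_derivative f (at x)) (at x)"
  using assms Ck_on_SucD unfolding smooth_on_def by metis

lemma smooth_on_frechet_derivative: "smooth_on f S \<Longrightarrow> smooth_on (\<lambda>x. frechet_derivative f (at x) v) S"
  unfolding smooth_on_def by (metis Ck_on.simps(2))

lemma smooth_on_imp_continuous_on: "smooth_on f S \<Longrightarrow> continuous_on S f"
  unfolding smooth_on_def by (metis Ck_on.simps(1))

lemma smooth_onI_derivative:
  assumes "open S" "\<And>x. x \<in> S \<Longrightarrow> (f has_derivative f' x) (at x)"
    and "\<And>v. smooth_on (\<lambda>x. f' x v) S"
  shows "smooth_on f S"
  unfolding smooth_on_def
proof
  fix k show "Ck_on k f S"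
    using Ck_on_SucI[OF assms(1,2)] assms(3) Ck_on_Suc_imp unfolding smooth_on_def by metis
qed

text \<open>The derivative of the inverse is a product of inverses, so the induction on the order goes through by the product rule.\<close>

lemma smooth_on_inverse: "smooth_on (inverse :: real \<Rightarrow> real) {0<..}"
  unfolding smooth_on_def
proof
  fix k show "Ck_on k (inverse :: real \<Rightarrow> real) {0<..}"
  proof (induction k)
    case 0
    show ?case by (auto intro!: continuous_intros)
  next
    case (Suc k)
    show ?case
    proof (rule Ck_on_SucI)
      show "(inverse has_derivative (\<lambda>v. - (inverse x * v * inverse x))) (at x)" if "x \<in> {0<..}" for x :: real
        using that by (intro has_derivative_inverse') auto
      have "Ck_on k (\<lambda>x. (- v) * (inverse x * inverse x)) {0<..}" for v :: real
        by (intro Ck_on_bilinear[OF _ bounded_bilinear_mult] Suc Ck_on_const) auto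
      then show "Ck_on k (\<lambda>x. - (inverse x * v * inverse x)) {0<..}" for v :: real
        by (simp add: mult_ac)
    qed simp
  qed
qed

lemma smooth_on_ln: "smooth_on (ln :: real \<Rightarrow> real) {0<..}"
proof (rule smooth_onI_derivative)
  show "(ln has_derivative (\<lambda>v. v * inverse x)) (at x)" if "x \<in> {0<..}" for x :: real
    using DERIV_ln[of x] that unfolding has_field_derivative_def by (simp add: mult_commute_abs)
  show "smooth_on (\<lambda>x. v * inverse x) {0<..}" for v :: real
    by (intro smooth_on_mult smooth_on_inverse smooth_on_const) auto
qed simp

lemma smooth_on_exp: "smooth_on (exp :: complex \<Rightarrow> complex) UNIV"
  unfolding smooth_on_def
proof
  fix k show "Ck_on k (exp :: complex \<Rightarrow> complex) UNIV"
  proof (induction k)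
    case 0
    show ?case by (auto intro!: continuous_intros)
  next
    case (Suc k)
    show ?case
    proof (rule Ck_on_SucI)
      show "(exp has_derivative (\<lambda>v. v * exp x)) (at x)" for x :: complex
        using DERIV_exp[of x] unfolding has_field_derivative_def by (simp add: mult_commute_abs)
      show "Ck_on k (\<lambda>x. v * exp x) UNIV" for v :: complex
        by (intro Ck_on_bilinear[OF _ bounded_bilinear_mult] Suc Ck_on_const) auto
    qed simp
  qed
qed

section \<open>Iterated derivatives in one variable\<close>

text \<open>A sequence of successive derivatives, given as a whole. Products and compositions can then be described by writing down
  their sequence, without iterating \<open>vector_derivative\<close>, and derivatives of order \<open>n\<close> are compared through \<open>derivs_unique\<close>.\<close>

definition derivs :: "real set \<Rightarrow> (nat \<Rightarrow> real \<Rightarrow> complex) \<Rightarrow> bool" where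
  "derivs I h \<longleftrightarrow> (\<forall>n. \<forall>s\<in>I. (h n has_vector_derivative h (Suc n) s) (at s))"

lemma derivs_unique:
  assumes "open I" "derivs I g" "derivs I h" "\<And>s. s \<in> I \<Longrightarrow> g 0 s = h 0 s" "s \<in> I"
  shows "g n s = h n s"
  using assms(5)
proof (induction n arbitrary: s)
  case 0
  then show ?case by (simp add: assms(4))
next
  case (Suc n)
  have "(h n has_vector_derivative g (Suc n) s) (at s)"
    using assms(2) Suc.prems
    by (intro has_vector_derivative_transform_within_open[OF _ assms(1) Suc.prems Suc.IH])
      (auto simp: derivs_def)
  moreover have "(h n has_vector_derivative h (Suc n) s) (at s)"
    using assms(3) Suc.prems by (auto simp: derivs_def)
  ultimately show ?case by (rule vector_derivative_unique_at)
qed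

lemma smooth_on_derivs:
  assumes "open I" "smooth_on f I"
  obtains h where "h 0 = f" "derivs I h"
proof -
  define D where "D g s = frechet_derivative g (at s) 1" for g :: "real \<Rightarrow> complex" and s
  define h where "h n = (D ^^ n) f" for n
  have smooth: "smooth_on (h n) I" for n
    by (induction n) (simp_all add: h_def D_def assms(2) smooth_on_frechet_derivative)
  have "(h n has_vector_derivative h (Suc n) s) (at s)" if "s \<in> I" for n s
  proof -
    have d: "(h n has_derivative frechet_derivative (h n) (at s)) (at s)"
      by (rule smooth_on_has_derivative[OF assms(1) smooth that])
    then interpret bounded_linear "frechet_derivative (h n) (at s)"
      by (rule has_derivative_bounded_linear)
    have lin: "frechet_derivative (h n) (at s) x = x *\<^sub>R h (Suc n) s" for x
      using scaleR[of x 1] by (simp add: h_def D_def)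
    have "frechet_derivative (h n) (at s) = (\<lambda>x. x *\<^sub>R h (Suc n) s)"
      by (rule ext) (rule lin)
    with d show ?thesis by (simp add: has_vector_derivative_def)
  qed
  then show thesis
    using that[of h] by (auto simp: derivs_def h_def)
qed

lemma derivs_imp_smooth_on:
  assumes "open I" "derivs I h"
  shows "smooth_on (h n) I"
  unfolding smooth_on_def
proof
  fix k show "Ck_on k (h n) I"
  proof (induction k arbitrary: n)
    case 0
    show ?case using assms(2)
      by (auto simp: derivs_def intro!: continuous_at_imp_continuous_on has_vector_derivative_continuous)
  next
    case (Suc k)
    show ?case
    proof (rule Ck_on_SucI[OF assms(1)])
      show "(h n has_derivative (\<lambda>v. v *\<^sub>R h (Suc n) s)) (at s)" if "s \<in> I" for s
        using assms(2) that by (auto simp: derivs_def has_vector_derivative_def)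
      show "Ck_on k (\<lambda>s. v *\<^sub>R h (Suc n) s) I" for v
        by (intro Ck_on_bilinear[OF _ bounded_bilinear_scaleR] Ck_on_const Suc assms(1))
    qed
  qed
qed

text \<open>An affine factor contributes only two terms to Leibniz's rule. At \<open>n = 0\<close> the truncated index
  \<open>n - 1 = 0\<close> is harmless because of the factor \<open>n\<close>.\<close>

lemma derivs_affine:
  assumes "derivs I h"
  shows "derivs I (\<lambda>n s. of_real (p + q * s) * h n s + of_nat n * of_real q * h (n - 1) s)"
  unfolding derivs_def
proof (intro allI ballI)
  fix n s assume s: "s \<in> I"
  have d[derivative_intros]: "(h n has_vector_derivative h (Suc n) s) (at s)" for n
    using assms s by (simp add: derivs_def)
  have a: "((\<lambda>s. of_real (p + q * s) * h n s) has_vector_derivative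
      of_real (p + q * s) * h (Suc n) s + of_real q * h n s) (at s)"
    by (auto intro!: derivative_eq_intros simp: scaleR_conv_of_real)
  show "((\<lambda>s. of_real (p + q * s) * h n s + of_nat n * of_real q * h (n - 1) s) has_vector_derivative
      of_real (p + q * s) * h (Suc n) s + of_nat (Suc n) * of_real q * h (Suc n - 1) s) (at s)"
  proof (cases n)
    case 0
    then show ?thesis using a by simp
  next
    case (Suc n')
    have "((\<lambda>s. of_nat n * of_real q * h n' s) has_vector_derivative of_nat n * of_real q * h n s) (at s)"
      using d[of n'] Suc by (auto intro!: derivative_eq_intros)
    from has_vector_derivative_add[OF a this] show ?thesis
      by (simp add: Suc algebra_simps)
  qed
qed

text \<open>The leading Taylor coefficients of \<open>s\<^sup>j h(s)\<close>, by \<open>j\<close> applications of Leibniz's rule with the factor \<open>s\<close>.\<close>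

lemma derivs_power_times:
  assumes "derivs I h"
  obtains g where "derivs I g" "\<And>s. g 0 s = of_real s ^ j * h 0 s"
    and "\<And>n. g n 0 = (if n < j then 0 else fact n / fact (n - j) * h (n - j) 0)"
proof -
  have "\<exists>g. derivs I g \<and> (\<forall>s. g 0 s = of_real s ^ j * h 0 s) \<and>
    (\<forall>n. g n 0 = (if n < j then 0 else fact n / fact (n - j) * h (n - j) 0))"
  proof (induction j)
    case 0
    show ?case using assms by (intro exI[of _ h]) auto
  next
    case (Suc j)
    then obtain g where g: "derivs I g" "\<And>s. g 0 s = of_real s ^ j * h 0 s"
      "\<And>n. g n 0 = (if n < j then 0 else fact n / fact (n - j) * h (n - j) 0)" by blast
    show ?case
    proof (intro exI[of _ "\<lambda>n s. of_real (0 + 1 * s) * g n s + of_nat n * of_real 1 * g (n - 1) s"] conjI allI)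
      show "derivs I (\<lambda>n s. of_real (0 + 1 * s) * g n s + of_nat n * of_real 1 * g (n - 1) s)"
        by (rule derivs_affine[OF g(1)])
      show "of_real (0 + 1 * 0) * g n 0 + of_nat n * of_real 1 * g (n - 1) 0 =
          (if n < Suc j then 0 else fact n / fact (n - Suc j) * h (n - Suc j) 0)" for n
        by (cases n) (auto simp: g(3))
    qed (simp add: g(2))
  qed
  then show thesis using that by blast
qed

text \<open>Bol's lemma. With \<open>w = 1 + c s\<close> the function of weight \<open>k + 1\<close> is \<open>w\<close> times the one of weight \<open>k\<close>. So Leibniz's rule
  expresses its derivative of order \<open>k + 2\<close> by the known derivative of order \<open>k + 1\<close> and the derivative of that; the terms in which
  the power of \<open>w\<close> is differentiated cancel.\<close>

lemma Bol:
  fixes c :: real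
  defines "I \<equiv> {s. 0 < 1 + c * s}"
  assumes h: "derivs UNIV h"
    and g: "derivs I g" "\<And>s. s \<in> I \<Longrightarrow> g 0 s = of_real (1 + c * s) ^ k * h 0 (s / (1 + c * s))"
    and s: "s \<in> I"
  shows "g (Suc k) s = h (Suc k) (s / (1 + c * s)) / of_real (1 + c * s) ^ (k + 2)"
  using g s
proof (induction k arbitrary: g s)
  have openI: "open I"
    unfolding I_def by (intro open_Collect_less continuous_intros)
  define u where "u s = s / (1 + c * s)" for s
  have du: "(u has_real_derivative 1 / (1 + c * s)^2) (at s)" if "s \<in> I" for s
    using that unfolding u_def I_def
    by (auto intro!: derivative_eq_intros simp: power2_eq_square field_simps)
  have dh: "((\<lambda>s. h n (u s)) has_vector_derivative h (Suc n) (u s) / of_real (1 + c * s)^2) (at s)"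
    if "s \<in> I" for n s
  proof -
    have "((\<lambda>s. h n (u s)) has_vector_derivative (1 / (1 + c * s)^2) *\<^sub>R h (Suc n) (u s)) (at s)"
      using vector_diff_chain_at[of u "1 / (1 + c * s)^2" s "h n" "h (Suc n) (u s)"] du[OF that] h
      by (auto simp: derivs_def has_real_derivative_iff_has_vector_derivative o_def)
    then show ?thesis by (simp add: scaleR_conv_of_real)
  qed
  {
    case 0
    have "(g 0 has_vector_derivative g (Suc 0) s) (at s)"
      using 0 by (auto simp: derivs_def)
    then have "((\<lambda>s. h 0 (u s)) has_vector_derivative g (Suc 0) s) (at s)"
      by (rule has_vector_derivative_transform_within_open[OF _ openI]) (use 0 in \<open>auto simp: u_def\<close>)
    from vector_derivative_unique_at[OF this dh] 0 show ?case by (simp add: u_def power2_eq_square)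
  next
    case (Suc k)
    define w where "w s = complex_of_real (1 + c * s)" for s
    have w: "w s \<noteq> 0" if "s \<in> I" for s
      unfolding w_def of_real_eq_0_iff using that by (simp add: I_def)
    have dw: "(w has_vector_derivative of_real c) (at s)" for s
      unfolding w_def by (auto intro!: derivative_eq_intros)
    have "smooth_on (\<lambda>s. w s ^ k * h 0 (u s)) I"
    proof (intro smooth_on_mult smooth_on_power openI)
      show "smooth_on w I"
        unfolding w_def
        by (intro smooth_on_compose_linear[OF _ bounded_linear_of_real] smooth_on_add smooth_on_mult
            smooth_on_const smooth_on_id openI)
      have "smooth_on u I"
      proof -
        have "smooth_on (\<lambda>s. s * inverse (1 + c * s)) I"
          by (rule smooth_on_mult[OF openI smooth_on_id[OF openI]],
              rule smooth_on_compose[OF openI open_greaterThan smooth_on_inverse])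
            (use openI in \<open>auto intro!: smooth_on_add smooth_on_mult smooth_on_const smooth_on_id simp: I_def\<close>)
        then show ?thesis by (simp add: u_def[abs_def] divide_inverse)
      qed
      then show "smooth_on (\<lambda>s. h 0 (u s)) I"
        by (intro smooth_on_compose[OF openI open_UNIV derivs_imp_smooth_on[OF open_UNIV h]]) auto
    qed
    then obtain f where f: "f 0 = (\<lambda>s. w s ^ k * h 0 (u s))" "derivs I f"
      using smooth_on_derivs[OF openI] by metis
    \<comment> \<open>The sequence \<open>f\<close> belongs to weight \<open>k\<close>; the one for weight \<open>k + 1\<close> is obtained from it by \<open>derivs_affine\<close>.\<close>
    have fk: "f (Suc k) s = h (Suc k) (u s) / w s ^ (k + 2)" if "s \<in> I" for s
      using Suc.IH[OF f(2) _ that] f(1) by (auto simp: u_def w_def)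
    have "(f (Suc k) has_vector_derivative f (Suc (Suc k)) s) (at s)"
      using f(2) Suc.prems(3) by (auto simp: derivs_def)
    then have d1: "((\<lambda>s. h (Suc k) (u s) / w s ^ (k + 2)) has_vector_derivative f (Suc (Suc k)) s) (at s)"
      by (rule has_vector_derivative_transform_within_open[OF _ openI Suc.prems(3) fk])
    have d2: "((\<lambda>s. h (Suc k) (u s)) has_vector_derivative w s ^ (k + 2) * f (Suc (Suc k)) s
        + of_nat (k + 2) * of_real c * w s ^ (k + 1) * (h (Suc k) (u s) / w s ^ (k + 2))) (at s)"
    proof -
      have dwp: "((\<lambda>s. w s ^ n) has_vector_derivative of_nat n * of_real c * w s ^ (n - 1)) (at s)" for n
      proof -
        have "((\<lambda>s. (1 + c * s) ^ n) has_real_derivative of_nat n * c * (1 + c * s) ^ (n - 1)) (at s)"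
          by (auto intro!: derivative_eq_intros)
        from has_vector_derivative_of_real[OF this]
        show ?thesis by (simp add: w_def)
      qed
      have "((\<lambda>s. w s ^ (k + 2) * (h (Suc k) (u s) / w s ^ (k + 2))) has_vector_derivative
          w s ^ (k + 2) * f (Suc (Suc k)) s
        + of_nat (k + 2) * of_real c * w s ^ (k + 1) * (h (Suc k) (u s) / w s ^ (k + 2))) (at s)"
        using has_vector_derivative_mult[OF dwp[of "k + 2"] d1] by simp
      then show ?thesis
        by (rule has_vector_derivative_transform_within_open[OF _ openI Suc.prems(3)]) (auto simp: w)
    qed
    have "h (Suc (Suc k)) (u s) / w s ^ 2 = w s ^ (k + 2) * f (Suc (Suc k)) s
        + of_nat (k + 2) * of_real c * w s ^ (k + 1) * (h (Suc k) (u s) / w s ^ (k + 2))"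
      using vector_derivative_unique_at[OF dh[OF Suc.prems(3), of "Suc k"]] d2 by (simp add: w_def)
    then have E: "h (Suc (Suc k)) (u s) / w s ^ 2 = w s ^ (k + 2) * f (Suc (Suc k)) s
        + of_nat (k + 2) * of_real c * w s ^ (k + 1) * f (Suc k) s"
      by (simp only: fk[OF Suc.prems(3)])
    have "h (Suc (Suc k)) (u s) / w s ^ (k + 3) = (h (Suc (Suc k)) (u s) / w s ^ 2) / w s ^ (k + 1)"
      by (simp add: power_add power2_eq_square power3_eq_cube mult_ac)
    also have "\<dots> = w s * f (Suc (Suc k)) s + of_nat (k + 2) * of_real c * f (Suc k) s"
      unfolding E using w[OF Suc.prems(3)] by (simp add: divide_simps) (simp add: algebra_simps)
    finally have key: "w s * f (Suc (Suc k)) s + of_nat (k + 2) * of_real c * f (Suc k) s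
        = h (Suc (Suc k)) (u s) / w s ^ (k + 3)" by simp
    have "g (Suc (Suc k)) s = of_real (1 + c * s) * f (Suc (Suc k)) s
        + of_nat (Suc (Suc k)) * of_real c * f (Suc (Suc k) - 1) s"
      by (rule derivs_unique[OF openI Suc.prems(1) derivs_affine[OF f(2)] _ Suc.prems(3)])
        (simp add: Suc.prems(2) f(1) u_def w_def mult_ac)
    with key show ?case by (simp add: w_def u_def power3_eq_cube power_add mult_ac)
  }
qed

section \<open>Mixed partial derivatives\<close>

lemma smooth_has_line_derivative:
  assumes "smooth_on F UNIV"
  shows "((\<lambda>t. F (x + t *\<^sub>R v)) has_vector_derivative frechet_derivative F (at (x + s *\<^sub>R v)) v) (at s)"
proof -
  have d: "(F has_derivative frechet_derivative F (at (x + s *\<^sub>R v))) (at (x + s *\<^sub>R v))"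
    by (rule smooth_on_has_derivative[OF open_UNIV assms]) simp
  have "((\<lambda>t. x + t *\<^sub>R v) has_derivative (\<lambda>t. t *\<^sub>R v)) (at s)"
    by (auto intro!: derivative_eq_intros)
  from has_derivative_compose[OF this d] show ?thesis
    unfolding has_vector_derivative_def
    using linear_simps(5)[OF has_derivative_bounded_linear[OF d]] by simp
qed

lemma partials_Cons:
  assumes "smooth_on (partials js F) UNIV"
  shows "partials (j # js) F = (\<lambda>x. frechet_derivative (partials js F) (at x) (axis j 1))"
  using vector_derivative_at[OF smooth_has_line_derivative[OF assms, of _ _ 0]] by (simp add: fun_eq_iff)

lemma smooth_partials: "smooth_on F UNIV \<Longrightarrow> smooth_on (partials js F) UNIV"
proof (induction js)
  case (Cons j js)
  then have "smooth_on (partials js F) UNIV" by simp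
  from smooth_on_frechet_derivative[OF this] show ?case by (simp add: partials_Cons[OF \<open>smooth_on (partials js F) UNIV\<close>] del: partials.simps)
qed simp

lemma partials_append: "partials (js @ ks) F = partials js (partials ks F)"
  by (induction js) auto

lemma partials_has_derivative:
  assumes "smooth_on F UNIV"
  shows "((\<lambda>t. partials js F (x + t *\<^sub>R axis j 1)) has_vector_derivative partials (j # js) F (x + s *\<^sub>R axis j 1)) (at s)"
  using smooth_has_line_derivative[OF smooth_partials[OF assms]]
  by (simp add: partials_Cons[OF smooth_partials[OF assms]] del: partials.simps)

lemma partials_has_line_derivative:
  fixes F :: "real^'m \<Rightarrow> 'b::real_normed_vector"
  assumes "smooth_on F UNIV"
  shows "((\<lambda>s. partials js F (s *\<^sub>R z)) has_vector_derivative
    (\<Sum>j\<in>UNIV. (z $ j) *\<^sub>R partials (j # js) F (s *\<^sub>R z))) (at s)"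
proof -
  note sm = smooth_partials[OF assms, of js]
  interpret bounded_linear "frechet_derivative (partials js F) (at (s *\<^sub>R z))"
    by (rule has_derivative_bounded_linear[OF smooth_on_has_derivative[OF open_UNIV sm]]) simp
  have "frechet_derivative (partials js F) (at (s *\<^sub>R z)) (\<Sum>j\<in>UNIV. (z $ j) *\<^sub>R axis j 1)
      = (\<Sum>j\<in>UNIV. (z $ j) *\<^sub>R partials (j # js) F (s *\<^sub>R z))"
    by (simp add: partials_Cons[OF sm] sum scaleR del: partials.simps)
  moreover have "(\<Sum>j\<in>UNIV. (z $ j) *\<^sub>R axis j (1::real)) = z"
    using basis_expansion[of z] by (simp add: scalar_mult_eq_scaleR)
  ultimately show ?thesis
    using smooth_has_line_derivative[OF sm, of 0 z s] by simp
qed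

lemma partials_bounded_linear:
  assumes "bounded_linear h" "smooth_on F UNIV"
  shows "partials js (\<lambda>y. h (F y)) = (\<lambda>x. h (partials js F x))"
proof (induction js)
  case (Cons j js)
  have "((\<lambda>t. h (partials js F (x + t *\<^sub>R axis j 1))) has_vector_derivative h (partials (j # js) F x)) (at 0)" for x
    using bounded_linear.has_vector_derivative[OF assms(1) partials_has_derivative[OF assms(2), of js x j 0]] by simp
  from vector_derivative_at[OF this] show ?case by (simp only: partials.simps(2) Cons.IH)
qed simp

lemma partials_sum:
  assumes "\<And>i. i \<in> A \<Longrightarrow> smooth_on (f i) UNIV"
  shows "partials js (\<lambda>y. \<Sum>i\<in>A. f i y) = (\<lambda>x. \<Sum>i\<in>A. partials js (f i) x)"
proof (induction js)
  case (Cons j js)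
  have "((\<lambda>t. \<Sum>i\<in>A. partials js (f i) (x + t *\<^sub>R axis j 1)) has_vector_derivative
      (\<Sum>i\<in>A. partials (j # js) (f i) x)) (at 0)" for x
    using partials_has_derivative[OF assms, of _ js x j 0] by (intro has_vector_derivative_sum) simp
  from vector_derivative_at[OF this] show ?case by (simp only: partials.simps(2) Cons.IH)
qed simp

lemma partials_add:
  assumes "smooth_on F UNIV" "smooth_on G UNIV"
  shows "partials js (\<lambda>y. F y + G y) = (\<lambda>x. partials js F x + partials js G x)"
proof (induction js)
  case (Cons j js)
  have "((\<lambda>t. partials js F (x + t *\<^sub>R axis j 1) + partials js G (x + t *\<^sub>R axis j 1)) has_vector_derivative
      partials (j # js) F x + partials (j # js) G x) (at 0)" for x
    using partials_has_derivative[OF assms(1), of js x j 0] partials_has_derivative[OF assms(2), of js x j 0]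
    by (intro has_vector_derivative_add) simp_all
  from vector_derivative_at[OF this] show ?case by (simp only: partials.simps(2) Cons.IH)
qed simp

lemma partials_zero: "partials js (\<lambda>y. 0) = (\<lambda>x. 0)"
  by (induction js) simp_all

lemma partials_cmult:
  fixes F :: "real^'m \<Rightarrow> complex"
  assumes "smooth_on F UNIV"
  shows "partials js (\<lambda>y. c * F y) = (\<lambda>x. c * partials js F x)"
  by (rule partials_bounded_linear[OF bounded_linear_mult_right assms])

text \<open>Schwarz's theorem: differentiate under the integral sign in
  \<open>F(x + s e\<^sub>i + t e\<^sub>j) - F(x + s e\<^sub>i) = \<integral> \<partial>\<^sub>j F\<close>.\<close>

lemma partials_commute:
  fixes F :: "real^'m \<Rightarrow> complex"
  assumes "smooth_on F UNIV"
  shows "partials [i, j] F = partials [j, i] F"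
proof
  fix x0 :: "real^'m"
  define a b where "a = axis i (1::real)" and "b = axis j (1::real)"
  \<comment> \<open>The base point is shifted so that \<open>x0\<close> lies in the interior of the interval of integration.\<close>
  define x where "x = x0 - b"
  define p where "p s t = x + s *\<^sub>R a + t *\<^sub>R b" for s t
  have pa: "((\<lambda>s. partials js F (p s t)) has_vector_derivative partials (i # js) F (p s t)) (at s)" for js s t
    using partials_has_derivative[OF assms, of js "x + t *\<^sub>R b" i s] by (simp add: p_def a_def algebra_simps)
  have pb: "((\<lambda>t. partials js F (p s t)) has_vector_derivative partials (j # js) F (p s t)) (at t)" for js s t
    using partials_has_derivative[OF assms, of js "x + s *\<^sub>R a" j t] by (simp add: p_def b_def algebra_simps)
  have cont: "continuous_on S (\<lambda>z. partials js F (p (f z) (g z)))"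
    if "continuous_on S f" "continuous_on S g" for js S and f g :: "'z::topological_space \<Rightarrow> real"
    using smooth_on_imp_continuous_on[OF smooth_partials[OF assms]]
    by (rule continuous_on_compose2) (auto simp: p_def intro!: continuous_intros that)
  have ftc: "integral {0..t} (\<lambda>u. partials (j # js) F (p s u)) = partials js F (p s t) - partials js F (p s 0)"
    if "0 \<le> t" for js s t
    by (intro integral_unique fundamental_theorem_of_calculus that has_vector_derivative_at_within[OF pb])
  have eq: "integral {0..t} (\<lambda>u. partials (i # j # []) F (p 0 u)) = partials [i] F (p 0 t) - partials [i] F (p 0 0)"
    if t: "0 \<le> t" for t
  proof -
    have "((\<lambda>s. integral (cbox 0 t) (\<lambda>u. partials [j] F (p s u))) has_vector_derivative
        integral (cbox 0 t) (\<lambda>u. partials [i, j] F (p 0 u))) (at 0 within UNIV)"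
    proof (rule leibniz_rule_vector_derivative)
      show "((\<lambda>s. partials [j] F (p s u)) has_vector_derivative partials [i, j] F (p s u)) (at s within UNIV)" for s u
        using pa by (simp del: partials.simps)
      show "(\<lambda>u. partials [j] F (p s u)) integrable_on cbox 0 t" for s
        by (intro integrable_continuous cont continuous_intros)
      show "continuous_on (UNIV \<times> cbox 0 t) (\<lambda>(s, u). partials [i, j] F (p s u))"
        unfolding case_prod_unfold by (intro cont continuous_intros)
    qed auto
    then have "((\<lambda>s. partials [] F (p s t) - partials [] F (p s 0)) has_vector_derivative
        integral {0..t} (\<lambda>u. partials [i, j] F (p 0 u))) (at 0)"
      using ftc[OF t, of "[]"] by (simp del: partials.simps)
    moreover have "((\<lambda>s. partials [] F (p s t) - partials [] F (p s 0)) has_vector_derivative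
        partials [i] F (p 0 t) - partials [i] F (p 0 0)) (at 0)"
      by (intro has_vector_derivative_diff pa)
    ultimately show ?thesis by (rule vector_derivative_unique_at)
  qed
  have "((\<lambda>t. integral {0..t} (\<lambda>u. partials [i, j] F (p 0 u))) has_vector_derivative partials [i, j] F (p 0 1))
      (at 1 within {0..2})"
    by (intro integral_has_vector_derivative cont continuous_intros) auto
  then have "((\<lambda>t. integral {0..t} (\<lambda>u. partials [i, j] F (p 0 u))) has_vector_derivative partials [i, j] F (p 0 1)) (at 1)"
    using at_within_interior[of "1::real" "{0..2}"] by (simp del: partials.simps)
  then have "((\<lambda>t. partials [i] F (p 0 t) - partials [i] F (p 0 0)) has_vector_derivative partials [i, j] F (p 0 1)) (at 1)"
    by (rule has_vector_derivative_transform_within_open[of _ _ _ "{0<..}"]) (auto simp: eq simp del: partials.simps)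
  moreover have "((\<lambda>t. partials [i] F (p 0 t) - partials [i] F (p 0 0)) has_vector_derivative partials [j, i] F (p 0 1) - 0) (at 1)"
    by (intro has_vector_derivative_diff pb has_vector_derivative_const)
  ultimately have "partials [i, j] F (p 0 1) = partials [j, i] F (p 0 1)"
    using vector_derivative_unique_at by fastforce
  then show "partials [i, j] F x0 = partials [j, i] F x0"
    by (simp add: p_def x_def del: partials.simps)
qed

text \<open>Adjacent entries commute by Schwarz's theorem, so any entry can be moved to the front.\<close>

lemma partials_mset_cong:
  fixes F :: "real^'m \<Rightarrow> complex"
  assumes "smooth_on F UNIV" "mset js = mset ks"
  shows "partials js F = partials ks F"
proof -
  have swap: "partials (as @ [j]) G = partials (j # as) G" if "smooth_on G UNIV" for as j and G :: "real^'m \<Rightarrow> complex"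
  proof (induction as)
    case (Cons a as)
    have "partials ((a # as) @ [j]) G = partials [a, j] (partials as G)"
      using Cons by simp
    also have "\<dots> = partials [j, a] (partials as G)"
      by (rule partials_commute[OF smooth_partials[OF that]])
    finally show ?case by simp
  qed simp
  show ?thesis
    using assms(2)
  proof (induction js arbitrary: ks)
    case (Cons j js)
    then have "j \<in> set ks" by (metis list.set_intros(1) set_mset_mset)
    then obtain as bs where ks: "ks = as @ j # bs" by (meson split_list)
    with Cons have "partials js F = partials (as @ bs) F" by simp
    moreover have "partials ks F = partials (j # as @ bs) F"
      using swap[OF smooth_partials[OF assms(1)], of as j bs]
      by (simp add: ks partials_append[symmetric] del: partials.simps)
    ultimately show ?case by simp
  qed simp
qed

section \<open>Homogeneous polynomials and Taylor forms\<close>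

definition cvec :: "real^'m \<Rightarrow> complex^'m" where
  "cvec y = (\<chi> i. complex_of_real (y $ i))"

definition monomial :: "('m \<Rightarrow> nat) \<Rightarrow> complex^'m \<Rightarrow> complex" where
  "monomial e z = (\<Prod>i\<in>UNIV. (z $ i) ^ e i)"

lemma cvec_nth [simp]: "cvec y $ i = complex_of_real (y $ i)"
  by (simp add: cvec_def)

lemma cvec_scaleR: "cvec (s *\<^sub>R y) = complex_of_real s *s cvec y"
  by (simp add: vec_eq_iff)

lemma map_matrix_cvec: "map_matrix complex_of_real A *v cvec y = cvec (A *v y)"
  by (simp add: vec_eq_iff matrix_vector_mult_def map_matrix_def)

lemma monomial_add: "monomial (\<lambda>i. d i + e i) z = monomial d z * monomial e z"
  by (simp add: monomial_def power_add prod.distrib)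

lemma monomial_count_Cons:
  "monomial (count_list (j # js)) z = z $ j * monomial (count_list js) z"
proof -
  have "monomial (count_list (j # js)) z = (\<Prod>i\<in>UNIV. (if i = j then z $ i else 1) * (z $ i) ^ count_list js i)"
    unfolding monomial_def by (intro prod.cong) auto
  then show ?thesis by (simp add: prod.distrib monomial_def)
qed

lemma monomial_scale: "monomial e (c *s z) = c ^ sum e UNIV * monomial e z"
  by (simp add: monomial_def power_mult_distrib prod.distrib power_sum)

lemma smooth_monomial: "smooth_on (\<lambda>y. monomial e (cvec y)) UNIV"
proof -
  have "smooth_on (\<lambda>y::real^'a. complex_of_real (y $ i)) UNIV" for i
    using bounded_linear_compose[OF bounded_linear_of_real bounded_linear_vec_nth]
    by (rule smooth_on_bounded_linear[OF open_UNIV])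
  then show ?thesis
    unfolding monomial_def cvec_nth by (intro smooth_on_prod smooth_on_power open_UNIV)
qed

lemma finite_degree: "finite {e :: 'm::finite \<Rightarrow> nat. sum e UNIV = k}"
proof (rule finite_subset)
  show "{e :: 'm \<Rightarrow> nat. sum e UNIV = k} \<subseteq> Pi\<^sub>E UNIV (\<lambda>_. {..k})"
    by (auto intro: member_le_sum)
  show "finite (Pi\<^sub>E (UNIV :: 'm set) (\<lambda>_. {..k}))"
    by (intro finite_PiE) auto
qed

lemma finite_lists_length: "finite {js :: 'm::finite list. length js = n}"
  using finite_lists_length_eq[of "UNIV :: 'm set" n] by simp

lemma Pol_altdef: "Pol k = {p. \<exists>c. p = (\<lambda>z. \<Sum>e | sum e UNIV = k. c e * monomial e z)}"
  by (simp add: Pol_def monomial_def)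

lemma PolE:
  assumes "p \<in> Pol k"
  obtains c where "p = (\<lambda>z. \<Sum>e | sum e UNIV = k. c e * monomial e z)"
  using assms unfolding Pol_altdef by blast

lemma Pol_zero: "(\<lambda>z. 0) \<in> Pol k"
  unfolding Pol_altdef by (auto intro!: exI[of _ "\<lambda>_. 0"])

lemma Pol_add:
  assumes "p \<in> Pol k" "q \<in> Pol k"
  shows "(\<lambda>z. p z + q z) \<in> Pol k"
proof -
  obtain c where p: "p = (\<lambda>z. \<Sum>e | sum e UNIV = k. c e * monomial e z)"
    using assms(1) by (rule PolE)
  obtain d where q: "q = (\<lambda>z. \<Sum>e | sum e UNIV = k. d e * monomial e z)"
    using assms(2) by (rule PolE)
  from p q have "(\<lambda>z. p z + q z) = (\<lambda>z. \<Sum>e | sum e UNIV = k. (c e + d e) * monomial e z)"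
    by (simp add: sum.distrib distrib_right)
  then show ?thesis
    unfolding Pol_altdef by (intro CollectI exI)
qed

lemma Pol_cmult:
  assumes "p \<in> Pol k"
  shows "(\<lambda>z. a * p z) \<in> Pol k"
proof -
  obtain c where "p = (\<lambda>z. \<Sum>e | sum e UNIV = k. c e * monomial e z)"
    using assms by (rule PolE)
  then have "(\<lambda>z. a * p z) = (\<lambda>z. \<Sum>e | sum e UNIV = k. (a * c e) * monomial e z)"
    by (simp add: sum_distrib_left mult.assoc)
  then show ?thesis
    unfolding Pol_altdef by (intro CollectI exI)
qed

lemma Pol_sum: "(\<And>i. i \<in> A \<Longrightarrow> f i \<in> Pol k) \<Longrightarrow> (\<lambda>z. \<Sum>i\<in>A. f i z) \<in> Pol k"
  by (induction A rule: infinite_finite_induct) (auto simp: Pol_zero Pol_add)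

lemma monomial_in_Pol: "sum e UNIV = k \<Longrightarrow> monomial e \<in> Pol k"
proof -
  assume k: "sum e UNIV = k"
  have "monomial e = (\<lambda>z. \<Sum>d | sum d UNIV = k. (if d = e then 1 else 0) * monomial d z)"
  proof
    fix z
    have "(\<Sum>d | sum d UNIV = k. (if d = e then 1 else 0) * monomial d z)
        = (\<Sum>d | sum d UNIV = k. if d = e then monomial d z else 0)"
      by (intro sum.cong) auto
    then show "monomial e z = (\<Sum>d | sum d UNIV = k. (if d = e then 1 else 0) * monomial d z)"
      using k by (simp add: sum.delta finite_degree)
  qed
  then show ?thesis
    unfolding Pol_altdef by (intro CollectI exI)
qed

lemma sum_count_list: "sum (count_list js) (UNIV :: 'm::finite set) = length js"
  by (rule sum_count_set) auto

lemma monomial_count_in_Pol: "length js = k \<Longrightarrow> monomial (count_list js) \<in> Pol k"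
  by (simp add: monomial_in_Pol sum_count_list)

lemma Pol_mult:
  assumes "p \<in> Pol j" "q \<in> Pol k"
  shows "(\<lambda>z. p z * q z) \<in> Pol (j + k)"
proof -
  obtain c where p: "p = (\<lambda>z. \<Sum>e | sum e UNIV = j. c e * monomial e z)"
    using assms(1) by (rule PolE)
  obtain d where q: "q = (\<lambda>z. \<Sum>e | sum e UNIV = k. d e * monomial e z)"
    using assms(2) by (rule PolE)
  from p q have "(\<lambda>z. p z * q z) = (\<lambda>z. \<Sum>e | sum e UNIV = j. \<Sum>e' | sum e' UNIV = k.
      (c e * d e') * monomial (\<lambda>i. e i + e' i) z)"
    by (simp add: sum_product monomial_add mult_ac)
  also have "\<dots> \<in> Pol (j + k)"
    by (intro Pol_sum Pol_cmult monomial_in_Pol) (auto simp: sum.distrib)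
  finally show ?thesis .
qed

lemma Pol_const: "(\<lambda>z. c) \<in> Pol 0"
  using Pol_cmult[OF monomial_in_Pol[of "\<lambda>_. 0" 0], of c] by (simp add: monomial_def)

lemma Pol_power: "p \<in> Pol k \<Longrightarrow> (\<lambda>z. p z ^ n) \<in> Pol (k * n)"
  by (induction n) (use Pol_const[of 1] Pol_mult in auto)

lemma Pol_prod:
  "(\<And>i. i \<in> A \<Longrightarrow> f i \<in> Pol (k i)) \<Longrightarrow> (\<lambda>z. \<Prod>i\<in>A. f i z) \<in> Pol (sum k A)" if "finite A"
  using that by (induction A rule: finite_induct) (auto simp: Pol_const Pol_mult)

lemma Pol_coordinate: "(\<lambda>z. z $ i) \<in> Pol 1"
  using monomial_count_in_Pol[of "[i]" 1] by (simp add: monomial_count_Cons[abs_def] monomial_def)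

lemma Pol_substitute:
  assumes "p \<in> Pol k"
  shows "(\<lambda>z. p (A *v z)) \<in> Pol k"
proof -
  obtain c where p: "p = (\<lambda>z. \<Sum>e | sum e UNIV = k. c e * monomial e z)"
    using assms by (rule PolE)
  have lin: "(\<lambda>z. (A *v z) $ i) \<in> Pol 1" for i
    unfolding matrix_vector_mult_def by (simp add: Pol_sum Pol_cmult Pol_coordinate del: One_nat_def)
  have "(\<lambda>z. monomial e (A *v z)) \<in> Pol (sum e UNIV)" for e
    using Pol_prod[of UNIV "\<lambda>i z. ((A *v z) $ i) ^ e i" e] Pol_power[OF lin] by (simp add: monomial_def)
  then show ?thesis
    unfolding p by (intro Pol_sum Pol_cmult) auto
qed

lemma pol_act_in_Pol: "p \<in> Pol k \<Longrightarrow> pol_act g p \<in> Pol k"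
  unfolding pol_act_def by (rule Pol_substitute)

lemma Pol_homogeneous: "p \<in> Pol k \<Longrightarrow> p (c *s z) = c ^ k * p z"
  by (elim PolE) (simp add: monomial_scale sum_distrib_left mult_ac)

lemma smooth_Pol: "p \<in> Pol k \<Longrightarrow> smooth_on (\<lambda>y. p (cvec y)) UNIV"
  by (elim PolE) (auto intro!: smooth_on_sum smooth_on_mult smooth_on_const smooth_monomial)

text \<open>Exponents and lists of indices are two descriptions of monomials: \<open>Pol\<close> uses the former, \<open>partials\<close> the latter.\<close>

lemma ex_count_list: "\<exists>js. count_list js = (e :: 'm::finite \<Rightarrow> nat)"
proof -
  obtain js where "mset js = (\<Sum>i\<in>UNIV. replicate_mset (e i) i)"
    using ex_mset by blast
  then have "count_list js i = e i" for i
    by (simp add: count_sum if_distrib sum.delta cong: if_cong flip: count_mset)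
  then show ?thesis by blast
qed

text \<open>The monomials and the derivatives at the origin are dual bases up to nonzero factors. Differentiating in the last direction of the list
  first keeps the function a monomial during the induction.\<close>

lemma partials_monomial:
  "partials js (\<lambda>y. monomial e (cvec y)) 0 = (if e = count_list js then \<Prod>i\<in>UNIV. fact (e i) else 0)"
proof (induction js arbitrary: e rule: rev_induct)
  case Nil
  show ?case
    by (auto simp: monomial_def fun_eq_iff power_0_left prod_zero_iff)
next
  case (snoc j js)
  define e' where "e' = e(j := e j - 1)"
  have "partials [j] (\<lambda>y. monomial e (cvec y)) x = of_nat (e j) * monomial e' (cvec x)" for x
  proof -
    define C where "C = (\<Prod>i\<in>UNIV - {j}. complex_of_real (x $ i) ^ e i)"
    have split: "monomial d z = (z $ j) ^ d j * (\<Prod>i\<in>UNIV - {j}. (z $ i) ^ d i)" for d :: "'a \<Rightarrow> nat" and z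
      unfolding monomial_def by (simp add: prod.remove[of UNIV j])
    have "monomial e (cvec (x + t *\<^sub>R axis j 1)) = of_real ((x $ j + t) ^ e j) * C" for t
      by (auto simp: split C_def axis_def intro!: prod.cong)
    moreover have "((\<lambda>t. of_real ((x $ j + t) ^ e j) * C) has_vector_derivative
        of_real (of_nat (e j) * (x $ j) ^ (e j - 1)) * C) (at 0)"
    proof -
      have "((\<lambda>t. (x $ j + t) ^ e j) has_real_derivative of_nat (e j) * (x $ j) ^ (e j - 1)) (at 0)"
        by (auto intro!: derivative_eq_intros)
      from has_vector_derivative_mult_left[OF has_vector_derivative_of_real[OF this]]
      show ?thesis .
    qed
    ultimately have "partials [j] (\<lambda>y. monomial e (cvec y)) x = of_real (of_nat (e j) * (x $ j) ^ (e j - 1)) * C"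
      by (simp only: partials.simps vector_derivative_at)
    also have "C = (\<Prod>i\<in>UNIV - {j}. complex_of_real (x $ i) ^ e' i)"
      unfolding C_def e'_def by (intro prod.cong) auto
    finally show ?thesis unfolding split[of e' "cvec x"] by (simp add: e'_def mult.assoc)
  qed
  then have "partials [j] (\<lambda>y. monomial e (cvec y)) = (\<lambda>y. of_nat (e j) * monomial e' (cvec y))" ..
  then have "partials (js @ [j]) (\<lambda>y. monomial e (cvec y)) 0
      = of_nat (e j) * partials js (\<lambda>y. monomial e' (cvec y)) 0"
    by (simp only: partials_append partials_cmult[OF smooth_monomial])
  also have "\<dots> = (if e = count_list (js @ [j]) then \<Prod>i\<in>UNIV. fact (e i) else 0)"
  proof (cases "e j = 0")
    case True
    then have "e \<noteq> count_list (js @ [j])" by auto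
    with True show ?thesis by simp
  next
    case False
    then have "e' = count_list js \<longleftrightarrow> e = count_list (js @ [j])"
    proof -
      have "e' i = count_list js i \<longleftrightarrow> e i = count_list (js @ [j]) i" for i
        using False by (cases "i = j") (auto simp: e'_def)
      then show ?thesis by (simp only: fun_eq_iff)
    qed
    moreover have "of_nat (e j) * (\<Prod>i\<in>UNIV. fact (e' i)) = (\<Prod>i\<in>UNIV. fact (e i) :: complex)"
    proof -
      have "(\<Prod>i\<in>UNIV. fact (d i) :: complex) = fact (d j) * (\<Prod>i\<in>UNIV - {j}. fact (d i))" for d :: "'a \<Rightarrow> nat"
        by (simp add: prod.remove[of UNIV j])
      moreover have "(\<Prod>i\<in>UNIV - {j}. fact (e' i) :: complex) = (\<Prod>i\<in>UNIV - {j}. fact (e i))"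
        unfolding e'_def by (intro prod.cong) auto
      ultimately show ?thesis
        using False by (simp add: e'_def fact_reduce[of "e j"])
    qed
    ultimately show ?thesis unfolding snoc by (simp only: mult_zero_right simp_thms split: if_split) blast
  qed
  finally show ?case .
qed

text \<open>The coefficients are derivatives along real directions, so values at real points determine them.\<close>

lemma Pol_eqI:
  assumes "p \<in> Pol k" "q \<in> Pol k" "\<And>y. p (cvec y) = q (cvec y)"
  shows "p = q"
proof -
  have "(\<lambda>z. p z + (- 1) * q z) \<in> Pol k"
    by (intro Pol_add Pol_cmult assms)
  then obtain c where c: "(\<lambda>z. p z + (- 1) * q z) = (\<lambda>z. \<Sum>e | sum e UNIV = k. c e * monomial e z)"
    by (rule PolE)
  have "c e = 0" if e: "sum e UNIV = k" for e
  proof -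
    obtain js where js: "count_list js = e" using ex_count_list by blast
    have "(\<lambda>y. \<Sum>e | sum e UNIV = k. c e * monomial e (cvec y)) = (\<lambda>y. 0)"
    proof
      fix y show "(\<Sum>e | sum e UNIV = k. c e * monomial e (cvec y)) = 0"
        using fun_cong[OF c, of "cvec y"] by (simp add: assms(3))
    qed
    moreover have "partials js (\<lambda>y. \<Sum>e | sum e UNIV = k. c e * monomial e (cvec y)) 0
        = (\<Sum>d | sum d UNIV = k. c d * (if d = e then \<Prod>i\<in>UNIV. fact (d i) else 0))"
      by (subst partials_sum)
        (auto intro!: sum.cong smooth_on_mult smooth_on_const smooth_monomial
          simp: partials_cmult[OF smooth_monomial] partials_monomial js)
    moreover have "\<dots> = c e * (\<Prod>i\<in>UNIV. fact (e i))"
      using e by (simp add: finite_degree if_distrib sum.delta cong: if_cong)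
    moreover have "partials js (\<lambda>y::real^'a. 0::complex) = (\<lambda>x. 0)"
      by (induction js) simp_all
    ultimately show ?thesis by simp
  qed
  then have "p z + (- 1) * q z = 0" for z
    by (simp only: fun_cong[OF c, of z]) (simp add: sum.neutral)
  then show ?thesis by (simp add: fun_eq_iff)
qed

text \<open>The derivative of order \<open>n\<close> at \<open>0\<close> of \<open>s \<mapsto> F (s z)\<close>, as a polynomial that also accepts complex \<open>z\<close>. Summing over lists instead of
  exponents avoids multinomial coefficients.\<close>

definition taylor_form :: "nat \<Rightarrow> (real^'m \<Rightarrow> complex) \<Rightarrow> complex^'m \<Rightarrow> complex" where
  "taylor_form n F z = (\<Sum>js | length js = n. partials js F 0 * monomial (count_list js) z)"

lemma taylor_form_in_Pol: "taylor_form n F \<in> Pol n"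
  unfolding taylor_form_def[abs_def] by (intro Pol_sum Pol_cmult monomial_count_in_Pol) simp

lemma sum_lists_Suc:
  "(\<Sum>js | length js = Suc n. f js) = (\<Sum>js | length js = n. \<Sum>j\<in>(UNIV :: 'm::finite set). f (j # js))"
proof -
  have "{js :: 'm list. length js = Suc n} = (\<lambda>(js, j). j # js) ` ({js. length js = n} \<times> UNIV)"
    by (auto simp: length_Suc_conv image_iff)
  moreover have "inj_on (\<lambda>(js, j). j # js) ({js :: 'm list. length js = n} \<times> UNIV)"
    by (auto simp: inj_on_def)
  ultimately show ?thesis
    by (simp add: sum.reindex sum.cartesian_product case_prod_unfold)
qed

lemma derivs_line:
  fixes F :: "real^'m \<Rightarrow> complex"
  assumes "smooth_on F UNIV"
  shows "derivs UNIV (\<lambda>n s. \<Sum>js | length js = n. partials js F (s *\<^sub>R z) * monomial (count_list js) (cvec z))"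
  unfolding derivs_def
proof (intro allI ballI)
  fix n s
  have "((\<lambda>s. \<Sum>js | length js = n. partials js F (s *\<^sub>R z) * monomial (count_list js) (cvec z)) has_vector_derivative
      (\<Sum>js | length js = n. (\<Sum>j\<in>UNIV. (z $ j) *\<^sub>R partials (j # js) F (s *\<^sub>R z)) * monomial (count_list js) (cvec z))) (at s)"
    by (intro has_vector_derivative_sum has_vector_derivative_mult_left partials_has_line_derivative assms)
  then show "((\<lambda>s. \<Sum>js | length js = n. partials js F (s *\<^sub>R z) * monomial (count_list js) (cvec z)) has_vector_derivative
      (\<Sum>js | length js = Suc n. partials js F (s *\<^sub>R z) * monomial (count_list js) (cvec z))) (at s)"
    by (simp add: sum_lists_Suc monomial_count_Cons sum_distrib_left sum_distrib_right scaleR_conv_of_real[where 'a = complex] mult_ac del: partials.simps)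
qed

text \<open>All Taylor forms are computed from this: it suffices to know the function along each real line through the origin, and there only
  near \<open>0\<close>.\<close>

lemma taylor_form_eq_derivs:
  assumes "smooth_on F UNIV" "open I" "0 \<in> I" "derivs I g" "\<And>s. s \<in> I \<Longrightarrow> g 0 s = F (s *\<^sub>R z)"
  shows "taylor_form n F (cvec z) = g n 0"
proof -
  let ?h = "\<lambda>n s. \<Sum>js | length js = n. partials js F (s *\<^sub>R z) * monomial (count_list js) (cvec z)"
  have "derivs I ?h"
    using derivs_line[OF assms(1)] by (simp add: derivs_def)
  moreover have "g 0 s = ?h 0 s" if "s \<in> I" for s
    by (simp add: assms(5)[OF that] monomial_def)
  ultimately have "g n 0 = ?h n 0"
    by (rule derivs_unique[OF assms(2,4) _ _ assms(3)])
  then show ?thesis by (simp add: taylor_form_def)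
qed

lemma taylor_form_Pol:
  assumes "p \<in> Pol k"
  shows "taylor_form k (\<lambda>y. p (cvec y)) = (\<lambda>z. fact k * p z)"
proof (rule Pol_eqI[OF taylor_form_in_Pol Pol_cmult[OF assms]])
  fix z
  define h where "h n s = (if n = 0 then p (cvec z) else 0)" for n :: nat and s :: real
  have "derivs UNIV h"
    by (simp add: derivs_def h_def[abs_def])
  then obtain g where g: "derivs UNIV g" "\<And>s. g 0 s = of_real s ^ k * h 0 s"
    "\<And>n. g n 0 = (if n < k then 0 else fact n / fact (n - k) * h (n - k) 0)"
    using derivs_power_times[where j = k] by blast
  show "taylor_form k (\<lambda>y. p (cvec y)) (cvec z) = fact k * p (cvec z)"
    by (subst taylor_form_eq_derivs[OF smooth_Pol[OF assms] open_UNIV _ g(1)])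
      (simp_all add: g h_def cvec_scaleR Pol_homogeneous[OF assms])
qed

lemma card_mset_pos: "card {js :: 'm::finite list. mset js = mset ks} \<noteq> 0"
proof -
  have "finite {js. mset js = mset ks}"
    by (rule finite_subset[OF _ finite_lists_length[of "length ks"]]) (auto dest: mset_eq_length)
  then show ?thesis by auto
qed

text \<open>The derivative in the directions \<open>ks\<close> picks out the terms whose index list is a permutation of \<open>ks\<close>; by symmetry they all
  have the same coefficient. So a homogeneous polynomial on real vectors determines its symmetric coefficient tensor.\<close>

lemma partials_symmetric_form:
  assumes sym: "\<And>js ks. mset js = mset ks \<Longrightarrow> b js = b ks" and ks: "length ks = n"
  shows "partials ks (\<lambda>y. \<Sum>js | length js = n. b js * monomial (count_list js) (cvec y)) 0
    = of_nat (card {js. mset js = mset ks}) * (\<Prod>i\<in>UNIV. fact (count_list ks i)) * b ks"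
proof -
  have same: "count_list js = count_list ks \<longleftrightarrow> mset js = mset ks" for js
    by (auto simp: multiset_eq_iff fun_eq_iff count_mset)
  have "partials ks (\<lambda>y. \<Sum>js | length js = n. b js * monomial (count_list js) (cvec y)) 0
      = (\<Sum>js | length js = n. b js * (if count_list js = count_list ks then \<Prod>i\<in>UNIV. fact (count_list js i) else 0))"
    by (subst partials_sum)
      (auto intro!: sum.cong smooth_on_mult smooth_on_const smooth_monomial
        simp: partials_cmult[OF smooth_monomial] partials_monomial)
  also have "\<dots> = (\<Sum>js | mset js = mset ks. b js * (\<Prod>i\<in>UNIV. fact (count_list js i)))"
  proof (rule sum.mono_neutral_cong_right)
    show "{js. mset js = mset ks} \<subseteq> {js. length js = n}"
      using ks by (auto dest: mset_eq_length)
  qed (auto simp: finite_lists_length same)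
  also have "\<dots> = (\<Sum>js | mset js = mset ks. b ks * (\<Prod>i\<in>UNIV. fact (count_list ks i)))"
  proof (intro sum.cong refl)
    fix js assume "js \<in> {js. mset js = mset ks}"
    then have eq: "mset js = mset ks" by simp
    show "b js * (\<Prod>i\<in>UNIV. fact (count_list js i)) = b ks * (\<Prod>i\<in>UNIV. fact (count_list ks i))"
      by (simp only: sym[OF eq] same[THEN iffD2, OF eq])
  qed
  finally show ?thesis by simp
qed

lemma symmetric_form_eq_0D:
  fixes b :: "'m::finite list \<Rightarrow> complex"
  assumes sym: "\<And>js ks. mset js = mset ks \<Longrightarrow> b js = b ks" and ks: "length ks = n"
    and zero: "\<And>y. (\<Sum>js | length js = n. b js * monomial (count_list js) (cvec y)) = 0"
  shows "b ks = 0"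
proof -
  have "of_nat (card {js. mset js = mset ks}) * (\<Prod>i\<in>UNIV. fact (count_list ks i)) * b ks = 0"
    using partials_symmetric_form[of b ks n, OF sym ks] unfolding zero by (simp add: partials_zero)
  then show ?thesis
    using card_mset_pos[of ks] by (simp add: prod_zero_iff)
qed

text \<open>Since the jets of a smooth function are symmetric, they can be recovered from the Taylor forms.\<close>

lemma partials_eqI:
  fixes F G :: "real^'m \<Rightarrow> complex"
  assumes "smooth_on F UNIV" "smooth_on G UNIV" "length ks = n"
    and "\<And>z. taylor_form n F (cvec z) = c * taylor_form n G (cvec z)"
  shows "partials ks F 0 = c * partials ks G 0"
proof -
  define K where "K = of_nat (card {js. mset js = mset ks}) * (\<Prod>i\<in>UNIV. fact (count_list ks i)) * (1::complex)"
  have "partials ks (\<lambda>y. taylor_form n F (cvec y)) 0 = c * partials ks (\<lambda>y. taylor_form n G (cvec y)) 0"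
    unfolding assms(4) by (rule fun_cong[OF partials_cmult[OF smooth_Pol[OF taylor_form_in_Pol]]])
  then have "K * partials ks F 0 = K * (c * partials ks G 0)"
    unfolding taylor_form_def K_def mult_1_right
    by (simp only: partials_symmetric_form[OF partials_mset_cong[OF assms(1), THEN fun_cong] assms(3)]
        partials_symmetric_form[OF partials_mset_cong[OF assms(2), THEN fun_cong] assms(3)] mult_ac)
  moreover have "K \<noteq> 0"
    using card_mset_pos[of ks] by (simp add: K_def prod_zero_iff)
  ultimately show ?thesis
    by simp
qed

text \<open>The Taylor form has the same jets as the function itself up to the factor \<open>n!\<close>, because its own Taylor form is \<open>n!\<close> times
  itself. This allows a functional of the \<open>n\<close>-jet to be evaluated on polynomials.\<close>

lemma partials_taylor_form:
  fixes F :: "real^'m \<Rightarrow> complex"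
  assumes "smooth_on F UNIV" "length ks = n"
  shows "partials ks (\<lambda>y. taylor_form n F (cvec y)) 0 = fact n * partials ks F 0"
  by (rule partials_eqI[OF smooth_Pol[OF taylor_form_in_Pol] assms])
    (simp add: taylor_form_Pol[OF taylor_form_in_Pol])

section \<open>Block matrices and the parabolic subgroup\<close>

lemma matrix_inv_unique:
  fixes A B :: "'a::field^'n^'n"
  assumes "A ** B = mat 1"
  shows "matrix_inv A = B"
proof -
  have "A ** matrix_inv A = mat 1 \<and> matrix_inv A ** A = mat 1"
    unfolding matrix_inv_def
    by (rule someI[of _ B]) (use assms matrix_left_right_inverse in blast)
  then show ?thesis
    by (metis assms matrix_mul_assoc matrix_mul_lid matrix_mul_rid)
qed

lemma matrix_inv_cancel:
  fixes A :: "'a::field^'n^'n"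
  assumes "det A \<noteq> 0"
  shows "A ** matrix_inv A = mat 1" "matrix_inv A ** A = mat 1"
proof -
  obtain B where B: "A ** B = mat 1" "B ** A = mat 1"
    using assms invertible_det_nz unfolding invertible_def by blast
  with matrix_inv_unique[OF B(1)] show "A ** matrix_inv A = mat 1" "matrix_inv A ** A = mat 1"
    by simp_all
qed

lemma matrix_inv_matrix_inv:
  fixes A :: "'a::field^'n^'n"
  shows "det A \<noteq> 0 \<Longrightarrow> matrix_inv (matrix_inv A) = A"
  by (intro matrix_inv_unique matrix_inv_cancel)

lemma det_matrix_inv:
  fixes A :: "'a::field^'n^'n"
  assumes "det A \<noteq> 0"
  shows "det (matrix_inv A) = inverse (det A)"
  using arg_cong[OF matrix_inv_cancel(1)[OF assms], of det] assms
  by (simp add: det_mul inverse_unique)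

lemma SL_det_nz: "A \<in> SL \<Longrightarrow> det A \<noteq> 0"
  by (simp add: SL_def)

lemma SLpm_det_nz: "A \<in> SLpm \<Longrightarrow> det A \<noteq> 0"
  by (auto simp: SLpm_def)

lemma SL_mult: "A \<in> SL \<Longrightarrow> B \<in> SL \<Longrightarrow> A ** B \<in> SL"
  by (simp add: SL_def det_mul)

lemma SL_one: "mat 1 \<in> SL"
  by (simp add: SL_def)

lemma SLpm_one: "mat 1 \<in> SLpm"
  by (simp add: SLpm_def)

lemma SL_inv: "A \<in> SL \<Longrightarrow> matrix_inv A \<in> SL"
  by (simp add: SL_def det_matrix_inv)

lemma SLpm_inv: "A \<in> SLpm \<Longrightarrow> matrix_inv A \<in> SLpm"
  by (auto simp: SLpm_def det_matrix_inv)

lemma SL_subset_SLpm: "A \<in> SL \<Longrightarrow> A \<in> SLpm"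
  by (simp add: SL_def SLpm_def)

lemma sum_option: "(\<Sum>i\<in>(UNIV :: 'm::finite option set). f i) = f None + (\<Sum>i\<in>UNIV. f (Some i))"
  by (simp add: UNIV_option_conv sum.reindex)

lemma prod_option: "(\<Prod>i\<in>(UNIV :: 'm::finite option set). f i) = f None * (\<Prod>i\<in>UNIV. f (Some i))"
  by (simp add: UNIV_option_conv prod.reindex)

lemma block_mat_nth [simp]:
  "block_mat a r c D $ None $ None = a"
  "block_mat a r c D $ None $ Some j = r $ j"
  "block_mat a r c D $ Some i $ None = c $ i"
  "block_mat a r c D $ Some i $ Some j = D $ i $ j"
  by (simp_all add: block_mat_def)

lemma vec_option_eqI:
  "v $ None = w $ None \<Longrightarrow> (\<And>i. v $ Some i = w $ Some i) \<Longrightarrow> v = w" for v w :: "'b^('m::finite option)"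
  by (auto simp: vec_eq_iff split_option_all)

lemma mat_option_eqI:
  fixes A B :: "'b^('m::finite option)^('m option)"
  shows "A $ None $ None = B $ None $ None \<Longrightarrow> (\<And>j. A $ None $ Some j = B $ None $ Some j) \<Longrightarrow>
    (\<And>i. A $ Some i $ None = B $ Some i $ None) \<Longrightarrow>
    (\<And>i j. A $ Some i $ Some j = B $ Some i $ Some j) \<Longrightarrow> A = B"
  by (intro vec_option_eqI)

text \<open>Only the permutations that fix the first index contribute: the others hit a zero of the first column.\<close>

lemma det_block_mat:
  fixes D :: "real^'m^'m"
  shows "det (block_mat a r 0 D) = a * det D"
proof -
  let ?A = "block_mat a r 0 D"
  let ?f = "map_permutation (UNIV :: 'm set) Some"
  let ?P = "{p. p permutes (UNIV :: 'm option set)}"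
  let ?Q = "{q. q permutes (UNIV :: 'm set)}"
  let ?t = "\<lambda>p. of_int (sign p) * (\<Prod>i\<in>UNIV. ?A $ i $ p i)"
  have app: "?f q (Some i) = Some (q i)" for q i
    by (rule map_permutation_apply) auto
  have perm: "?f q permutes range Some" if "q permutes UNIV" for q
    by (rule map_permutation_permutes[OF _ that]) (simp add: bij_betw_def)
  have None: "?f q None = None" if "q permutes UNIV" for q
    using perm[OF that] by (rule permutes_not_in) auto
  have inj: "inj_on ?f ?Q"
    by (rule inj_onI) (metis app ext option.inject)
  have "sum ?t ?P = sum ?t (?f ` ?Q)"
  proof (rule sum.mono_neutral_right)
    show "finite ?P" by (simp add: finite_permutations)
    show "?f ` ?Q \<subseteq> ?P" using perm permutes_subset by blast
    show "\<forall>p\<in>?P - ?f ` ?Q. ?t p = 0"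
    proof
      fix p assume p: "p \<in> ?P - ?f ` ?Q"
      then have bij: "bij p" using permutes_bij by blast
      have "p None \<noteq> None"
      proof
        assume pN: "p None = None"
        have ps: "p permutes range Some"
        proof (rule permutes_superset)
          show "p permutes UNIV" using p by simp
          show "p x = x" if "x \<in> UNIV - range Some" for x
            using that pN by (cases x) auto
        qed
        define q where "q i = the (p (Some i))" for i
        have pq: "p (Some i) = Some (q i)" for i
          using permutes_in_image[OF ps, of "Some i"] by (auto simp: q_def)
        have "bij q"
        proof -
          have "inj q"
            using bij by (intro injI) (metis bij_is_inj injD option.inject pq)
          then show ?thesis by (simp add: bij_def finite_UNIV_inj_surj)
        qed
        then have q: "q permutes UNIV" by (intro bij_imp_permutes) auto
        have "?f q = p"
        proof
          fix x show "?f q x = p x"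
            by (cases x) (simp_all add: app pq pN None[OF q])
        qed
        with q p show False by blast
      qed
      obtain i where i: "p i = None" using bij by (metis bij_pointE)
      with \<open>p None \<noteq> None\<close> obtain i' where "i = Some i'" by (cases i) auto
      with i have "?A $ i $ p i = 0" by simp
      then have "(\<Prod>i\<in>UNIV. ?A $ i $ p i) = 0"
        by (intro prod_zero) auto
      then show "?t p = 0" by simp
    qed
  qed
  also have "\<dots> = (\<Sum>q\<in>?Q. ?t (?f q))"
    by (simp add: sum.reindex[OF inj])
  also have "\<dots> = (\<Sum>q\<in>?Q. a * (of_int (sign q) * (\<Prod>i\<in>UNIV. D $ i $ q i)))"
  proof (rule sum.cong[OF refl])
    fix q assume "q \<in> ?Q"
    then have q: "q permutes UNIV" by simp
    have "sign (?f q) = sign q"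
      by (rule sign_map_permutation[OF _ q]) auto
    then show "?t (?f q) = a * (of_int (sign q) * (\<Prod>i\<in>UNIV. D $ i $ q i))"
      by (simp add: prod_option app None[OF q])
  qed
  finally show ?thesis
    by (simp add: det_def sum_distrib_left)
qed

lemma block_mat_mult:
  "block_mat a r c D ** block_mat a' r' c' D' = block_mat (a * a' + r \<bullet> c') (a *\<^sub>R r' + transpose D' *v r)
    (a' *\<^sub>R c + D *v c') ((\<chi> i j. c $ i * r' $ j) + D ** D')"
  by (rule mat_option_eqI)
    (simp_all add: matrix_matrix_mult_def matrix_vector_mult_def sum_option inner_vec_def transpose_def mult.commute)

definition col0 :: "real^('m::finite option)^('m option) \<Rightarrow> real^('m option)" where
  "col0 x = column None x"

definition vcons :: "real \<Rightarrow> real^'m \<Rightarrow> real^('m::finite option)" where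
  "vcons a y = (\<chi> i. case i of None \<Rightarrow> a | Some i' \<Rightarrow> y $ i')"

lemma vcons_nth [simp]: "vcons a y $ None = a" "vcons a y $ Some i = y $ i"
  by (simp_all add: vcons_def)

lemma vcons_scaleR: "c *\<^sub>R vcons a y = vcons (c * a) (c *\<^sub>R y)"
  by (rule vec_option_eqI) simp_all

lemma col0_mult: "col0 (x ** y) = x *v col0 y"
  by (simp add: col0_def column_def matrix_matrix_mult_def matrix_vector_mult_def vec_eq_iff)

lemma col0_block_mat: "col0 (block_mat a r c D) = vcons a c"
  by (rule vec_option_eqI) (simp_all add: col0_def column_def)

lemma col0_nonzero:
  assumes "x \<in> SL"
  shows "col0 x \<noteq> 0"
proof
  assume "col0 x = 0"
  then have "det x = 0" unfolding col0_def by (rule det_zero_column)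
  with assms show False by (simp add: SL_def)
qed

lemma block_mat_vcons: "block_mat a r c D *v vcons b y = vcons (a * b + r \<bullet> y) (b *\<^sub>R c + D *v y)"
  by (rule vec_option_eqI) (simp_all add: matrix_vector_mult_def sum_option inner_vec_def mult.commute)

lemma mat_matrix_mult: "mat c ** A = (\<chi> i j. c * A $ i $ j)" for A :: "'a::semiring_1^'n^'n"
  by (simp add: matrix_matrix_mult_def mat_def vec_eq_iff if_distrib[of "\<lambda>x. x * _"] sum.delta cong: if_cong)

lemma matrix_mat_mult: "A ** mat c = (\<chi> i j. A $ i $ j * c)" for A :: "'a::semiring_1^'n^'n"
  by (simp add: matrix_matrix_mult_def mat_def vec_eq_iff if_distrib[of "\<lambda>x. _ * x"] sum.delta' cong: if_cong)

lemma mat_vector_mult: "mat c *v v = c *s v" for v :: "'a::semiring_1^'n"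
  by (simp add: matrix_vector_mult_def mat_def vec_eq_iff if_distrib[of "\<lambda>x. x * _"] sum.delta cong: if_cong)

definition P_elt :: "real^'m^'m \<Rightarrow> real \<Rightarrow> real^'m \<Rightarrow> real^('m::finite option)^('m option)" where
  "P_elt g t y = M_elt g ** A_elt t ** N_plus_elt y"

lemma block_mat_cong:
  "a = a' \<Longrightarrow> r = r' \<Longrightarrow> c = c' \<Longrightarrow> D = D' \<Longrightarrow> block_mat a r c D = block_mat a' r' c' D'"
  by simp

lemma P_elt_block:
  "P_elt g t y = block_mat (inverse (det g) * exp t) ((inverse (det g) * exp t) *\<^sub>R y) 0
    (exp (- t / real CARD('m)) *\<^sub>R (g :: real^'m^'m))"
  unfolding P_elt_def M_elt_def A_elt_def N_plus_elt_def block_mat_mult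
  by (intro block_mat_cong) (simp_all add: matrix_mat_mult mat_vector_mult transpose_mat scalar_mult_eq_scaleR vec_eq_iff mult.commute)

lemma N_minus_add: "N_minus_elt x ** N_minus_elt y = N_minus_elt (x + y)"
  unfolding N_minus_elt_def block_mat_mult
  by (intro block_mat_cong) (simp_all add: vec_eq_iff)

lemma N_minus_0: "N_minus_elt 0 = mat 1"
  by (rule mat_option_eqI) (simp_all add: N_minus_elt_def mat_def)

lemma det_scaleR: "det (c *\<^sub>R A) = c ^ CARD('m) * det A" for A :: "real^'m^'m"
proof -
  have "c *\<^sub>R A = mat c ** A"
    by (simp add: mat_matrix_mult vec_eq_iff)
  then show ?thesis by (simp add: det_mul det_diagonal mat_def)
qed

lemma exp_root_power: "exp (t / real CARD('m::finite)) ^ CARD('m) = exp t"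
  by (simp flip: exp_of_nat_mult)

lemma P_elt_in_SL: "g \<in> SLpm \<Longrightarrow> P_elt g t y \<in> SL"
  using exp_root_power[where 'm = 'a and t = "- t"]
  by (auto simp: SL_def SLpm_def P_elt_block det_block_mat det_scaleR exp_minus)

lemma N_minus_in_SL: "N_minus_elt x \<in> SL"
proof -
  have "transpose (N_minus_elt x) = block_mat 1 x 0 (mat 1)"
    by (rule mat_option_eqI) (auto simp: transpose_def N_minus_elt_def mat_def)
  then have "det (N_minus_elt x) = 1"
    by (metis det_transpose det_block_mat det_I mult_1)
  then show ?thesis by (simp add: SL_def)
qed

lemma col0_N_minus: "col0 (x ** N_minus_elt y) = x *v vcons 1 y"
  by (simp add: col0_mult N_minus_elt_def col0_block_mat)

text \<open>The parabolic subgroup is the stabilizer of the line through the first basis vector. The sign and the absolute value of the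
  eigenvalue are the \<open>M\<close>- and the \<open>A\<close>-component.\<close>

lemma col0_proportional:
  fixes x x' :: "real^('m::finite option)^('m option)"
  assumes "x \<in> SL" "x' \<in> SL" "col0 x' = a *\<^sub>R col0 x"
  obtains g t y where "g \<in> SLpm" "x' = x ** P_elt g t y" "a = inverse (det g) * exp t"
proof -
  define p where "p = matrix_inv x ** x'"
  have p: "p \<in> SL" unfolding p_def by (intro SL_mult SL_inv assms)
  have xp: "x ** p = x'"
    using matrix_inv_cancel(1)[OF SL_det_nz[OF assms(1)]] by (simp add: p_def matrix_mul_assoc)
  have "col0 p = a *\<^sub>R col0 (matrix_inv x ** x)"
    by (simp add: p_def col0_mult assms(3) matrix_vector_mult_scaleR)
  then have c: "col0 p = a *\<^sub>R col0 (mat 1)"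
    using matrix_inv_cancel(2)[OF SL_det_nz[OF assms(1)]] by simp
  have p0: "p $ None $ None = a" "p $ Some i $ None = 0" for i
    using arg_cong[OF c, of "\<lambda>v. v $ None"] arg_cong[OF c, of "\<lambda>v. v $ Some i"]
    by (simp_all add: col0_def column_def mat_def)
  define r where "r = (\<chi> j. p $ None $ Some j)"
  define D where "D = (\<chi> i j. p $ Some i $ Some j)"
  have pb: "p = block_mat a r 0 D"
    by (rule mat_option_eqI) (simp_all add: p0 r_def D_def)
  have aD: "a * det D = 1"
    using p by (simp add: pb det_block_mat SL_def)
  then have a: "a \<noteq> 0" by auto
  define t where "t = ln \<bar>a\<bar>"
  define g where "g = exp (t / real CARD('m)) *\<^sub>R D"
  have "det g = \<bar>a\<bar> * det D"
    using a by (simp add: g_def det_scaleR exp_root_power t_def)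
  then have dg: "det g = sgn a"
    using aD a by (simp add: abs_if sgn_if mult.commute split: if_splits)
  have g: "g \<in> SLpm"
    using a by (simp add: SLpm_def dg sgn_if)
  have ag: "a = inverse (det g) * exp t"
    using a by (simp add: dg t_def sgn_if abs_if)
  have "P_elt g t (inverse a *\<^sub>R r) = block_mat a (a *\<^sub>R inverse a *\<^sub>R r) 0 (exp (- t / real CARD('m)) *\<^sub>R g)"
    unfolding P_elt_block ag[symmetric] ..
  also have "\<dots> = p"
    using a by (simp add: pb g_def exp_minus)
  finally show thesis
    using that[OF g _ ag] xp by metis
qed

section \<open>Functions in the induced representations\<close>

definition sgn_char :: "sign \<Rightarrow> real \<Rightarrow> complex" where
  "sgn_char \<alpha> a = (case \<alpha> of Plus \<Rightarrow> 1 | Minus \<Rightarrow> complex_of_real (sgn a))"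

text \<open>The factor by which a function in the induced representation changes when the first column is multiplied by \<open>a\<close>.\<close>

definition chi :: "sign \<Rightarrow> complex \<Rightarrow> real \<Rightarrow> complex" where
  "chi \<alpha> lam a = sgn_char \<alpha> a * exp (- lam * complex_of_real (ln \<bar>a\<bar>))"

lemma sign_char_eq: "sign_char \<alpha> g = sgn_char \<alpha> (det g)"
  by (cases \<alpha>) (simp_all add: sgn_char_def)

lemma sgn_char_mult: "sgn_char \<alpha> (a * b) = sgn_char \<alpha> a * sgn_char \<alpha> b"
  by (cases \<alpha>) (simp_all add: sgn_char_def sgn_mult)

lemma sgn_char_one [simp]: "sgn_char \<alpha> 1 = 1"
  by (cases \<alpha>) (simp_all add: sgn_char_def)

lemma sgn_char_pos: "0 < a \<Longrightarrow> sgn_char \<alpha> a = 1"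
  by (cases \<alpha>) (simp_all add: sgn_char_def)

lemma sgn_char_square: "a \<noteq> 0 \<Longrightarrow> sgn_char \<alpha> a * sgn_char \<alpha> a = 1"
  by (cases \<alpha>) (auto simp: sgn_char_def sgn_if)

lemma sgn_char_nonzero: "a \<noteq> 0 \<Longrightarrow> sgn_char \<alpha> a \<noteq> 0"
  by (metis sgn_char_square mult_zero_left zero_neq_one)

lemma sgn_char_inverse: "sgn_char \<alpha> (inverse a) = sgn_char \<alpha> a"
  by (cases \<alpha>) (simp_all add: sgn_char_def sgn_if)

lemma inverse_sgn_char: "a \<noteq> 0 \<Longrightarrow> inverse (sgn_char \<alpha> a) = sgn_char \<alpha> a"
  using sgn_char_square[of a \<alpha>] by (rule inverse_unique)

lemma sgn_char_shift:
  assumes "d = 1 \<or> d = -1"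
  shows "sgn_char (sign_shift \<alpha> k) d = sgn_char \<alpha> d * of_real d ^ k"
  using assms by (cases \<alpha>; cases "even k") (auto simp: sgn_char_def sign_shift_def)

lemma chi_mult: "a \<noteq> 0 \<Longrightarrow> b \<noteq> 0 \<Longrightarrow> chi \<alpha> lam (a * b) = chi \<alpha> lam a * chi \<alpha> lam b"
  by (simp add: chi_def sgn_char_mult abs_mult ln_mult algebra_simps exp_add[symmetric])

lemma mat_mult_mat: "mat a ** mat b = (mat (a * b) :: 'a::comm_semiring_1^'n^'n)"
  by (simp add: mat_matrix_mult) (simp add: mat_def vec_eq_iff)

lemma matrix_inv_mat: "c \<noteq> 0 \<Longrightarrow> matrix_inv (mat c) = (mat (inverse c) :: 'a::field^'n^'n)"
  by (rule matrix_inv_unique) (simp add: mat_mult_mat)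

lemma Ind_P:
  "f \<in> Ind \<alpha> \<rho> lam \<Longrightarrow> x \<in> SL \<Longrightarrow> g \<in> SLpm \<Longrightarrow>
    f (x ** P_elt g t y) = matrix_inv (ind_char \<alpha> \<rho> lam g t) *v f x"
  by (simp add: Ind_def P_elt_def)

lemma Ind_outside: "f \<in> Ind \<alpha> \<rho> lam \<Longrightarrow> x \<notin> SL \<Longrightarrow> f x = 0"
  by (simp add: Ind_def)

lemma Ind_smooth: "f \<in> Ind \<alpha> \<rho> lam \<Longrightarrow> smooth_on_SL f"
  by (simp add: Ind_def)

lemma matrix_inv_ind_char_triv:
  assumes "g \<in> SLpm"
  shows "matrix_inv (ind_char \<alpha> triv_rep lam g t) = mat (chi \<alpha> lam (inverse (det g) * exp t))"
proof -
  have d: "\<bar>det g\<bar> = 1" using assms by (auto simp: SLpm_def)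
  then have "det g \<noteq> 0" by auto
  then have "chi \<alpha> lam (inverse (det g) * exp t) = inverse (sgn_char \<alpha> (det g) * exp (lam * complex_of_real t))"
    using d by (simp add: chi_def abs_mult sgn_char_mult sgn_char_pos sgn_char_inverse inverse_sgn_char exp_minus)
  with \<open>det g \<noteq> 0\<close> show ?thesis
    by (simp add: ind_char_def triv_rep_def mat_mult_mat sign_char_eq matrix_inv_mat sgn_char_nonzero del: inverse_mult_distrib)
qed

text \<open>Two group elements with proportional first columns differ by an element of the parabolic subgroup, on which only the factor
  of proportionality matters.\<close>

lemma Ind_triv_col0:
  assumes "f \<in> Ind \<alpha> triv_rep lam" "x \<in> SL" "x' \<in> SL" "col0 x' = a *\<^sub>R col0 x"
  shows "f x' = chi \<alpha> lam a *s f x"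
proof -
  obtain g t y where g: "g \<in> SLpm" "x' = x ** P_elt g t y" "a = inverse (det g) * exp t"
    using col0_proportional[OF assms(2-4)] .
  then show ?thesis
    using Ind_P[OF assms(1,2) g(1), of t y]
    by (simp add: matrix_inv_ind_char_triv mat_vector_mult)
qed

lemma bounded_linear_matrix_mult_left: "bounded_linear (\<lambda>x :: real^'p^'n. A ** x)" for A :: "real^'n^'m"
  by (rule linear_conv_bounded_linear[THEN iffD1], rule linearI)
    (simp_all add: vec_eq_iff matrix_matrix_mult_def sum_distrib_left distrib_left sum.distrib mult.left_commute)

lemma bounded_linear_matrix_mult_right: "bounded_linear (\<lambda>x :: real^'n^'m. x ** A)" for A :: "real^'p^'n"
  by (rule linear_conv_bounded_linear[THEN iffD1], rule linearI)
    (simp_all add: vec_eq_iff matrix_matrix_mult_def sum_distrib_left distrib_right sum.distrib mult.assoc)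

lemma bounded_linear_col0: "bounded_linear col0"
  by (rule linear_conv_bounded_linear[THEN iffD1], rule linearI)
    (simp_all add: col0_def column_def vec_eq_iff)

text \<open>The Lie algebra of the opposite unipotent group. Since \<open>N_lie y\<close> squares to zero, its exponential is \<open>mat 1 + N_lie y\<close>.\<close>

definition N_lie :: "real^'m \<Rightarrow> real^('m::finite option)^('m option)" where
  "N_lie y = block_mat 0 0 y 0"

lemma bounded_linear_N_lie: "bounded_linear N_lie"
proof (rule linear_conv_bounded_linear[THEN iffD1], rule linearI)
  show "N_lie (b1 + b2) = N_lie b1 + N_lie b2" for b1 b2 :: "real^'a"
    by (rule mat_option_eqI) (simp_all add: N_lie_def)
  show "N_lie (r *\<^sub>R b) = r *\<^sub>R N_lie b" for b :: "real^'a" and r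
    by (rule mat_option_eqI) (simp_all add: N_lie_def)
qed

lemma N_minus_eq: "N_minus_elt y = mat 1 + N_lie y"
  by (rule mat_option_eqI) (auto simp: N_minus_elt_def N_lie_def mat_def)

lemma N_minus_mult_N_lie: "N_minus_elt y ** N_lie z = N_lie z"
  unfolding N_minus_elt_def N_lie_def block_mat_mult
  by (intro block_mat_cong) (simp_all add: vec_eq_iff matrix_matrix_mult_def)

lemma mult_N_minus_eq: "x ** N_minus_elt y = x + x ** N_lie y"
  by (simp add: N_minus_eq matrix_add_ldistrib)

lemma matrix_mult_scaleR: "A ** (t *\<^sub>R B) = t *\<^sub>R (A ** B)" for A :: "real^'n^'m" and B :: "real^'p^'n"
  by (simp add: vec_eq_iff matrix_matrix_mult_def sum_distrib_left mult.left_commute)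

text \<open>The velocity of the chart is a left invariant vector field, that is, right multiplication by a fixed matrix.\<close>

lemma mult_N_minus_add: "x ** N_minus_elt (y + t *\<^sub>R v) = x ** N_minus_elt y + t *\<^sub>R ((x ** N_minus_elt y) ** N_lie v)"
proof -
  have "x ** N_minus_elt y ** N_lie v = x ** N_lie v"
    by (simp only: N_minus_mult_N_lie flip: matrix_mul_assoc)
  then show ?thesis
    by (simp add: mult_N_minus_eq linear_simps(1,5)[OF bounded_linear_N_lie] matrix_add_ldistrib matrix_mult_scaleR)
qed

lemma smooth_mult_N_minus: "smooth_on (\<lambda>y. x ** N_minus_elt y) UNIV"
  unfolding mult_N_minus_eq
  using bounded_linear_compose[OF bounded_linear_matrix_mult_left[of x] bounded_linear_N_lie]
  by (intro smooth_on_add smooth_on_const smooth_on_bounded_linear open_UNIV)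

lemma open_smooth_preimage: "smooth_on g UNIV \<Longrightarrow> open U \<Longrightarrow> open {y. g y \<in> U}"
  using open_vimage[of U g] smooth_on_imp_continuous_on[of g UNIV] by (simp add: vimage_def)

lemma smooth_chart:
  assumes "smooth_on_SL f" "x \<in> SL"
  shows "smooth_on (\<lambda>y. f (x ** N_minus_elt y)) UNIV"
proof (rule smooth_on_local[OF open_UNIV])
  fix y0
  have SL: "x ** N_minus_elt y \<in> SL" for y
    by (intro SL_mult assms N_minus_in_SL)
  obtain U F where U: "open U" "x ** N_minus_elt y0 \<in> U" "smooth_on F U" "\<And>h. h \<in> U \<inter> SL \<Longrightarrow> F h = f h"
    using assms(1) SL unfolding smooth_on_SL_def by metis
  define V where "V = {y. x ** N_minus_elt y \<in> U}"
  have V: "open V"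
    unfolding V_def by (rule open_smooth_preimage[OF smooth_mult_N_minus U(1)])
  have "smooth_on (\<lambda>y. F (x ** N_minus_elt y)) V"
    by (rule smooth_on_compose[OF V U(1,3) smooth_on_subset[OF smooth_mult_N_minus]]) (auto simp: V_def)
  then have "smooth_on (\<lambda>y. f (x ** N_minus_elt y)) V"
    by (rule iffD1[OF smooth_on_cong[OF V], rotated]) (use SL U(4) in \<open>auto simp: V_def\<close>)
  then show "\<exists>U. open U \<and> y0 \<in> U \<and> smooth_on (\<lambda>y. f (x ** N_minus_elt y)) U"
    using V U(2) by (auto simp: V_def)
qed

lemma left_trans_matrix_inv: "p \<in> SL \<Longrightarrow> left_trans (matrix_inv p) f = (\<lambda>x. f (p ** x))"
  by (simp add: left_trans_def matrix_inv_matrix_inv SL_det_nz)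

lemma mult_in_SL_iff: "p \<in> SL \<Longrightarrow> p ** x \<in> SL \<longleftrightarrow> x \<in> SL"
  by (simp add: SL_def det_mul)

lemma Ind_left_mult:
  assumes "f \<in> Ind \<alpha> \<rho> lam" "p \<in> SL"
  shows "(\<lambda>x. f (p ** x)) \<in> Ind \<alpha> \<rho> lam"
proof -
  have "smooth_on_SL (\<lambda>x. f (p ** x))"
    unfolding smooth_on_SL_def
  proof
    fix g :: "real^('a option)^('a option)" assume "g \<in> SL"
    then have "p ** g \<in> SL" by (intro SL_mult assms)
    then obtain U F where U: "open U" "p ** g \<in> U" "smooth_on F U" "\<And>h. h \<in> U \<inter> SL \<Longrightarrow> F h = f h"
      using Ind_smooth[OF assms(1)] unfolding smooth_on_SL_def by metis
    define V where "V = {x. p ** x \<in> U}"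
    have sm: "smooth_on (\<lambda>x. p ** x) UNIV"
      by (intro smooth_on_bounded_linear bounded_linear_matrix_mult_left) auto
    have V: "open V"
      unfolding V_def by (rule open_smooth_preimage[OF sm U(1)])
    have "smooth_on (\<lambda>x. F (p ** x)) V"
      by (rule smooth_on_compose[OF V U(1,3) smooth_on_subset[OF sm]]) (auto simp: V_def)
    then show "\<exists>U F. open U \<and> g \<in> U \<and> smooth_on F U \<and> (\<forall>h\<in>U \<inter> SL. F h = f (p ** h))"
      using V U(2,4) assms(2) by (intro exI[of _ V] exI) (auto simp: V_def mult_in_SL_iff)
  qed
  then show ?thesis
    using assms by (auto simp: Ind_def mult_in_SL_iff matrix_mul_assoc)
qed

lemma Ind_left_trans:
  assumes "f \<in> Ind \<alpha> \<rho> lam" "p \<in> SL"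
  shows "left_trans p f \<in> Ind \<alpha> \<rho> lam"
  unfolding left_trans_def by (intro Ind_left_mult assms SL_inv)

text \<open>The converse of \<open>Ind_triv_col0\<close>.\<close>

lemma homogeneous_in_Ind:
  fixes F :: "real^('m::finite option) \<Rightarrow> complex"
  assumes "smooth_on F (- {0})" "\<And>a v. a \<noteq> 0 \<Longrightarrow> v \<noteq> 0 \<Longrightarrow> F (a *\<^sub>R v) = chi \<alpha> lam a * F v"
  shows "(\<lambda>x. if x \<in> SL then \<chi> i. F (col0 x) else 0) \<in> Ind \<alpha> (triv_rep :: real^'m^'m \<Rightarrow> complex^1^1) lam"
proof -
  let ?f = "\<lambda>x. if x \<in> SL then \<chi> i. F (col0 x) else 0 :: complex^1"
  have sm: "smooth_on col0 (UNIV :: (real^('m option)^('m option)) set)"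
    by (intro smooth_on_bounded_linear bounded_linear_col0) auto
  define U where "U = {x :: real^('m option)^('m option). col0 x \<in> - {0}}"
  have U: "open U"
    unfolding U_def by (rule open_smooth_preimage[OF sm]) auto
  have lin: "bounded_linear (\<lambda>c. \<chi> i. c :: complex^1)"
    by (rule linear_conv_bounded_linear[THEN iffD1], rule linearI) (simp_all add: vec_eq_iff)
  have "smooth_on (\<lambda>x. F (col0 x)) U"
    by (rule smooth_on_compose[OF U _ assms(1) smooth_on_subset[OF sm]]) (auto simp: U_def)
  then have "smooth_on (\<lambda>x. (\<chi> i. F (col0 x)) :: complex^1) U"
    by (rule smooth_on_compose_linear[OF U lin])
  then have "smooth_on_SL ?f"
    unfolding smooth_on_SL_def using U
    by (intro ballI exI[of _ U] exI) (auto simp: U_def dest: col0_nonzero)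
  moreover have "?f (x ** (M_elt g ** A_elt t ** N_plus_elt y)) = matrix_inv (ind_char \<alpha> triv_rep lam g t) *v ?f x"
    if x: "x \<in> SL" and g: "g \<in> SLpm" for x and g :: "real^'m^'m" and t y
  proof -
    define a where "a = inverse (det g) * exp t"
    have a: "a \<noteq> 0" using SLpm_det_nz[OF g] by (simp add: a_def)
    have "col0 (P_elt g t y) = a *\<^sub>R col0 (mat 1)"
    proof -
      have "col0 (P_elt g t y) = vcons a 0"
        by (simp add: P_elt_block col0_block_mat a_def)
      moreover have "col0 (mat 1 :: real^('m option)^('m option)) = vcons 1 0"
        using col0_block_mat[of 1 0 "0 :: real^'m" "mat 1"] N_minus_0[where 'a = 'm] by (simp add: N_minus_elt_def)
      ultimately show ?thesis by (simp add: vcons_scaleR)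
    qed
    then have "col0 (x ** P_elt g t y) = a *\<^sub>R (x *v col0 (mat 1))"
      by (simp add: col0_mult matrix_vector_mult_scaleR)
    then have "col0 (x ** P_elt g t y) = a *\<^sub>R col0 x"
      using col0_mult[of x "mat 1"] by simp
    then have "F (col0 (x ** P_elt g t y)) = chi \<alpha> lam a * F (col0 x)"
      by (simp add: assms(2)[OF a col0_nonzero[OF x]])
    moreover have "x ** P_elt g t y \<in> SL"
      by (intro SL_mult x P_elt_in_SL g)
    ultimately have "?f (x ** P_elt g t y) = chi \<alpha> lam a *s ?f x"
      using x by (simp add: vec_eq_iff)
    then show ?thesis
      by (simp only: P_elt_def[symmetric] matrix_inv_ind_char_triv[OF g] mat_vector_mult a_def)
  qed
  ultimately show ?thesis
    unfolding Ind_def by simp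
qed

text \<open>In the chart \<open>v = (1, y)\<close> this is \<open>q(y)\<close> times an even smooth function with value \<open>1\<close> at the origin, so the Taylor
  form of order \<open>j\<close> is \<open>j! q\<close>. The number \<open>D\<close> is the degree of the polynomial factor; its parity
  has to match the sign \<open>\<alpha>\<close>.\<close>

definition test_fun :: "complex \<Rightarrow> nat \<Rightarrow> (complex^'m \<Rightarrow> complex) \<Rightarrow> nat \<Rightarrow> real^('m::finite option) \<Rightarrow> complex" where
  "test_fun lam j q D v = of_real ((v $ None) ^ (D - j)) * q (cvec (\<chi> i. v $ Some i))
     * exp (- ((lam + of_nat D) / 2) * of_real (ln (v \<bullet> v)))"

lemma smooth_test_fun:
  assumes "q \<in> Pol j"
  shows "smooth_on (test_fun lam j q D) (- {0})"
proof -
  have U: "open (- {0} :: (real^('a option)) set)" by (rule open_Compl[OF closed_singleton])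
  have "bounded_linear (\<lambda>v::real^('a option). \<chi> i. v $ Some i)"
    by (rule linear_conv_bounded_linear[THEN iffD1], rule linearI) (simp_all add: vec_eq_iff)
  then have tail: "smooth_on (\<lambda>v::real^('a option). \<chi> i. v $ Some i) (- {0})"
    by (intro smooth_on_bounded_linear U)
  have "smooth_on (\<lambda>v::real^('a option). v $ None) (- {0})"
    by (intro smooth_on_bounded_linear U bounded_linear_vec_nth)
  then have "smooth_on (\<lambda>v::real^('a option). complex_of_real ((v $ None) ^ (D - j))) (- {0})"
    by (intro smooth_on_compose_linear[OF U bounded_linear_of_real] smooth_on_power U)
  moreover have "smooth_on (\<lambda>v::real^('a option). q (cvec (\<chi> i. v $ Some i))) (- {0})"
    by (rule smooth_on_compose[OF U open_UNIV smooth_Pol[OF assms] tail]) simp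
  moreover have "smooth_on (\<lambda>v::real^('a option). exp (- ((lam + of_nat D) / 2) * of_real (ln (v \<bullet> v)))) (- {0})"
  proof (rule smooth_on_compose[OF U open_UNIV smooth_on_exp], rule smooth_on_mult[OF U smooth_on_const[OF U]],
      rule smooth_on_compose_linear[OF U bounded_linear_of_real])
    show "smooth_on (\<lambda>v::real^('a option). ln (v \<bullet> v)) (- {0})"
    proof (rule smooth_on_compose[OF U open_greaterThan smooth_on_ln])
      show "smooth_on (\<lambda>v::real^('a option). v \<bullet> v) (- {0})"
        by (rule smooth_on_bilinear[OF U bounded_bilinear_inner smooth_on_id[OF U] smooth_on_id[OF U]])
    qed auto
  qed simp
  ultimately show ?thesis
    unfolding test_fun_def by (intro smooth_on_mult U)
qed

lemma test_fun_homogeneous: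
  assumes q: "q \<in> Pol j" and D: "j \<le> D" "even D \<longleftrightarrow> \<alpha> = Plus" and a: "a \<noteq> 0" and v: "v \<noteq> 0"
  shows "test_fun lam j q D (a *\<^sub>R v) = chi \<alpha> lam a * test_fun lam j q D v"
proof -
  have ln: "ln ((a *\<^sub>R v) \<bullet> (a *\<^sub>R v)) = 2 * ln \<bar>a\<bar> + ln (v \<bullet> v)"
  proof -
    have "(a *\<^sub>R v) \<bullet> (a *\<^sub>R v) = \<bar>a\<bar> ^ 2 * (v \<bullet> v)" by (simp add: power2_eq_square)
    moreover have "ln (\<bar>a\<bar> ^ 2 * (v \<bullet> v)) = ln (\<bar>a\<bar> ^ 2) + ln (v \<bullet> v)"
      using a v by (intro ln_mult_pos) auto
    moreover have "ln (\<bar>a\<bar> ^ 2) = 2 * ln \<bar>a\<bar>"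
      using ln_realpow[of "\<bar>a\<bar>" 2] a by simp
    ultimately show ?thesis by (simp only:)
  qed
  have pow: "complex_of_real a ^ D * exp (- of_nat D * of_real (ln \<bar>a\<bar>)) = sgn_char \<alpha> a"
  proof -
    have "exp (- of_nat D * complex_of_real (ln \<bar>a\<bar>)) = of_real (inverse (\<bar>a\<bar> ^ D))"
    proof -
      have "exp (- of_nat D * complex_of_real (ln \<bar>a\<bar>)) = of_real (exp (- (of_nat D * ln \<bar>a\<bar>)))"
        by (simp add: exp_of_real[symmetric])
      also have "exp (- (of_nat D * ln \<bar>a\<bar>)) = inverse (\<bar>a\<bar> ^ D)"
        using a by (simp add: exp_minus exp_of_nat_mult)
      finally show ?thesis .
    qed
    moreover have "a ^ D * inverse (\<bar>a\<bar> ^ D) = (if even D then 1 else sgn a)"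
    proof -
      have "a ^ D * inverse (\<bar>a\<bar> ^ D) = (sgn a) ^ D"
        using a by (simp add: power_mult_distrib[symmetric] power_inverse[symmetric] sgn_if)
      then show ?thesis using a by (simp add: sgn_if)
    qed
    ultimately have "complex_of_real a ^ D * exp (- of_nat D * of_real (ln \<bar>a\<bar>)) = of_real (if even D then 1 else sgn a)"
      by (simp only: of_real_mult[symmetric] of_real_power[symmetric])
    then show ?thesis
      using D(2) by (cases \<alpha>) (simp_all add: sgn_char_def)
  qed
  have q': "q (cvec (\<chi> i. (a *\<^sub>R v) $ Some i)) = of_real a ^ j * q (cvec (\<chi> i. v $ Some i))"
  proof -
    have "cvec (\<chi> i. (a *\<^sub>R v) $ Some i) = complex_of_real a *s cvec (\<chi> i. v $ Some i)"
      by (simp add: vec_eq_iff)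
    then show ?thesis by (simp add: Pol_homogeneous[OF q])
  qed
  have e: "exp (- ((lam + of_nat D) / 2) * of_real (2 * ln \<bar>a\<bar> + ln (v \<bullet> v)))
     = exp (- lam * of_real (ln \<bar>a\<bar>)) * exp (- of_nat D * of_real (ln \<bar>a\<bar>))
       * exp (- ((lam + of_nat D) / 2) * of_real (ln (v \<bullet> v)))"
    unfolding exp_add[symmetric] by (rule arg_cong[of _ _ exp]) (simp add: field_simps)
  have "complex_of_real a ^ (D - j) * of_real a ^ j = of_real a ^ D"
    using D(1) by (simp add: power_add[symmetric])
  then have "test_fun lam j q D (a *\<^sub>R v) = (complex_of_real a ^ D * exp (- of_nat D * of_real (ln \<bar>a\<bar>)))
      * exp (- lam * of_real (ln \<bar>a\<bar>)) * test_fun lam j q D v"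
    unfolding test_fun_def ln e q' by (simp add: power_mult_distrib mult_ac)
  then show ?thesis
    by (simp only: pow chi_def)
qed

section \<open>Construction of the intertwining operators\<close>

definition chart :: "(real^('m::finite option)^('m option) \<Rightarrow> complex^1) \<Rightarrow>
    real^('m option)^('m option) \<Rightarrow> real^'m \<Rightarrow> complex" where
  "chart f x y = f (x ** N_minus_elt y) $ 1"

lemma smooth_chart_component:
  assumes "smooth_on_SL f" "x \<in> SL"
  shows "smooth_on (chart f x) UNIV"
  unfolding chart_def[abs_def]
  by (rule smooth_on_compose_linear[OF open_UNIV bounded_linear_vec_nth smooth_chart[OF assms]])

lemma partials_chart:
  assumes "smooth_on_SL f" "x \<in> SL"
  shows "partials js (chart f x) y = partials js (\<lambda>y. f (x ** N_minus_elt y)) y $ 1"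
  unfolding chart_def[abs_def]
  by (simp add: partials_bounded_linear[OF bounded_linear_vec_nth smooth_chart[OF assms]])

lemma partials_translate: "partials js (\<lambda>y. F (a + y)) z = partials js F (a + z)"
  by (induction js arbitrary: z) (simp_all add: add.assoc)

lemma partials_chart_N_minus:
  assumes "smooth_on_SL f" "g \<in> SL"
  shows "partials js (chart f (g ** N_minus_elt x)) 0 = partials js (\<lambda>y. f (g ** N_minus_elt y)) x $ 1"
proof -
  have "chart f (g ** N_minus_elt x) = (\<lambda>y. chart f g (x + y))"
    by (simp add: chart_def[abs_def] N_minus_add flip: matrix_mul_assoc)
  then show ?thesis
    by (simp add: partials_translate partials_chart[OF assms])
qed

text \<open>To show that \<open>x \<mapsto> partials js (chart f x) 0\<close> is smooth on the group, the coordinate derivatives are written as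
  derivatives along left invariant vector fields. Their formula makes sense for functions on the whole matrix space, and hence applies to local
  smooth extensions of \<open>f\<close>.\<close>

primrec left_derivs :: "'m list \<Rightarrow> (real^('m::finite option)^('m option) \<Rightarrow> 'b::real_normed_vector) \<Rightarrow>
    real^('m option)^('m option) \<Rightarrow> 'b" where
  "left_derivs [] F = F"
| "left_derivs (j # js) F = (\<lambda>x. frechet_derivative (left_derivs js F) (at x) (x ** N_lie (axis j 1)))"

lemma smooth_left_derivs:
  assumes "open U" "smooth_on F U"
  shows "smooth_on (left_derivs js F) U"
proof (induction js)
  case (Cons j js)
  define G where "G = left_derivs js F"
  have G: "smooth_on G U" using Cons by (simp add: G_def)
  have "smooth_on (\<lambda>x. \<Sum>b\<in>Basis. ((x ** N_lie (axis j 1)) \<bullet> b) *\<^sub>R frechet_derivative G (at x) b) U"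
    by (intro smooth_on_sum assms(1) smooth_on_bilinear[OF _ bounded_bilinear_scaleR] smooth_on_frechet_derivative G
        smooth_on_bilinear[OF _ bounded_bilinear_inner] smooth_on_const smooth_on_bounded_linear
        bounded_linear_matrix_mult_right)
  moreover have "(\<Sum>b\<in>Basis. ((x ** N_lie (axis j 1)) \<bullet> b) *\<^sub>R frechet_derivative G (at x) b)
      = left_derivs (j # js) F x" if "x \<in> U" for x
  proof -
    interpret bounded_linear "frechet_derivative G (at x)"
      by (rule has_derivative_bounded_linear[OF smooth_on_has_derivative[OF assms(1) G that]])
    have "frechet_derivative G (at x) (\<Sum>b\<in>Basis. ((x ** N_lie (axis j 1)) \<bullet> b) *\<^sub>R b)
      = (\<Sum>b\<in>Basis. ((x ** N_lie (axis j 1)) \<bullet> b) *\<^sub>R frechet_derivative G (at x) b)"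
      by (simp only: sum scaleR)
    then show ?thesis by (simp add: euclidean_representation G_def)
  qed
  ultimately show ?case
    by (rule iffD1[OF smooth_on_cong[OF assms(1)], rotated])
qed (simp add: assms)

lemma partials_eq_left_derivs:
  assumes "open U" "smooth_on F U" "\<And>h. h \<in> U \<inter> SL \<Longrightarrow> F h = f h" "x \<in> SL" "x ** N_minus_elt y \<in> U"
  shows "partials js (\<lambda>y. f (x ** N_minus_elt y)) y = left_derivs js F (x ** N_minus_elt y)"
  using assms(5)
proof (induction js arbitrary: y)
  case Nil
  then show ?case using assms(3,4) by (simp add: SL_mult N_minus_in_SL)
next
  case (Cons j js)
  let ?e = "axis j (1::real)"
  let ?c = "\<lambda>t. x ** N_minus_elt (y + t *\<^sub>R ?e)"
  have line: "?c t = x ** N_minus_elt y + t *\<^sub>R ((x ** N_minus_elt y) ** N_lie ?e)" for t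
    by (rule mult_N_minus_add)
  define V where "V = {t. ?c t \<in> U}"
  have V: "open V"
    unfolding V_def line
    by (rule open_smooth_preimage[OF _ assms(1)])
      (intro smooth_on_add smooth_on_const smooth_on_bilinear[OF _ bounded_bilinear_scaleR] smooth_on_id open_UNIV)
  have "(left_derivs js F has_derivative frechet_derivative (left_derivs js F) (at (x ** N_minus_elt y))) (at (?c 0))"
    using smooth_on_has_derivative[OF assms(1) smooth_left_derivs[OF assms(1,2)] Cons.prems] by simp
  moreover have "(?c has_vector_derivative (x ** N_minus_elt y) ** N_lie ?e) (at 0)"
    unfolding line by (auto intro!: derivative_eq_intros)
  ultimately have "((\<lambda>t. left_derivs js F (?c t)) has_vector_derivative left_derivs (j # js) F (x ** N_minus_elt y)) (at 0)"
    using vector_derivative_diff_chain_within[of ?c _ 0 UNIV "left_derivs js F"] by (simp add: o_def has_derivative_at_withinI)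
  then have "((\<lambda>t. partials js (\<lambda>y. f (x ** N_minus_elt y)) (y + t *\<^sub>R ?e)) has_vector_derivative
      left_derivs (j # js) F (x ** N_minus_elt y)) (at 0)"
    by (rule has_vector_derivative_transform_within_open[OF _ V])
      (use Cons in \<open>auto simp: V_def\<close>)
  then show ?case
    by (simp add: vector_derivative_at del: left_derivs.simps)
qed

definition linear_on_Pol :: "nat \<Rightarrow> ((complex^'m \<Rightarrow> complex) \<Rightarrow> complex^'d) \<Rightarrow> bool" where
  "linear_on_Pol k S \<longleftrightarrow> (\<forall>p\<in>Pol k. \<forall>q\<in>Pol k. S (\<lambda>z. p z + q z) = S p + S q) \<and>
     (\<forall>p\<in>Pol k. \<forall>c. S (\<lambda>z. c * p z) = c *s S p)"

lemma linear_on_Pol_add: "linear_on_Pol k S \<Longrightarrow> p \<in> Pol k \<Longrightarrow> q \<in> Pol k \<Longrightarrow> S (\<lambda>z. p z + q z) = S p + S q"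
  by (simp add: linear_on_Pol_def)

lemma linear_on_Pol_cmult: "linear_on_Pol k S \<Longrightarrow> p \<in> Pol k \<Longrightarrow> S (\<lambda>z. c * p z) = c *s S p"
  by (simp add: linear_on_Pol_def)

lemma linear_on_Pol_zero: "linear_on_Pol k S \<Longrightarrow> S (\<lambda>z. 0) = 0"
  using linear_on_Pol_cmult[OF _ Pol_zero, of k S 0] by simp

lemma linear_on_Pol_sum:
  assumes S: "linear_on_Pol k S" and f: "\<And>i. i \<in> A \<Longrightarrow> f i \<in> Pol k"
  shows "S (\<lambda>z. \<Sum>i\<in>A. c i * f i z) = (\<Sum>i\<in>A. c i *s S (f i))"
  using f
proof (induction A rule: infinite_finite_induct)
  case (insert i A)
  then have "(\<lambda>z. c i * f i z) \<in> Pol k" "(\<lambda>z. \<Sum>i\<in>A. c i * f i z) \<in> Pol k"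
    by (auto intro!: Pol_cmult Pol_sum)
  with insert show ?case
    by (simp add: linear_on_Pol_add[OF S] linear_on_Pol_cmult[OF S])
qed (simp_all add: linear_on_Pol_zero[OF S])

lemma linear_on_Pol_taylor_form:
  assumes "linear_on_Pol k S"
  shows "S (taylor_form k F) = (\<Sum>js | length js = k. partials js F 0 *s S (monomial (count_list js)))"
  unfolding taylor_form_def[abs_def]
  by (rule linear_on_Pol_sum[OF assms]) (simp add: monomial_count_in_Pol)

lemma Ind_add:
  assumes f: "f \<in> Ind \<alpha> \<rho> lam" and h: "h \<in> Ind \<alpha> \<rho> lam"
  shows "(\<lambda>x. f x + h x) \<in> Ind \<alpha> \<rho> lam"
proof -
  have "smooth_on_SL (\<lambda>x. f x + h x)"
    unfolding smooth_on_SL_def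
  proof
    fix g :: "real^('a option)^('a option)" assume g: "g \<in> SL"
    obtain U F where U: "open U" "g \<in> U" "smooth_on F U" "\<forall>h\<in>U \<inter> SL. F h = f h"
      using Ind_smooth[OF f] g unfolding smooth_on_SL_def by blast
    obtain V H where V: "open V" "g \<in> V" "smooth_on H V" "\<forall>x\<in>V \<inter> SL. H x = h x"
      using Ind_smooth[OF h] g unfolding smooth_on_SL_def by blast
    have "smooth_on (\<lambda>x. F x + H x) (U \<inter> V)"
      using U V by (intro smooth_on_add) (auto intro: smooth_on_subset)
    then show "\<exists>U F. open U \<and> g \<in> U \<and> smooth_on F U \<and> (\<forall>x\<in>U \<inter> SL. F x = f x + h x)"
      using U V by (intro exI[of _ "U \<inter> V"] exI[of _ "\<lambda>x. F x + H x"]) auto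
  qed
  with f h show ?thesis
    by (simp add: Ind_def matrix_vector_right_distrib)
qed

lemma bounded_linear_vector_smult: "bounded_linear (\<lambda>v :: complex^'d. c *s v)"
  by (rule linear_conv_bounded_linear[THEN iffD1], rule linearI) (simp_all add: vec_eq_iff algebra_simps)

lemma Ind_scale:
  assumes f: "f \<in> Ind \<alpha> \<rho> lam"
  shows "(\<lambda>x. c *s f x) \<in> Ind \<alpha> \<rho> lam"
proof -
  have "smooth_on_SL (\<lambda>x. c *s f x)"
    unfolding smooth_on_SL_def
  proof
    fix g :: "real^('a option)^('a option)" assume g: "g \<in> SL"
    obtain U F where U: "open U" "g \<in> U" "smooth_on F U" "\<forall>h\<in>U \<inter> SL. F h = f h"
      using Ind_smooth[OF f] g unfolding smooth_on_SL_def by blast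
    then show "\<exists>U F. open U \<and> g \<in> U \<and> smooth_on F U \<and> (\<forall>x\<in>U \<inter> SL. F x = c *s f x)"
      by (intro exI[of _ U] exI[of _ "\<lambda>x. c *s F x"])
        (auto intro: smooth_on_compose_linear[OF _ bounded_linear_vector_smult])
  qed
  with f show ?thesis
    by (simp add: Ind_def vec.scale vector_scalar_commute)
qed

text \<open>The element \<open>P_elt g t \<eta>\<close> maps \<open>(1, s z)\<close> to a multiple of a vector of the form \<open>(1, y)\<close>, where \<open>y\<close> is again on a line through the
  origin; on these lines it acts by a fractional linear change of the parameter.\<close>

lemma chart_P_elt:
  fixes f :: "real^('m::finite option)^('m option) \<Rightarrow> complex^1" and g :: "real^'m^'m" and t :: real
  assumes f: "f \<in> Ind \<alpha> triv_rep lam" and x: "x \<in> SL" and g: "g \<in> SLpm"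
    and w: "0 < 1 + s * (\<eta> \<bullet> z)"
  defines "a \<equiv> inverse (det g) * exp t"
    and "r \<equiv> det g * exp (- t * (1 + 1 / real CARD('m)))"
  shows "chart f (x ** P_elt g t \<eta>) (s *\<^sub>R z)
    = chi \<alpha> lam (a * (1 + s * (\<eta> \<bullet> z))) * chart f x ((s / (1 + s * (\<eta> \<bullet> z))) *\<^sub>R (r *\<^sub>R (g *v z)))"
proof -
  define c where "c = 1 + s * (\<eta> \<bullet> z)"
  have dg: "inverse (det g) = det g" using g by (auto simp: SLpm_def)
  have "exp (- t / real CARD('m)) = exp t * exp (- t * (1 + 1 / real CARD('m)))"
    by (simp add: exp_add[symmetric] algebra_simps)
  moreover have "det g * det g = 1" using g by (auto simp: SLpm_def)
  ultimately have ar: "exp (- t / real CARD('m)) = a * r"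
    unfolding a_def r_def dg by (simp add: algebra_simps)
  have "P_elt g t \<eta> *v vcons 1 (s *\<^sub>R z) = vcons (a * c) ((a * r * s) *\<^sub>R (g *v z))"
    unfolding P_elt_block block_mat_vcons a_def[symmetric] ar
    by (simp add: c_def algebra_simps scaleR_matrix_vector_assoc[symmetric] matrix_vector_mult_scaleR)
  also have "\<dots> = (a * c) *\<^sub>R vcons 1 ((s / c) *\<^sub>R (r *\<^sub>R (g *v z)))"
    using w by (simp add: vcons_scaleR c_def mult_ac)
  finally have "col0 (x ** P_elt g t \<eta> ** N_minus_elt (s *\<^sub>R z))
      = (a * c) *\<^sub>R col0 (x ** N_minus_elt ((s / c) *\<^sub>R (r *\<^sub>R (g *v z))))"
    unfolding col0_N_minus by (simp add: matrix_vector_mult_scaleR flip: matrix_vector_mul_assoc)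
  then have "f (x ** P_elt g t \<eta> ** N_minus_elt (s *\<^sub>R z))
      = chi \<alpha> lam (a * c) *s f (x ** N_minus_elt ((s / c) *\<^sub>R (r *\<^sub>R (g *v z))))"
    by (intro Ind_triv_col0[OF f] SL_mult x P_elt_in_SL g N_minus_in_SL)
  then show ?thesis by (simp add: chart_def c_def)
qed

text \<open>The equivariance of the Taylor form. On a line, \<open>chi\<close> contributes the power of \<open>1 + c s\<close> with exponent \<open>-lam\<close>, which for
  \<open>lam = 1 - k\<close> is the weight in Bol's lemma; so the dependence on \<open>\<eta>\<close> disappears. For \<open>k = 0\<close> only the value at \<open>s = 0\<close> enters, and \<open>lam\<close> is free.\<close>

lemma taylor_form_chart_P:
  fixes f :: "real^('m::finite option)^('m option) \<Rightarrow> complex^1" and g :: "real^'m^'m"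
  assumes f: "f \<in> Ind \<alpha> triv_rep lam" and x: "x \<in> SL" and g: "g \<in> SLpm"
    and k: "k = 0 \<or> lam = 1 - of_nat k" and \<nu>: "\<nu> = lam + of_nat k * (1 + 1 / of_nat CARD('m))"
  shows "taylor_form k (chart f (x ** P_elt g t \<eta>)) = (\<lambda>z. sgn_char (sign_shift \<alpha> k) (det g) * exp (- \<nu> * of_real t) *
      taylor_form k (chart f x) (map_matrix complex_of_real g *v z))"
proof (rule Pol_eqI[OF taylor_form_in_Pol])
  show "(\<lambda>z. sgn_char (sign_shift \<alpha> k) (det g) * exp (- \<nu> * of_real t) *
      taylor_form k (chart f x) (map_matrix complex_of_real g *v z)) \<in> Pol k"
    by (intro Pol_cmult Pol_substitute taylor_form_in_Pol)
  fix z :: "real^'m"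
  define a where "a = inverse (det g) * exp t"
  define r where "r = det g * exp (- t * (1 + 1 / real CARD('m)))"
  have d: "det g = 1 \<or> det g = -1" using g by (auto simp: SLpm_def)
  then have a: "a \<noteq> 0" by (auto simp: a_def)
  have chi_a: "chi \<alpha> lam a = sgn_char \<alpha> (det g) * exp (- lam * of_real t)"
    using d by (auto simp: chi_def a_def abs_mult sgn_char_mult sgn_char_pos)
  have chi_nz: "chi \<alpha> lam a \<noteq> 0"
    using a by (simp add: chi_def sgn_char_nonzero)
  have sm: "smooth_on (chart f x) UNIV" and sm': "smooth_on (chart f (x ** P_elt g t \<eta>)) UNIV"
    using Ind_smooth[OF f] x g by (auto intro!: smooth_chart_component SL_mult P_elt_in_SL)
  define I where "I = {s. 0 < 1 + (\<eta> \<bullet> z) * s}"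
  have I: "open I" "0 \<in> I"
    unfolding I_def by (auto intro!: open_Collect_less continuous_intros)
  let ?l = "\<lambda>x z n s. \<Sum>js | length js = n. partials js (chart f x) (s *\<^sub>R z) * monomial (count_list js) (cvec z)"
  let ?xp = "x ** P_elt g t \<eta>"
  have h: "derivs UNIV (?l x (r *\<^sub>R (g *v z)))" and h': "derivs UNIV (?l ?xp z)"
    by (intro derivs_line sm sm')+
  have val: "?l x z 0 s = chart f x (s *\<^sub>R z)" for x z s
    by (simp add: monomial_def)
  have tf: "?l x z n 0 = taylor_form n (chart f x) (cvec z)" for x z n
    by (simp add: taylor_form_def)
  have col: "chart f ?xp (s *\<^sub>R z) = chi \<alpha> lam (a * (1 + (\<eta> \<bullet> z) * s)) *
      chart f x ((s / (1 + (\<eta> \<bullet> z) * s)) *\<^sub>R (r *\<^sub>R (g *v z)))" if "s \<in> I" for s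
    using chart_P_elt[OF f x g, of s \<eta> z t] that
    by (simp add: a_def r_def I_def mult.commute)
  have main: "taylor_form k (chart f ?xp) (cvec z) = chi \<alpha> lam a * taylor_form k (chart f x) (cvec (r *\<^sub>R (g *v z)))"
  proof (cases k)
    case 0
    then show ?thesis using col[OF I(2)] by (simp add: tf[symmetric] monomial_def)
  next
    case (Suc k')
    then have lam: "lam = - of_nat k'" using k by simp
    define G where "G n s = inverse (chi \<alpha> lam a) * ?l ?xp z n s" for n s
    have G: "derivs I G"
      using h' unfolding derivs_def G_def[abs_def] by (auto intro!: has_vector_derivative_mult_right)
    have "G 0 s = of_real (1 + (\<eta> \<bullet> z) * s) ^ k' * ?l x (r *\<^sub>R (g *v z)) 0 (s / (1 + (\<eta> \<bullet> z) * s))" if s: "s \<in> I" for s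
    proof -
      have w: "0 < 1 + (\<eta> \<bullet> z) * s" using s by (simp add: I_def)
      have "chi \<alpha> lam (1 + (\<eta> \<bullet> z) * s) = exp (of_nat k' * complex_of_real (ln (1 + (\<eta> \<bullet> z) * s)))"
        using w by (simp add: chi_def sgn_char_pos lam)
      also have "\<dots> = of_real (1 + (\<eta> \<bullet> z) * s) ^ k'"
        using w by (simp only: exp_of_nat_mult exp_of_real exp_ln)
      finally have chi: "chi \<alpha> lam (1 + (\<eta> \<bullet> z) * s) = of_real (1 + (\<eta> \<bullet> z) * s) ^ k'" .
      have nz: "1 + (\<eta> \<bullet> z) * s \<noteq> 0" using w by simp
      show ?thesis
        unfolding G_def val col[OF s] chi_mult[OF a nz] chi using chi_nz by simp
    qed
    from Bol[OF h G[unfolded I_def] this[unfolded I_def], of 0]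
    have "G k 0 = ?l x (r *\<^sub>R (g *v z)) k 0" by (simp add: Suc)
    then show ?thesis
      unfolding G_def tf using chi_nz by (simp add: field_simps)
  qed
  also have "taylor_form k (chart f x) (cvec (r *\<^sub>R (g *v z))) = of_real r ^ k * taylor_form k (chart f x) (cvec (g *v z))"
    by (simp add: cvec_scaleR Pol_homogeneous[OF taylor_form_in_Pol])
  also have "chi \<alpha> lam a * (of_real r ^ k * taylor_form k (chart f x) (cvec (g *v z)))
      = sgn_char (sign_shift \<alpha> k) (det g) * exp (- \<nu> * of_real t) * taylor_form k (chart f x) (cvec (g *v z))"
  proof -
    define E where "E = exp (of_nat k * of_real (- t * (1 + 1 / real CARD('m))) :: complex)"
    have "of_real r ^ k = of_real (det g) ^ k * E"
      by (simp only: E_def r_def of_real_mult power_mult_distrib exp_of_nat_mult exp_of_real[symmetric])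
    then have "chi \<alpha> lam a * of_real r ^ k = sgn_char (sign_shift \<alpha> k) (det g) * (exp (- lam * of_real t) * E)"
      by (simp only: chi_a sgn_char_shift[OF d] mult_ac)
    also have "exp (- lam * of_real t) * E = exp (- \<nu> * of_real t)"
      unfolding E_def exp_add[symmetric] by (rule arg_cong[of _ _ exp]) (simp add: \<nu> algebra_simps)
    finally have "chi \<alpha> lam a * of_real r ^ k = sgn_char (sign_shift \<alpha> k) (det g) * exp (- \<nu> * of_real t)" .
    then show ?thesis by (simp only: mult.assoc[symmetric])
  qed
  finally show "taylor_form k (chart f ?xp) (cvec z) = sgn_char (sign_shift \<alpha> k) (det g) * exp (- \<nu> * of_real t) *
      taylor_form k (chart f x) (map_matrix complex_of_real g *v cvec z)"
    by (simp add: map_matrix_cvec)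
qed

definition taylor_op :: "(real^('m::finite option)^('m option) \<Rightarrow> complex^1) set \<Rightarrow> nat \<Rightarrow>
    ((complex^'m \<Rightarrow> complex) \<Rightarrow> complex^'d) \<Rightarrow>
    (real^('m option)^('m option) \<Rightarrow> complex^1) \<Rightarrow> real^('m option)^('m option) \<Rightarrow> complex^'d" where
  "taylor_op I k S f = (if f \<in> I then (\<lambda>x. S (taylor_form k (chart f x))) else 0)"

lemma chart_outside:
  assumes "f \<in> Ind \<alpha> \<rho> lam" "x \<notin> SL"
  shows "chart f x = (\<lambda>y. 0)"
proof -
  have "x ** N_minus_elt y \<notin> SL" for y :: "real^'a"
    using assms(2) N_minus_in_SL[of y] by (simp add: SL_def det_mul)
  then show ?thesis
    using assms(1) by (simp add: chart_def[abs_def] Ind_outside)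
qed

lemma taylor_op_smooth:
  assumes S: "linear_on_Pol k S" and f: "smooth_on_SL f"
  shows "smooth_on_SL (\<lambda>x. S (taylor_form k (chart f x)))"
  unfolding smooth_on_SL_def
proof
  fix g :: "real^('a option)^('a option)" assume g: "g \<in> SL"
  obtain U F where U: "open U" "g \<in> U" "smooth_on F U" "\<And>h. h \<in> U \<inter> SL \<Longrightarrow> F h = f h"
    using f g unfolding smooth_on_SL_def by metis
  let ?H = "\<lambda>x. \<Sum>js | length js = k. (left_derivs js F x $ 1) *s S (monomial (count_list js))"
  have lin: "bounded_linear (\<lambda>v :: complex^1. v $ 1 *s w)" for w :: "complex^'b"
    by (rule linear_conv_bounded_linear[THEN iffD1], rule linearI) (simp_all add: vec_eq_iff algebra_simps)
  have "smooth_on ?H U"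
    by (intro smooth_on_sum U(1) smooth_on_compose_linear[OF U(1) lin] smooth_left_derivs U(3))
  moreover have "?H x = S (taylor_form k (chart f x))" if "x \<in> U \<inter> SL" for x
  proof -
    have "partials js (chart f x) 0 = left_derivs js F x $ 1" for js
      using partials_eq_left_derivs[OF U(1,3,4), of x 0 js] that
      by (simp add: partials_chart[OF f] N_minus_0)
    then show ?thesis
      by (simp add: linear_on_Pol_taylor_form[OF S])
  qed
  ultimately show "\<exists>U F. open U \<and> g \<in> U \<and> smooth_on F U \<and> (\<forall>h\<in>U \<inter> SL. F h = S (taylor_form k (chart f h)))"
    using U(1,2) by (intro exI[of _ U] exI[of _ ?H]) auto
qed

lemma taylor_op_diff_op:
  assumes S: "linear_on_Pol k S" and I: "\<And>f. f \<in> I \<Longrightarrow> smooth_on_SL f"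
  shows "diff_op_on I (taylor_op I k S)"
  unfolding diff_op_on_def
proof (intro exI[of _ k] ballI)
  fix g :: "real^('a option)^('a option)" assume g: "g \<in> SL"
  define a :: "'a list \<Rightarrow> real^'a \<Rightarrow> complex^1^'b" where
    "a js x = (if length js = k then \<chi> i l. S (monomial (count_list js)) $ i else 0)" for js x
  have av: "a js x *v v = (if length js = k then v $ 1 *s S (monomial (count_list js)) else 0)" for js x v
    by (simp add: a_def matrix_vector_mult_def vec_eq_iff mult.commute)
  have "smooth_on (a js) UNIV" for js
    unfolding a_def by (rule smooth_on_const) simp
  moreover have "taylor_op I k S f (g ** N_minus_elt x) =
      (\<Sum>js | length js \<le> k. a js x *v partials js (\<lambda>y. f (g ** N_minus_elt y)) x)" if f: "f \<in> I" for f x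
  proof -
    have "(\<Sum>js | length js \<le> k. a js x *v partials js (\<lambda>y. f (g ** N_minus_elt y)) x)
      = (\<Sum>js | length js = k. a js x *v partials js (\<lambda>y. f (g ** N_minus_elt y)) x)"
    proof (rule sum.mono_neutral_right)
      show "finite {js :: 'a list. length js \<le> k}"
        using finite_lists_length_le[of "UNIV :: 'a set" k] by simp
    qed (auto simp: av)
    then show ?thesis
      using f by (simp add: taylor_op_def linear_on_Pol_taylor_form[OF S] partials_chart_N_minus[OF I g] av)
  qed
  ultimately show "\<exists>a. (\<forall>js. smooth_on (a js) UNIV) \<and> (\<forall>f\<in>I. \<forall>x. taylor_op I k S f (g ** N_minus_elt x) =
      (\<Sum>js | length js \<le> k. a js x *v partials js (\<lambda>y. f (g ** N_minus_elt y)) x))"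
    by blast
qed

lemma matrix_inv_ind_char:
  assumes g: "g \<in> SLpm" and \<rho>: "\<rho> g ** matrix_inv (\<rho> g) = mat 1"
  shows "matrix_inv (ind_char \<beta> \<rho> \<nu> g t) *v v = exp (- \<nu> * of_real t) *s (sgn_char \<beta> (det g) *s (matrix_inv (\<rho> g) *v v))"
proof -
  have comm: "\<rho> g ** mat c = mat c ** \<rho> g" for c
    by (simp add: matrix_mat_mult mat_matrix_mult mult.commute)
  have "ind_char \<beta> \<rho> \<nu> g t ** (mat (exp (- \<nu> * of_real t) * sgn_char \<beta> (det g)) ** matrix_inv (\<rho> g))
    = mat (sgn_char \<beta> (det g) * exp (\<nu> * of_real t)) ** (\<rho> g ** mat (exp (- \<nu> * of_real t) * sgn_char \<beta> (det g)))
      ** matrix_inv (\<rho> g)"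
    by (simp add: ind_char_def sign_char_eq matrix_mul_assoc)
  also have "\<dots> = mat ((sgn_char \<beta> (det g) * sgn_char \<beta> (det g)) * (exp (\<nu> * of_real t) * exp (- \<nu> * of_real t)))
      ** (\<rho> g ** matrix_inv (\<rho> g))"
    unfolding comm by (simp add: matrix_mul_assoc mat_mult_mat mult_ac)
  also have "\<dots> = mat 1"
    using SLpm_det_nz[OF g] by (simp add: \<rho> sgn_char_square mult_exp_exp)
  finally have "matrix_inv (ind_char \<beta> \<rho> \<nu> g t) = mat (exp (- \<nu> * of_real t) * sgn_char \<beta> (det g)) ** matrix_inv (\<rho> g)"
    by (rule matrix_inv_unique)
  then show ?thesis
    by (simp add: mat_vector_mult vec.scale_scale flip: matrix_vector_mul_assoc)
qed

text \<open>Invariance under left translations is built into \<open>chart\<close>, and the coefficients in each chart are constant. The point is that the values are sections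
  of the target bundle, which is \<open>taylor_form_chart_P\<close>.\<close>

lemma taylor_op_in_Diff:
  fixes S :: "(complex^'m \<Rightarrow> complex) \<Rightarrow> complex^'d" and \<rho> :: "real^'m^'m \<Rightarrow> complex^'d^'d"
  assumes S: "linear_on_Pol k S"
    and eq: "\<And>g p. g \<in> SLpm \<Longrightarrow> p \<in> Pol k \<Longrightarrow>
      sgn_char (sign_shift \<alpha> k) (det g) *s S (\<lambda>z. p (map_matrix complex_of_real g *v z)) =
      sgn_char \<beta> (det g) *s (matrix_inv (\<rho> g) *v S p)"
    and \<rho>: "\<And>g. g \<in> SLpm \<Longrightarrow> \<rho> g ** matrix_inv (\<rho> g) = mat 1"
    and k: "k = 0 \<or> lam = 1 - of_nat k" and \<nu>: "\<nu> = lam + of_nat k * (1 + 1 / of_nat CARD('m))"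
  defines "I \<equiv> Ind \<alpha> (triv_rep :: real^'m^'m \<Rightarrow> complex^1^1) lam"
  shows "taylor_op I k S \<in> Diff_G I (Ind \<beta> \<rho> \<nu>)"
proof -
  let ?D = "taylor_op I k S"
  have sm: "smooth_on_SL f" if "f \<in> I" for f
    using that Ind_smooth unfolding I_def by blast
  have target: "?D f \<in> Ind \<beta> \<rho> \<nu>" if f: "f \<in> I" for f
    unfolding Ind_def
  proof (intro CollectI conjI allI impI ballI)
    have Df: "?D f = (\<lambda>x. S (taylor_form k (chart f x)))"
      using f by (simp add: taylor_op_def)
    show "smooth_on_SL (?D f)"
      unfolding Df by (rule taylor_op_smooth[OF S sm[OF f]])
    show "?D f x = 0" if x: "x \<notin> SL" for x
      using chart_outside[OF f[unfolded I_def] x]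
      by (simp add: Df linear_on_Pol_taylor_form[OF S] partials_zero)
    fix x :: "real^('m option)^('m option)" and g :: "real^'m^'m" and t \<eta>
    assume x: "x \<in> SL" and g: "g \<in> SLpm"
    let ?q = "\<lambda>z. taylor_form k (chart f x) (map_matrix complex_of_real g *v z)"
    have "?D f (x ** P_elt g t \<eta>) = S (\<lambda>z. (sgn_char (sign_shift \<alpha> k) (det g) * exp (- \<nu> * of_real t)) * ?q z)"
      unfolding Df taylor_form_chart_P[OF f[unfolded I_def] x g k \<nu>] ..
    also have "\<dots> = (sgn_char (sign_shift \<alpha> k) (det g) * exp (- \<nu> * of_real t)) *s S ?q"
      by (rule linear_on_Pol_cmult[OF S Pol_substitute[OF taylor_form_in_Pol]])
    also have "\<dots> = exp (- \<nu> * of_real t) *s (sgn_char (sign_shift \<alpha> k) (det g) *s S ?q)"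
      by (simp add: mult.commute)
    also have "\<dots> = matrix_inv (ind_char \<beta> \<rho> \<nu> g t) *v ?D f x"
      unfolding eq[OF g taylor_form_in_Pol] matrix_inv_ind_char[where \<rho> = \<rho>, OF g \<rho>[OF g]] Df ..
    finally show "?D f (x ** (M_elt g ** A_elt t ** N_plus_elt \<eta>)) = matrix_inv (ind_char \<beta> \<rho> \<nu> g t) *v ?D f x"
      by (simp only: P_elt_def)
  qed
  have closed: "(\<lambda>x. f x + h x) \<in> I" "(\<lambda>x. c *s f x) \<in> I" if "f \<in> I" "h \<in> I" for f h c
    using that Ind_add Ind_scale unfolding I_def by blast+
  have "linear_op_on I ?D"
    unfolding linear_op_on_def
  proof (intro conjI ballI allI)
    fix f h c assume f: "f \<in> I" and h: "h \<in> I"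
    have zero: "taylor_form k (chart f x) = (\<lambda>z. 0)" if "x \<notin> SL" "f \<in> I" for f x
      using chart_outside[OF that(2)[unfolded I_def] that(1)]
      by (simp add: taylor_form_def[abs_def] partials_zero)
    have "taylor_form k (chart (\<lambda>x. f x + h x) x) = (\<lambda>z. taylor_form k (chart f x) z + taylor_form k (chart h x) z)" for x
    proof (cases "x \<in> SL")
      case True
      note [simp] = partials_add[OF smooth_chart_component[OF sm[OF f] True] smooth_chart_component[OF sm[OF h] True]]
      have "chart (\<lambda>x. f x + h x) x = (\<lambda>y. chart f x y + chart h x y)"
        by (simp add: chart_def[abs_def])
      then show ?thesis
        by (simp add: taylor_form_def[abs_def] distrib_right sum.distrib)
    qed (simp add: zero f h closed)
    then show "?D (\<lambda>x. f x + h x) = (\<lambda>x. ?D f x + ?D h x)"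
      using f h closed by (simp add: taylor_op_def linear_on_Pol_add[OF S] taylor_form_in_Pol)
    have "taylor_form k (chart (\<lambda>x. c *s f x) x) = (\<lambda>z. c * taylor_form k (chart f x) z)" for x
    proof (cases "x \<in> SL")
      case True
      have "chart (\<lambda>x. c *s f x) x = (\<lambda>y. c * chart f x y)"
        by (simp add: chart_def[abs_def])
      then show ?thesis
        by (simp add: taylor_form_def[abs_def] partials_cmult[OF smooth_chart_component[OF sm[OF f] True]]
            sum_distrib_left mult.assoc)
    qed (simp add: zero f closed(2)[OF f f])
    then show "?D (\<lambda>x. c *s f x) = (\<lambda>x. c *s ?D f x)"
      using f closed(2)[OF f f] by (simp add: taylor_op_def linear_on_Pol_cmult[OF S] taylor_form_in_Pol)
  qed
  moreover have "?D (left_trans g f) = left_trans g (?D f)" if "g \<in> SL" "f \<in> I" for g f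
  proof -
    have "left_trans g f \<in> I" using that Ind_left_trans unfolding I_def by blast
    moreover have "chart (left_trans g f) x = chart f (matrix_inv g ** x)" for x
      by (simp add: chart_def[abs_def] left_trans_def matrix_mul_assoc)
    ultimately show ?thesis
      using that by (simp add: taylor_op_def left_trans_def)
  qed
  moreover have "diff_op_on I ?D"
    by (rule taylor_op_diff_op[OF S sm])
  ultimately show ?thesis
    using target by (auto simp: Diff_G_def taylor_op_def)
qed

section \<open>Every intertwining operator is a Taylor operator\<close>

lemma taylor_form_scale:
  assumes F: "smooth_on F UNIV" and G: "smooth_on G UNIV" and eq: "\<And>s. G (s *\<^sub>R z) = C * F (s *\<^sub>R z')"
  shows "taylor_form n G (cvec z) = C * taylor_form n F (cvec z')"
proof -
  let ?l = "\<lambda>n s. \<Sum>js | length js = n. partials js F (s *\<^sub>R z') * monomial (count_list js) (cvec z')"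
  have "derivs UNIV (\<lambda>n s. C * ?l n s)"
    using derivs_line[OF F, of z'] unfolding derivs_def by (auto intro!: has_vector_derivative_mult_right)
  then have "taylor_form n G (cvec z) = C * ?l n 0"
    by (rule taylor_form_eq_derivs[OF G open_UNIV UNIV_I]) (simp add: eq monomial_def)
  then show ?thesis by (simp add: taylor_form_def)
qed

text \<open>Linear independence of distinct exponentials. Differentiating removes the constant and leaves, up to an exponential factor, a
  polynomial in \<open>u = exp (- c t)\<close> that vanishes for all \<open>u > 0\<close>.\<close>

lemma exponential_sum_constant:
  fixes v :: "nat \<Rightarrow> complex^'d" and c :: real
  assumes "0 < c" "\<And>t::real. (\<Sum>n\<le>N. exp ((\<mu> - of_nat n * of_real c) * of_real t) *s v n) = w" "n \<le> N"
  shows "(\<mu> - of_nat n * of_real c) *s v n = 0"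
proof -
  have "(\<mu> - of_nat n * of_real c) * v n $ i = 0" for i
  proof -
    let ?m = "\<lambda>n. \<mu> - of_nat n * complex_of_real c"
    let ?S = "\<lambda>z. \<Sum>n\<le>N. exp (?m n * z) * v n $ i"
    have zero: "(\<Sum>n\<le>N. (?m n * v n $ i) * u ^ n) = 0" if u: "u \<in> complex_of_real ` {0<..}" for u
    proof -
      obtain x where x: "0 < x" "u = of_real x" using u by auto
      define t where "t = - ln x / c"
      have u_eq: "exp (- (of_nat n * of_real c * of_real t)) = u ^ n" for n
      proof -
        have "- (of_nat n * of_real c * complex_of_real t) = of_nat n * of_real (ln x)"
          using assms(1) by (simp add: t_def)
        then show ?thesis using x by (simp only: exp_of_nat_mult exp_of_real exp_ln)
      qed
      have "(?S has_field_derivative (\<Sum>n\<le>N. ?m n * exp (?m n * of_real t) * v n $ i)) (at (of_real t))"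
        by (auto intro!: derivative_eq_intros sum.cong simp: mult_ac)
      then have "((\<lambda>t. ?S (of_real t)) has_vector_derivative (\<Sum>n\<le>N. ?m n * exp (?m n * of_real t) * v n $ i)) (at t)"
        by (rule has_vector_derivative_real_field)
      moreover have "(\<lambda>t. ?S (of_real t)) = (\<lambda>t. w $ i)"
        using arg_cong[OF assms(2), of "\<lambda>v. v $ i"] by (simp add: fun_eq_iff)
      ultimately have "(\<Sum>n\<le>N. ?m n * exp (?m n * of_real t) * v n $ i) = 0"
        using vector_derivative_unique_at[OF _ has_vector_derivative_const] by simp
      moreover have "exp (?m n * of_real t) = exp (\<mu> * of_real t) * u ^ n" for n
        unfolding u_eq[symmetric] exp_add[symmetric] by (rule arg_cong[of _ _ exp]) (simp add: algebra_simps)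
      ultimately have "exp (\<mu> * of_real t) * (\<Sum>n\<le>N. (?m n * v n $ i) * u ^ n) = 0"
        by (simp add: sum_distrib_left mult_ac)
      then show ?thesis by simp
    qed
    have "infinite (complex_of_real ` {0<..})"
      by (simp add: finite_image_iff infinite_Ioi inj_on_def)
    then have "infinite {u. (\<Sum>n\<le>N. (?m n * v n $ i) * u ^ n) = 0}"
      using zero by (metis (mono_tags, lifting) infinite_super mem_Collect_eq subsetI)
    then show ?thesis
      using polyfun_finite_roots[of "\<lambda>n. ?m n * v n $ i" N] assms(3) by blast
  qed
  then show ?thesis by (simp only: vec_eq_iff vector_smult_component zero_index simp_thms)
qed

definition test_ind :: "complex \<Rightarrow> nat \<Rightarrow> (complex^'m \<Rightarrow> complex) \<Rightarrow> nat \<Rightarrow>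
    real^('m::finite option)^('m option) \<Rightarrow> complex^1" where
  "test_ind lam j q D x = (if x \<in> SL then \<chi> i. test_fun lam j q D (col0 x) else 0)"

lemma test_ind_in_Ind:
  fixes q :: "complex^'m \<Rightarrow> complex"
  assumes "q \<in> Pol j" "j \<le> D" "even D \<longleftrightarrow> \<alpha> = Plus"
  shows "test_ind lam j q D \<in> Ind \<alpha> (triv_rep :: real^'m^'m \<Rightarrow> complex^1^1) lam"
  unfolding test_ind_def[abs_def]
  by (intro homogeneous_in_Ind smooth_test_fun[OF assms(1)] test_fun_homogeneous assms)

text \<open>The two lowest Taylor coefficients of a translated test function. Along the line through \<open>z\<close> it equals \<open>s\<^sup>j h(s)\<close>, and \<open>h(0)\<close> and
  \<open>h'(0)\<close> are elementary. The factor \<open>lam + j\<close> in the second coefficient is the obstruction to invariance under \<open>N\<^sub>+\<close>.\<close>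

lemma taylor_form_test:
  fixes q :: "complex^'m \<Rightarrow> complex" and g :: "real^'m^'m" and lam :: complex and \<eta> :: "real^'m"
  assumes q: "q \<in> Pol j" and D: "j \<le> D" "even D \<longleftrightarrow> \<alpha> = Plus" and g: "g \<in> SLpm"
  defines "F \<equiv> chart (test_ind lam j q D) (P_elt g 0 \<eta>)"
  shows "taylor_form j F (cvec z) = fact j * (sgn_char (sign_shift \<alpha> j) (det g) * q (cvec (g *v z)))"
    and "taylor_form (Suc j) F (cvec z) = fact (Suc j) * (sgn_char (sign_shift \<alpha> j) (det g) * q (cvec (g *v z))
      * (- (lam + of_nat j) * of_real (\<eta> \<bullet> z)))"
proof -
  have d: "det g = 1 \<or> det g = -1" using g by (auto simp: SLpm_def)
  define K where "K = sgn_char (sign_shift \<alpha> j) (det g) * q (cvec (g *v z))"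
  define c where "c = \<eta> \<bullet> z"
  define B where "B = (g *v z) \<bullet> (g *v z)"
  define \<mu> where "\<mu> = - ((lam + of_nat D) / 2)"
  define I where "I = {s. 0 < 1 + c * s}"
  have I: "open I" "0 \<in> I"
    unfolding I_def by (auto intro!: open_Collect_less continuous_intros)
  have SL: "P_elt g 0 \<eta> \<in> SL" by (rule P_elt_in_SL[OF g])
  have smF: "smooth_on F UNIV"
    unfolding F_def using test_ind_in_Ind[OF q D] SL by (intro smooth_chart_component) (auto intro: Ind_smooth)
  define W where "W s = (1 + c * s)\<^sup>2 + s\<^sup>2 * B" for s
  define h where "h s = K * of_real ((1 + c * s) ^ (D - j)) * exp (\<mu> * of_real (ln (W s)))" for s
  have W: "0 < W s" if "s \<in> I" for s
    using that unfolding W_def I_def B_def by (intro add_pos_nonneg) auto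
  \<comment> \<open>As \<open>det g = \<plusminus>1\<close>, its power depends only on the parity of \<open>D - j\<close>, which is that of \<open>\<alpha> + j\<close>.\<close>
  have dD: "complex_of_real (det g) ^ (D - j) = sgn_char (sign_shift \<alpha> j) (det g)"
  proof -
    have "even (D - j) \<longleftrightarrow> (even D \<longleftrightarrow> even j)" using D(1) by simp
    then show ?thesis
      unfolding sgn_char_shift[OF d]
      using d D(2) by (cases \<alpha>; cases "even j") (auto simp: sgn_char_def)
  qed
  have Fh: "F (s *\<^sub>R z) = of_real s ^ j * h s" if s: "s \<in> I" for s
  proof -
    have "P_elt g 0 \<eta> *v vcons 1 (s *\<^sub>R z) = vcons (det g * (1 + c * s)) (s *\<^sub>R (g *v z))"
      using d by (auto simp: P_elt_block block_mat_vcons c_def matrix_vector_mult_scaleR algebra_simps)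
    then have "F (s *\<^sub>R z) = test_fun lam j q D (vcons (det g * (1 + c * s)) (s *\<^sub>R (g *v z)))"
      by (simp add: F_def chart_def test_ind_def SL_mult SL N_minus_in_SL col0_N_minus)
    moreover have "vcons (det g * (1 + c * s)) (s *\<^sub>R (g *v z)) \<bullet> vcons (det g * (1 + c * s)) (s *\<^sub>R (g *v z)) = W s"
    proof -
      have "vcons a y \<bullet> vcons a y = a * a + y \<bullet> y" for a and y :: "real^'m"
        by (simp add: inner_vec_def sum_option)
      then show ?thesis using d by (auto simp: W_def B_def power2_eq_square)
    qed
    moreover have "(\<chi> i. vcons (det g * (1 + c * s)) (s *\<^sub>R (g *v z)) $ Some i) = s *\<^sub>R (g *v z)"
      by (simp add: vec_eq_iff)
    ultimately show ?thesis
      by (simp add: test_fun_def h_def K_def \<mu>_def cvec_scaleR Pol_homogeneous[OF q] power_mult_distrib dD mult_ac)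
  qed
  have "smooth_on h I"
  proof -
    have aff: "smooth_on (\<lambda>s. 1 + c * s) I"
      by (intro smooth_on_add smooth_on_const smooth_on_mult smooth_on_id I(1))
    have "smooth_on W I"
      unfolding W_def[abs_def] by (intro smooth_on_add smooth_on_mult smooth_on_power aff smooth_on_id smooth_on_const I(1))
    then have "smooth_on (\<lambda>s. ln (W s)) I"
      by (intro smooth_on_compose[OF I(1) open_greaterThan smooth_on_ln]) (auto dest: W)
    then have "smooth_on (\<lambda>s. exp (\<mu> * of_real (ln (W s)))) I"
      by (intro smooth_on_compose[OF I(1) open_UNIV smooth_on_exp] smooth_on_mult smooth_on_const
          smooth_on_compose_linear[OF _ bounded_linear_of_real] I(1)) auto
    then show ?thesis
      unfolding h_def[abs_def]
      by (intro smooth_on_mult smooth_on_const smooth_on_compose_linear[OF _ bounded_linear_of_real]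
          smooth_on_power aff I(1))
  qed
  then obtain H where H: "H 0 = h" "derivs I H"
    using smooth_on_derivs[OF I(1)] by metis
  obtain G where G: "derivs I G" "\<And>s. G 0 s = of_real s ^ j * H 0 s"
    "\<And>n. G n 0 = (if n < j then 0 else fact n / fact (n - j) * H (n - j) 0)"
    using derivs_power_times[OF H(2), where j = j] by blast
  have tf: "taylor_form n F (cvec z) = G n 0" for n
    by (rule taylor_form_eq_derivs[OF smF I G(1)]) (simp add: G(2) H(1) Fh)
  have h0: "h 0 = K" by (simp add: h_def W_def)
  have "(h has_vector_derivative K * (of_nat (D - j) * of_real c + \<mu> * (2 * of_real c))) (at 0)"
  proof -
    have "((\<lambda>s. (1 + c * s) ^ (D - j)) has_real_derivative of_nat (D - j) * c) (at 0)"
      by (auto intro!: derivative_eq_intros)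
    note d1 = has_vector_derivative_mult_right[OF has_vector_derivative_of_real[OF this], of K]
    have "((\<lambda>s. ln (W s)) has_real_derivative 2 * c) (at 0)"
      unfolding W_def by (auto intro!: derivative_eq_intros)
    note d2 = has_vector_derivative_mult_right[OF has_vector_derivative_of_real[OF this], of \<mu>]
    have "((exp \<circ> (\<lambda>s. \<mu> * of_real (ln (W s)))) has_vector_derivative (\<mu> * of_real (2 * c)) * exp (\<mu> * of_real (ln (W 0)))) (at 0)"
      by (rule field_vector_diff_chain_at[OF d2 DERIV_exp])
    from has_vector_derivative_mult[OF d1 this] show ?thesis
      by (simp add: h_def[abs_def] W_def o_def algebra_simps)
  qed
  moreover have "(h has_vector_derivative H 1 0) (at 0)"
    using H I(2) by (auto simp: derivs_def)
  ultimately have "H 1 0 = K * (of_nat (D - j) * of_real c + \<mu> * (2 * of_real c))"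
    by (rule vector_derivative_unique_at[symmetric])
  also have "\<dots> = K * (- (lam + of_nat j) * of_real c)"
    using D(1) by (simp add: \<mu>_def of_nat_diff algebra_simps)
  finally have H1: "H 1 0 = K * (- (lam + of_nat j) * of_real c)" .
  show "taylor_form j F (cvec z) = fact j * (sgn_char (sign_shift \<alpha> j) (det g) * q (cvec (g *v z)))"
    unfolding tf G(3) by (simp add: H(1) h0 K_def)
  show "taylor_form (Suc j) F (cvec z) = fact (Suc j) * (sgn_char (sign_shift \<alpha> j) (det g) * q (cvec (g *v z))
      * (- (lam + of_nat j) * of_real (\<eta> \<bullet> z)))"
    unfolding tf G(3) using H1 by (simp add: K_def c_def)
qed

lemma P_elt_one: "P_elt (mat 1) 0 0 = mat 1"
  using N_minus_0 by (simp add: P_elt_block N_minus_elt_def)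

text \<open>The element \<open>A_elt t\<close> acts in the chart by the dilation with factor \<open>exp (- t (1 + 1/m))\<close>.\<close>

lemma partials_chart_A_elt:
  fixes f :: "real^('m::finite option)^('m option) \<Rightarrow> complex^1"
  assumes f: "f \<in> Ind \<alpha> triv_rep lam" and js: "length js = n"
  shows "partials js (chart f (P_elt (mat 1) t 0)) 0
    = exp (- lam * of_real t) * exp (- of_nat n * of_real (1 + 1 / real CARD('m)) * of_real t) * partials js (chart f (mat 1)) 0"
proof (rule partials_eqI[OF _ _ js])
  let ?e = "mat 1 :: real^('m option)^('m option)" and ?p = "P_elt (mat 1) t 0 :: real^('m option)^('m option)"
  define c where "c = 1 + 1 / real CARD('m)"
  show sm: "smooth_on (chart f ?p) UNIV" "smooth_on (chart f ?e) UNIV"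
    by (intro smooth_chart_component Ind_smooth[OF f] P_elt_in_SL SLpm_one SL_one)+
  fix z
  have "taylor_form n (chart f ?p) (cvec z) = exp (- lam * of_real t) * taylor_form n (chart f ?e) (cvec (exp (- t * c) *\<^sub>R z))"
  proof (rule taylor_form_scale[OF sm(2,1)])
    fix s
    show "chart f ?p (s *\<^sub>R z) = exp (- lam * of_real t) * chart f ?e (s *\<^sub>R exp (- t * c) *\<^sub>R z)"
      using chart_P_elt[OF f SL_one SLpm_one, of s 0 z t] by (simp add: c_def chi_def sgn_char_pos)
  qed
  also have "\<dots> = exp (- lam * of_real t) * (of_real (exp (- t * c)) ^ n * taylor_form n (chart f ?e) (cvec z))"
    by (simp add: cvec_scaleR Pol_homogeneous[OF taylor_form_in_Pol])
  also have "complex_of_real (exp (- t * c)) ^ n = exp (- of_nat n * of_real c * of_real t)"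
    by (simp add: exp_of_nat_mult[symmetric] exp_of_real[symmetric] mult_ac)
  finally show "taylor_form n (chart f ?p) (cvec z) = exp (- lam * of_real t)
      * exp (- of_nat n * of_real (1 + 1 / real CARD('m)) * of_real t) * taylor_form n (chart f ?e) (cvec z)"
    by (simp only: c_def mult.assoc)
qed

text \<open>The operator is recovered from its value at the identity, a functional of the jets there. Equivariance under \<open>A\<close>, under
  \<open>M\<close> and under \<open>N\<^sub>+\<close> is used in this order: for the order of the operator, for the equivariance of \<open>S\<close>, and for the value of \<open>lam\<close>.\<close>

theorem Diff_imp_taylor_op:
  fixes \<rho> :: "real^'m^'m \<Rightarrow> complex^'d^'d" and \<alpha> :: sign and lam :: complex
  assumes \<rho>: "\<And>g. g \<in> SLpm \<Longrightarrow> \<rho> g ** matrix_inv (\<rho> g) = mat 1" and \<rho>1: "\<rho> (mat 1) = mat 1"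
  defines "I \<equiv> Ind \<alpha> (triv_rep :: real^'m^'m \<Rightarrow> complex^1^1) lam"
  assumes T: "T \<in> Diff_G I (Ind \<beta> \<rho> \<nu>)" and nz: "T \<noteq> 0"
  obtains k S where "linear_on_Pol k S" "T = taylor_op I k S" "\<exists>p\<in>Pol k. S p \<noteq> 0"
    and "k = 0 \<or> lam = 1 - of_nat k" "\<nu> = lam + of_nat k * (1 + 1 / of_nat CARD('m))"
    and "\<And>g p. g \<in> SLpm \<Longrightarrow> p \<in> Pol k \<Longrightarrow>
      sgn_char (sign_shift \<alpha> k) (det g) *s S (\<lambda>z. p (map_matrix complex_of_real g *v z)) =
      sgn_char \<beta> (det g) *s (matrix_inv (\<rho> g) *v S p)"
proof -
  let ?e = "mat 1 :: real^('m option)^('m option)"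
  define c where "c = 1 + 1 / real CARD('m)"
  have c: "0 < c" by (simp add: c_def add_pos_nonneg)
  have sm: "smooth_on (chart f x) UNIV" if "f \<in> I" "x \<in> SL" for f x
    using that by (intro smooth_chart_component) (auto simp: I_def intro: Ind_smooth)
  have TI: "T f \<in> Ind \<beta> \<rho> \<nu>" if "f \<in> I" for f
    using T that by (simp add: Diff_G_def)
  have mult_I: "(\<lambda>x. f (p ** x)) \<in> I" if "f \<in> I" "p \<in> SL" for f p
    using that Ind_left_mult unfolding I_def by blast
  have T_mult: "T (\<lambda>x. f (p ** x)) x = T f (p ** x)" if "f \<in> I" "p \<in> SL" for f p x
  proof -
    have "T (left_trans (matrix_inv p) f) = left_trans (matrix_inv p) (T f)"
      using T that(1) SL_inv[OF that(2)] by (auto simp: Diff_G_def)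
    then show ?thesis by (simp add: left_trans_matrix_inv[OF that(2)])
  qed
  obtain N b where b: "\<And>f. f \<in> I \<Longrightarrow> T f ?e = (\<Sum>js | length js \<le> N. partials js (chart f ?e) 0 *s b js)"
  proof -
    obtain N and a :: "'m list \<Rightarrow> real^'m \<Rightarrow> complex^1^'d" where a: "\<And>f x. f \<in> I \<Longrightarrow>
        T f (?e ** N_minus_elt x) = (\<Sum>js | length js \<le> N. a js x *v partials js (\<lambda>y. f (?e ** N_minus_elt y)) x)"
      using T SL_one unfolding Diff_G_def diff_op_on_def by blast
    have "T f ?e = (\<Sum>js | length js \<le> N. partials js (chart f ?e) 0 *s column 1 (a js 0))" if f: "f \<in> I" for f
    proof -
      have "A *v v = v $ 1 *s column 1 A" for A :: "complex^1^'d" and v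
        by (simp add: matrix_vector_mult_def column_def vec_eq_iff mult.commute sum_1)
      moreover have "smooth_on_SL f" using f unfolding I_def by (rule Ind_smooth)
      ultimately show ?thesis
        using a[OF f, of 0] by (simp add: N_minus_0 partials_chart[OF _ SL_one])
    qed
    then show thesis by (rule that)
  qed
  define L where "L n F = (\<Sum>js | length js = n. partials js F 0 *s b js)" for n and F :: "real^'m \<Rightarrow> complex"
  have sum_L: "T f ?e = (\<Sum>n\<le>N. L n (chart f ?e))" if "f \<in> I" for f
  proof -
    have "{js :: 'm list. length js \<le> N} = (\<Union>n\<le>N. {js. length js = n})" by auto
    then show ?thesis
      unfolding b[OF that] L_def
      by (simp only:) (rule sum.UNION_disjoint, auto simp: finite_lists_length)
  qed
  \<comment> \<open>\<open>A\<close> acts by different characters on the parts \<open>L n\<close> of different order, so at most one of them survives.\<close>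
  have graded: "(\<nu> - lam - of_nat n * of_real c) *s L n (chart f ?e) = 0" if f: "f \<in> I" and n: "n \<le> N" for f n
  proof (rule exponential_sum_constant[OF c _ n])
    fix t :: real
    let ?p = "P_elt (mat 1) t 0 :: real^('m option)^('m option)"
    have p: "?p \<in> SL" by (intro P_elt_in_SL SLpm_one)
    have ch: "chart (\<lambda>x. f (?p ** x)) ?e = chart f ?p"
      by (simp add: chart_def[abs_def])
    let ?E = "\<lambda>n. exp (- lam * of_real t) * exp (- of_nat n * of_real c * of_real t)"
    have "L n (chart f ?p) = ?E n *s L n (chart f ?e)" for n
      by (simp add: L_def c_def vec.scale_sum_right partials_chart_A_elt[OF f[unfolded I_def]])
    moreover have "T (\<lambda>x. f (?p ** x)) ?e = exp (- \<nu> * of_real t) *s T f ?e"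
    proof -
      have "T (\<lambda>x. f (?p ** x)) ?e = T f (?e ** ?p)"
        by (simp add: T_mult[OF f p])
      also have "\<dots> = matrix_inv (ind_char \<beta> \<rho> \<nu> (mat 1) t) *v T f ?e"
        by (rule Ind_P[OF TI[OF f] SL_one SLpm_one])
      also have "\<dots> = exp (- \<nu> * of_real t) *s T f ?e"
        using matrix_inv_unique[of "mat 1 :: complex^'d^'d" "mat 1"]
        by (simp add: matrix_inv_ind_char[where \<rho> = \<rho>, OF SLpm_one \<rho>[OF SLpm_one]] \<rho>1)
      finally show ?thesis .
    qed
    ultimately have eq: "(\<Sum>n\<le>N. ?E n *s L n (chart f ?e)) = exp (- \<nu> * of_real t) *s T f ?e"
      using sum_L[OF mult_I[OF f p]] by (simp add: ch)
    have "(\<Sum>n\<le>N. exp ((\<nu> - lam - of_nat n * of_real c) * of_real t) *s L n (chart f ?e))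
      = exp (\<nu> * of_real t) *s (\<Sum>n\<le>N. ?E n *s L n (chart f ?e))"
      unfolding vec.scale_sum_right vec.scale_scale exp_add[symmetric]
      by (intro sum.cong refl arg_cong2[where f = "(*s)"] arg_cong[of _ _ exp]) (simp add: algebra_simps)
    then show "(\<Sum>n\<le>N. exp ((\<nu> - lam - of_nat n * of_real c) * of_real t) *s L n (chart f ?e)) = T f ?e"
      unfolding eq by (simp add: exp_minus_inverse mult_exp_exp)
  qed
  obtain f0 x0 where f0: "f0 \<in> I" "T f0 x0 \<noteq> 0"
  proof -
    obtain f0 where "T f0 \<noteq> 0" using nz by (auto simp: fun_eq_iff)
    moreover then have "f0 \<in> I" using T by (auto simp: Diff_G_def)
    ultimately show thesis using that by (auto simp: fun_eq_iff)
  qed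
  have x0: "x0 \<in> SL" using f0 Ind_outside[OF TI] by blast
  have "T (\<lambda>x. f0 (x0 ** x)) ?e \<noteq> 0"
    using f0 x0 by (simp add: T_mult)
  then obtain k where k: "k \<le> N" "L k (chart (\<lambda>x. f0 (x0 ** x)) ?e) \<noteq> 0"
    unfolding sum_L[OF mult_I[OF f0(1) x0]] using sum.neutral by (metis (no_types, lifting) atMost_iff)
  have \<nu>: "\<nu> = lam + of_nat k * (1 + 1 / of_nat CARD('m))"
  proof -
    have "\<nu> - lam - of_nat k * of_real c = 0"
      using graded[OF mult_I[OF f0(1) x0] k(1)] k(2) unfolding vec.scale_eq_0_iff by blast
    then show ?thesis by (simp add: c_def algebra_simps)
  qed
  have L0: "L n (chart f ?e) = 0" if "f \<in> I" "n \<le> N" "n \<noteq> k" for f n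
  proof -
    have "\<nu> - lam - of_nat n * of_real c = (of_nat k - of_nat n) * of_real c"
      by (simp add: \<nu> c_def algebra_simps diff_divide_distrib)
    moreover have "of_real c \<noteq> (0::complex)" using c by simp
    ultimately show ?thesis
      using graded[OF that(1,2)] that(3) by auto
  qed
  \<comment> \<open>The factor compensates for the \<open>k!\<close> in \<open>partials_taylor_form\<close>.\<close>
  define S where "S p = (1 / fact k) *s L k (\<lambda>y. p (cvec y))" for p :: "complex^'m \<Rightarrow> complex"
  have S: "linear_on_Pol k S"
    unfolding linear_on_Pol_def S_def L_def
    by (auto simp: partials_add smooth_Pol partials_cmult vec.scale_left_distrib sum.distrib vec.scale_right_distrib
        vec.scale_sum_right mult.left_commute)
  have S_taylor: "S (taylor_form k F) = L k F" if "smooth_on F UNIV" for F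
    unfolding S_def L_def by (simp add: partials_taylor_form[OF that] vec.scale_sum_right)
  have T1: "T f ?e = S (taylor_form k (chart f ?e))" if f: "f \<in> I" for f
  proof -
    have "T f ?e = (\<Sum>n\<le>N. if n = k then L k (chart f ?e) else 0)"
      unfolding sum_L[OF f] by (intro sum.cong refl) (auto simp: L0[OF f])
    then show ?thesis
      using k(1) by (simp add: S_taylor[OF sm[OF f SL_one]])
  qed
  have Tx: "T f x = S (taylor_form k (chart f x))" if f: "f \<in> I" and x: "x \<in> SL" for f x
  proof -
    have "T f x = T (\<lambda>y. f (x ** y)) ?e"
      by (simp add: T_mult[OF f x])
    also have "\<dots> = S (taylor_form k (chart (\<lambda>y. f (x ** y)) ?e))"
      by (rule T1[OF mult_I[OF f x]])
    also have "chart (\<lambda>y. f (x ** y)) ?e = chart f x"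
      by (simp add: chart_def[abs_def])
    finally show ?thesis .
  qed
  have T_eq: "T = taylor_op I k S"
  proof (intro ext)
    fix f and x :: "real^('m option)^('m option)"
    consider "f \<notin> I" | "f \<in> I" "x \<in> SL" | "f \<in> I" "x \<notin> SL" by blast
    then show "T f x = taylor_op I k S f x"
    proof cases
      case 1
      then show ?thesis using T by (simp add: taylor_op_def Diff_G_def)
    next
      case 2
      then show ?thesis by (simp add: taylor_op_def Tx)
    next
      case 3
      then show ?thesis
        using Ind_outside[OF TI] chart_outside[of f \<alpha> triv_rep lam x]
        by (simp add: taylor_op_def I_def linear_on_Pol_taylor_form[OF S] partials_zero)
    qed
  qed
  have S_nz: "\<exists>p\<in>Pol k. S p \<noteq> 0"
    using k(2) S_taylor[OF sm[OF mult_I[OF f0(1) x0] SL_one]] taylor_form_in_Pol by metis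
  have test: "T (test_ind lam j q D) (P_elt g 0 \<eta>) = sgn_char \<beta> (det g) *s (matrix_inv (\<rho> g) *v T (test_ind lam j q D) ?e)"
    if "test_ind lam j q D \<in> I" "g \<in> SLpm" for j q D g \<eta>
    using Ind_P[OF TI[OF that(1)] SL_one that(2), of 0 \<eta>]
    by (simp add: matrix_inv_ind_char[where \<rho> = \<rho>, OF that(2) \<rho>[OF that(2)]])
  have ex_D: "\<exists>D\<ge>j. even D \<longleftrightarrow> \<alpha> = Plus" for j :: nat
  proof (cases "even j \<longleftrightarrow> \<alpha> = Plus")
    case False
    then show ?thesis by (intro exI[of _ "Suc j"]) auto
  qed auto
  have equiv: "sgn_char (sign_shift \<alpha> k) (det g) *s S (\<lambda>z. p (map_matrix complex_of_real g *v z)) =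
      sgn_char \<beta> (det g) *s (matrix_inv (\<rho> g) *v S p)" if g: "g \<in> SLpm" and p: "p \<in> Pol k" for g p
  proof -
    obtain D where D: "k \<le> D" "even D \<longleftrightarrow> \<alpha> = Plus" using ex_D by blast
    let ?f = "test_ind lam k p D"
    have f: "?f \<in> I" unfolding I_def by (rule test_ind_in_Ind[OF p D])
    have tf: "taylor_form k (chart ?f (P_elt g 0 0)) = (\<lambda>z. (fact k * sgn_char (sign_shift \<alpha> k) (det g)) * p (map_matrix complex_of_real g *v z))"
      if g: "g \<in> SLpm" for g
      by (rule Pol_eqI[OF taylor_form_in_Pol Pol_cmult[OF Pol_substitute[OF p]]])
        (simp only: taylor_form_test(1)[OF p D g] map_matrix_cvec mult.assoc)
    have Tg: "T ?f (P_elt g 0 0) = fact k *s (sgn_char (sign_shift \<alpha> k) (det g) *s S (\<lambda>z. p (map_matrix complex_of_real g *v z)))"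
      if g: "g \<in> SLpm" for g
      unfolding Tx[OF f P_elt_in_SL[OF g]] tf[OF g]
      by (subst linear_on_Pol_cmult[OF S Pol_substitute[OF p]]) simp
    have "map_matrix complex_of_real (mat 1 :: real^'m^'m) = mat 1"
      by (simp add: map_matrix_def mat_def vec_eq_iff)
    then have "T ?f ?e = fact k *s S p"
      using Tg[OF SLpm_one] by (simp add: P_elt_one)
    then have "fact k *s (sgn_char (sign_shift \<alpha> k) (det g) *s S (\<lambda>z. p (map_matrix complex_of_real g *v z)))
        = fact k *s (sgn_char \<beta> (det g) *s (matrix_inv (\<rho> g) *v S p))"
      using test[OF f g, of 0] Tg[OF g] by (simp add: vector_scalar_commute mult.left_commute)
    then show ?thesis by (simp only: vec.scale_cancel_left) simp
  qed
  have "k = 0 \<or> lam = 1 - of_nat k"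
  proof (cases k)
    case (Suc j)
    have "lam = - of_nat j"
    proof (rule ccontr)
      assume lam: "lam \<noteq> - of_nat j"
      \<comment> \<open>A test function with leading term \<open>q\<close> of degree \<open>k - 1\<close>, moved by the elements of \<open>N\<^sub>+\<close> in the direction \<open>i\<close>: the
        target value does not change, but the Taylor form of order \<open>k\<close> is proportional to the parameter \<open>u\<close>.\<close>
      have van: "S (\<lambda>z. z $ i * q z) = 0" if q: "q \<in> Pol j" for q i
      proof -
        obtain D where D: "j \<le> D" "even D \<longleftrightarrow> \<alpha> = Plus" using ex_D by blast
        let ?f = "test_ind lam j q D"
        have f: "?f \<in> I" unfolding I_def by (rule test_ind_in_Ind[OF q D])
        have iq: "(\<lambda>z. z $ i * q z) \<in> Pol k"
          using Pol_mult[OF Pol_coordinate q] by (simp add: Suc)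
        have "taylor_form k (chart ?f (P_elt (mat 1) 0 (u *\<^sub>R axis i 1))) = (\<lambda>z. (fact k * - (lam + of_nat j) * of_real u) * (z $ i * q z))" for u
          by (rule Pol_eqI[OF taylor_form_in_Pol Pol_cmult[OF iq]])
            (simp add: Suc taylor_form_test(2)[OF q D SLpm_one] inner_axis' del: fact_Suc)
        then have Tu: "T ?f (P_elt (mat 1) 0 (u *\<^sub>R axis i 1)) = (fact k * - (lam + of_nat j) * of_real u) *s S (\<lambda>z. z $ i * q z)" for u
          unfolding Tx[OF f P_elt_in_SL[OF SLpm_one]] by (simp only: linear_on_Pol_cmult[OF S iq])
        have "T ?f (P_elt (mat 1) 0 \<eta>) = T ?f ?e" for \<eta>
          using test[OF f SLpm_one, of \<eta>] matrix_inv_unique[of "mat 1 :: complex^'d^'d" "mat 1"] by (simp add: \<rho>1)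
        then have "(fact k * - (lam + of_nat j) * of_real 1) *s S (\<lambda>z. z $ i * q z) = (fact k * - (lam + of_nat j) * of_real 0) *s S (\<lambda>z. z $ i * q z)"
          using Tu[of 0] Tu[of 1] by metis
        moreover have "fact k * - (lam + of_nat j) \<noteq> (0::complex)"
          using lam unfolding eq_neg_iff_add_eq_0 mult_eq_0_iff neg_equal_0_iff_equal by simp
        ultimately show ?thesis
          by (simp only: of_real_0 of_real_1 mult_1_right mult_zero_right vec.scale_zero_left vec.scale_eq_0_iff) simp
      qed
      have "S p = 0" if p: "p \<in> Pol k" for p
      proof -
        have mon: "S (monomial e) = 0" if e: "sum e UNIV = k" for e
        proof -
          obtain js where js: "count_list js = e" using ex_count_list by blast
          then have "length js = Suc j" using e Suc sum_count_list[of js] by simp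
          then obtain i js' where js': "js = i # js'" "length js' = j" by (auto simp: length_Suc_conv)
          have "monomial e = (\<lambda>z. z $ i * monomial (count_list js') z)"
            unfolding js[symmetric] js'(1) by (rule ext) (rule monomial_count_Cons)
          then show ?thesis using van[OF monomial_count_in_Pol[OF js'(2)]] by simp
        qed
        obtain c where p: "p = (\<lambda>z. \<Sum>e | sum e UNIV = k. c e * monomial e z)"
          using p by (rule PolE)
        have "S p = (\<Sum>e | sum e UNIV = k. c e *s S (monomial e))"
          unfolding p by (rule linear_on_Pol_sum[OF S]) (auto intro: monomial_in_Pol)
        then show ?thesis by (simp add: mon)
      qed
      with S_nz show False by blast
    qed
    then show ?thesis by (simp add: Suc)
  qed simp
  then show thesis
    using that[OF S T_eq S_nz _ \<nu> equiv] by blast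
qed

section \<open>Equivariant maps out of the space of homogeneous polynomials\<close>

abbreviation pol_comp :: "(complex^'m \<Rightarrow> complex) \<Rightarrow> real^'m^'m \<Rightarrow> complex^'m \<Rightarrow> complex" where
  "pol_comp p g \<equiv> \<lambda>z. p (map_matrix complex_of_real g *v z)"

lemma coordinate_power_eq_monomial: "(\<lambda>z. z $ i ^ k) = monomial (\<lambda>j. if j = i then k else 0)"
  by (simp add: monomial_def fun_eq_iff if_distrib prod.delta cong: if_cong)

lemma coordinate_power_in_Pol: "(\<lambda>z. z $ i ^ k) \<in> Pol k"
  using Pol_power[OF Pol_coordinate, of i k] by simp

text \<open>Rotations act transitively on the unit sphere if \<open>m \<ge> 2\<close>. For \<open>m = 1\<close> there is only one line, and the group is trivial.\<close>

lemma SL_transitive_on_lines: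
  fixes y :: "real^'m"
  obtains A c where "A \<in> SL" "y = c *\<^sub>R (A *v axis i 1)"
proof (cases "y = 0")
  case True
  then show ?thesis using that[OF SL_one, of 0] by simp
next
  case y: False
  show ?thesis
  proof (cases "2 \<le> CARD('m)")
    case True
    have "norm (y /\<^sub>R norm y) = 1" using y by simp
    then obtain A where A: "rotation_matrix A" "A *v axis i 1 = y /\<^sub>R norm y"
      using rotation_matrix_exists_basis[OF True] by metis
    then show ?thesis
      using that[of A "norm y"] y by (simp add: rotation_matrix_def SL_def)
  next
    case False
    then have "card (UNIV :: 'm set) = 1"
      using zero_less_card_finite[where 'a = 'm] by linarith
    then have "j = i" for j
      by (metis UNIV_I card_1_singletonE singletonD)
    then have "y $ j = ((y $ i) *\<^sub>R (mat 1 *v axis i 1)) $ j" for j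
      by (metis axis_nth matrix_vector_mul_lid mult.right_neutral vector_scaleR_component real_scaleR_def)
    then have "y = (y $ i) *\<^sub>R (mat 1 *v axis i 1)"
      unfolding vec_eq_iff by blast
    then show ?thesis by (rule that[OF SL_one])
  qed
qed

lemma power_sum_lists:
  fixes x z :: "complex^'m"
  shows "(\<Sum>j\<in>UNIV. x $ j * z $ j) ^ k = (\<Sum>js | length js = k. monomial (count_list js) x * monomial (count_list js) z)"
proof (induction k)
  case 0
  show ?case by (simp add: monomial_def)
next
  case (Suc k)
  then show ?case
    by (simp add: sum_lists_Suc monomial_count_Cons sum_product mult_ac) (subst sum.swap, simp add: mult_ac)
qed

text \<open>The determinant of \<open>diag(1, u, \<dots>, u)\<close> is normalized by a scalar, and scalars act on \<open>Pol k\<close> by a power. For small \<open>u\<close> these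
  matrices contract every polynomial to a multiple of \<open>z\<^sub>i\<^sup>k\<close>.\<close>

lemma contraction_in_SL:
  fixes i :: "'m::finite"
  assumes "0 < u"
  obtains s where "0 < s" "(\<chi> j l. if j = l then s * (if j = i then 1 else u) else 0 :: real^'m^'m) \<in> SL"
proof -
  define s where "s = (inverse u) powr (real (CARD('m) - 1) / real CARD('m))"
  have s: "0 < s" using assms by (simp add: s_def)
  have "s ^ CARD('m) = (inverse u) ^ (CARD('m) - 1)"
    using assms by (simp add: s_def powr_realpow[symmetric] powr_powr)
  moreover have "det (\<chi> j l. if j = l then s * (if j = i then 1 else u) else 0 :: real^'m^'m) = s ^ CARD('m) * u ^ (CARD('m) - 1)"
  proof -
    have "(\<Prod>j\<in>UNIV. if j = i then 1 else u) = (\<Prod>j\<in>UNIV - {i}. u)"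
      by (subst prod.remove[of _ i]) (auto intro: prod.cong)
    then show ?thesis
      by (subst det_diagonal) (simp_all add: prod.distrib card_Diff_singleton)
  qed
  ultimately have "(\<chi> j l. if j = l then s * (if j = i then 1 else u) else 0 :: real^'m^'m) \<in> SL"
    using assms by (simp add: SL_def power_inverse)
  with s show thesis by (rule that)
qed

text \<open>Both \<open>z\<^sub>i\<^sup>k\<close> and, by equivariance, any \<open>p\<close> with the same image behave in the same way under the contracting matrices. Hence
  \<open>S2 p\<close> equals the image of the contracted \<open>p\<close> for every \<open>u > 0\<close>; let \<open>u\<close> tend to \<open>0\<close>. Two maps \<open>S1\<close> and \<open>S2\<close> are needed because the lemma
  serves both for injectivity (\<open>S1 = 0\<close>) and for uniqueness.\<close>

lemma highest_weight_vector:
  assumes S1: "linear_on_Pol k S1" and S2: "linear_on_Pol k S2"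
    and R1: "\<And>g p. g \<in> SL \<Longrightarrow> p \<in> Pol k \<Longrightarrow> S1 (pol_comp p g) = R g *v S1 p"
    and R2: "\<And>g p. g \<in> SL \<Longrightarrow> p \<in> Pol k \<Longrightarrow> S2 (pol_comp p g) = R g *v S2 p"
    and p: "p \<in> Pol k" and eq: "S1 (\<lambda>z. z $ i ^ k) = S2 p"
  shows "S2 p = p (cvec (axis i 1)) *s S2 (\<lambda>z. z $ i ^ k)"
proof -
  obtain c where pc: "p = (\<lambda>z. \<Sum>e | sum e UNIV = k. c e * monomial e z)"
    using p by (rule PolE)
  let ?e0 = "\<lambda>j. if j = i then k else 0"
  have const: "S2 p = (\<Sum>e | sum e UNIV = k. (c e * of_real u ^ (k - e i)) *s S2 (monomial e))" if u: "0 < u" for u :: real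
  proof -
    obtain s where s: "0 < s" and SL: "(\<chi> j l. if j = l then s * (if j = i then 1 else u) else 0) \<in> SL" (is "?g \<in> SL")
      using contraction_in_SL[OF u, of i] by blast
    have gz: "(map_matrix complex_of_real ?g *v z) $ j = of_real (s * (if j = i then 1 else u)) * z $ j" for z j
      by (simp add: matrix_vector_mult_def map_matrix_def if_distrib[of complex_of_real] if_distrib[of "\<lambda>x. x * _"] sum.delta cong: if_cong)
    have mon: "monomial e (map_matrix complex_of_real ?g *v z) = (of_real s ^ k * of_real u ^ (k - e i)) * monomial e z"
      if e: "sum e UNIV = k" for e z
    proof -
      have "(\<Prod>j\<in>UNIV. complex_of_real (if j = i then 1 else u) ^ e j) = of_real u ^ (k - e i)"
      proof -
        have "(\<Prod>j\<in>UNIV. complex_of_real (if j = i then 1 else u) ^ e j) = (\<Prod>j\<in>UNIV - {i}. of_real u ^ e j)"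
          by (subst prod.remove[of _ i]) (auto intro: prod.cong)
        also have "\<dots> = of_real u ^ (sum e (UNIV - {i}))"
          by (simp add: power_sum)
        also have "sum e (UNIV - {i}) = k - e i"
          using e by (simp add: sum_diff1_nat)
        finally show ?thesis .
      qed
      moreover have "(\<Prod>j\<in>UNIV. complex_of_real s ^ e j) = of_real s ^ k"
        using e by (simp add: power_sum[symmetric])
      ultimately show ?thesis
        unfolding monomial_def gz of_real_mult power_mult_distrib prod.distrib by simp
    qed
    have "S1 (pol_comp (\<lambda>z. z $ i ^ k) ?g) = of_real s ^ k *s S1 (\<lambda>z. z $ i ^ k)"
      unfolding gz by (simp add: power_mult_distrib linear_on_Pol_cmult[OF S1 coordinate_power_in_Pol])
    then have "of_real s ^ k *s S2 p = R ?g *v S2 p"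
      using R1[OF SL coordinate_power_in_Pol] eq by simp
    also have "\<dots> = S2 (pol_comp p ?g)"
      using R2[OF SL p] by simp
    also have "pol_comp p ?g = (\<lambda>z. \<Sum>e | sum e UNIV = k. (of_real s ^ k * (c e * of_real u ^ (k - e i))) * monomial e z)"
      unfolding pc by (intro ext sum.cong refl) (simp add: mon mult_ac)
    also have "S2 \<dots> = (\<Sum>e | sum e UNIV = k. (of_real s ^ k * (c e * of_real u ^ (k - e i))) *s S2 (monomial e))"
      by (rule linear_on_Pol_sum[OF S2]) (simp add: monomial_in_Pol)
    also have "\<dots> = of_real s ^ k *s (\<Sum>e | sum e UNIV = k. (c e * of_real u ^ (k - e i)) *s S2 (monomial e))"
      by (simp add: vec.scale_sum_right)
    finally show ?thesis
      using s by (simp only: vec.scale_cancel_left) simp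
  qed
  have comp: "S2 p $ l = c ?e0 * S2 (monomial ?e0) $ l" for l
  proof -
    let ?h = "\<lambda>u. \<Sum>e | sum e UNIV = k. (c e * complex_of_real u ^ (k - e i)) * S2 (monomial e) $ l"
    have "isCont ?h 0" by (intro continuous_intros)
    then have "(?h \<longlongrightarrow> ?h 0) (at_right 0)"
      by (simp add: isCont_def filterlim_at_split)
    moreover have "(?h \<longlongrightarrow> S2 p $ l) (at_right 0)"
    proof (rule tendsto_eventually)
      have "?h u = S2 p $ l" if "0 < u" for u
        using arg_cong[OF const[OF that], of "\<lambda>v. v $ l"] by simp
      then show "eventually (\<lambda>u. ?h u = S2 p $ l) (at_right 0)"
        by (rule eventually_mono[OF eventually_at_right_less])
    qed
    ultimately have "S2 p $ l = ?h 0"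
      using tendsto_unique[OF trivial_limit_at_right_real] by blast
    also have "?h 0 = (\<Sum>e | sum e UNIV = k. if e = ?e0 then c e * S2 (monomial e) $ l else 0)"
    proof (intro sum.cong refl)
      fix e :: "'a \<Rightarrow> nat" assume "e \<in> {e. sum e UNIV = k}"
      then have k: "sum e UNIV = k" by simp
      have "k = e i + sum e (UNIV - {i})" using k by (simp add: sum.remove[of _ i])
      then have "k - e i = 0 \<longleftrightarrow> k = e i \<and> (\<forall>j. j \<noteq> i \<longrightarrow> e j = 0)"
        by auto
      also have "\<dots> \<longleftrightarrow> e = ?e0"
        by (auto simp: fun_eq_iff)
      finally have "k - e i = 0 \<longleftrightarrow> e = ?e0" .
      then show "(c e * complex_of_real 0 ^ (k - e i)) * S2 (monomial e) $ l = (if e = ?e0 then c e * S2 (monomial e) $ l else 0)"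
        by (auto simp: power_0_left)
    qed
    also have "\<dots> = c ?e0 * S2 (monomial ?e0) $ l"
      by (simp add: finite_degree sum.delta)
    finally show ?thesis .
  qed
  have "p (cvec (axis i 1)) = (\<Sum>e | sum e UNIV = k. if e = ?e0 then c e else 0)"
    unfolding pc
  proof (intro sum.cong refl)
    fix e :: "'a \<Rightarrow> nat" assume "e \<in> {e. sum e UNIV = k}"
    then have k: "sum e UNIV = k" by simp
    show "c e * monomial e (cvec (axis i 1)) = (if e = ?e0 then c e else 0)"
    proof (cases "\<forall>j. j \<noteq> i \<longrightarrow> e j = 0")
      case True
      then have "sum e UNIV = e i" by (simp add: sum.remove[of _ i])
      with True k have e0: "e = ?e0" by auto
      moreover have "monomial e (cvec (axis i 1)) = 1"
        unfolding monomial_def by (rule prod.neutral) (simp add: axis_def e0)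
      ultimately show ?thesis by simp
    next
      case False
      then obtain j where j: "j \<noteq> i" "e j \<noteq> 0" by blast
      then have "monomial e (cvec (axis i 1)) = 0"
        unfolding monomial_def by (intro prod_zero) (auto simp: axis_def power_0_left intro!: bexI[of _ j])
      with j show ?thesis by auto
    qed
  qed
  also have "\<dots> = c ?e0" by (simp add: finite_degree sum.delta)
  finally show ?thesis
    using comp unfolding coordinate_power_eq_monomial by (simp add: vec_eq_iff)
qed

text \<open>The orbit of \<open>z\<^sub>i\<^sup>k\<close> contains, up to scalars, the \<open>k\<close>-th powers of all real linear forms \<open>y\<close>. Their images are polynomials in
  \<open>y\<close> whose coefficients are the images of the monomials; if the polynomials vanish, so do the coefficients.\<close>

lemma highest_weight_vector_zero:
  assumes S: "linear_on_Pol k S"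
    and R: "\<And>g p. g \<in> SL \<Longrightarrow> p \<in> Pol k \<Longrightarrow> S (pol_comp p g) = R g *v S p"
    and zero: "S (\<lambda>z. z $ i ^ k) = 0" and p: "p \<in> Pol k"
  shows "S p = 0"
proof -
  have mon: "S (monomial (count_list ks)) = 0" if ks: "length ks = k" for ks
  proof -
    have "S (monomial (count_list ks)) $ l = 0" for l
    proof (rule symmetric_form_eq_0D[where b = "\<lambda>js. S (monomial (count_list js)) $ l", OF _ ks])
      show "S (monomial (count_list js)) $ l = S (monomial (count_list ks)) $ l" if "mset js = mset ks" for js ks
      proof -
        have "count_list js = count_list ks"
          using that by (simp add: fun_eq_iff flip: count_mset)
        then show ?thesis by simp
      qed
      fix y :: "real^'a"
      obtain A c where A: "A \<in> SL" and y: "y = c *\<^sub>R (A *v axis i 1)"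
        using SL_transitive_on_lines by metis
      let ?g = "transpose A"
      have g: "?g \<in> SL" using A by (simp add: SL_def)
      have lin: "(\<Sum>j\<in>UNIV. cvec y $ j * z $ j) = of_real c * (map_matrix complex_of_real ?g *v z) $ i" for z
        by (simp add: y matrix_vector_mult_def map_matrix_def transpose_def axis_def sum_distrib_left mult.assoc
            if_distrib[of "\<lambda>x. _ * x"] sum.delta cong: if_cong)
      have "(\<lambda>z. \<Sum>js | length js = k. monomial (count_list js) (cvec y) * monomial (count_list js) z)
          = (\<lambda>z. of_real c ^ k * pol_comp (\<lambda>z. z $ i ^ k) ?g z)"
        unfolding power_sum_lists[symmetric] lin by (simp add: power_mult_distrib)
      moreover have "S (\<lambda>z. of_real c ^ k * pol_comp (\<lambda>z. z $ i ^ k) ?g z) = 0"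
        unfolding linear_on_Pol_cmult[OF S Pol_substitute[OF coordinate_power_in_Pol]] R[OF g coordinate_power_in_Pol] zero
        by simp
      moreover have "S (\<lambda>z. \<Sum>js | length js = k. monomial (count_list js) (cvec y) * monomial (count_list js) z)
          = (\<Sum>js | length js = k. monomial (count_list js) (cvec y) *s S (monomial (count_list js)))"
        by (rule linear_on_Pol_sum[OF S]) (simp add: monomial_count_in_Pol)
      ultimately have "(\<Sum>js | length js = k. monomial (count_list js) (cvec y) *s S (monomial (count_list js))) $ l = 0"
        by simp
      then show "(\<Sum>js | length js = k. S (monomial (count_list js)) $ l * monomial (count_list js) (cvec y)) = 0"
        by (simp add: mult.commute)
    qed
    then show ?thesis by (simp add: vec_eq_iff)
  qed
  obtain c where pc: "p = (\<lambda>z. \<Sum>e | sum e UNIV = k. c e * monomial e z)"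
    using p by (rule PolE)
  have "S p = (\<Sum>e | sum e UNIV = k. c e *s S (monomial e))"
    unfolding pc by (rule linear_on_Pol_sum[OF S]) (simp add: monomial_in_Pol)
  also have "\<dots> = 0"
  proof (rule sum.neutral, intro ballI)
    fix e :: "'a \<Rightarrow> nat" assume e: "e \<in> {e. sum e UNIV = k}"
    obtain js where js: "count_list js = e" using ex_count_list by blast
    then have "length js = k" using e sum_count_list[of js] by simp
    from mon[OF this] show "c e *s S (monomial e) = 0" by (simp add: js)
  qed
  finally show ?thesis .
qed

text \<open>This is the irreducibility of \<open>Pol k\<close>. A nonzero \<open>p\<close> in the kernel can be moved so that its coefficient of \<open>z\<^sub>i\<^sup>k\<close> does not vanish;
  then contraction puts \<open>z\<^sub>i\<^sup>k\<close> into the kernel as well.\<close>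

lemma equivariant_injective:
  assumes S: "linear_on_Pol k S"
    and R: "\<And>g p. g \<in> SL \<Longrightarrow> p \<in> Pol k \<Longrightarrow> S (pol_comp p g) = R g *v S p"
    and nz: "\<exists>q\<in>Pol k. S q \<noteq> 0" and p: "p \<in> Pol k" "S p = 0"
  shows "p = (\<lambda>z. 0)"
proof (rule ccontr)
  assume "p \<noteq> (\<lambda>z. 0)"
  then obtain y where y: "p (cvec y) \<noteq> 0"
    using Pol_eqI[OF p(1) Pol_zero] by blast
  fix i :: 'a
  obtain A c where A: "A \<in> SL" and yA: "y = c *\<^sub>R (A *v axis i 1)"
    using SL_transitive_on_lines by metis
  have pA: "p (cvec (A *v axis i 1)) \<noteq> 0"
    using y by (auto simp: yA cvec_scaleR Pol_homogeneous[OF p(1)])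
  have zero: "linear_on_Pol k (\<lambda>_. 0 :: complex^'b)" by (simp add: linear_on_Pol_def)
  have "S (pol_comp p A) = pol_comp p A (cvec (axis i 1)) *s S (\<lambda>z. z $ i ^ k)"
    by (rule highest_weight_vector[OF zero S _ R Pol_substitute[OF p(1)]])
      (simp_all add: R[OF A p(1)] p(2))
  then have "S (\<lambda>z. z $ i ^ k) = 0"
    using pA by (simp add: R[OF A p(1)] p(2) map_matrix_cvec)
  from highest_weight_vector_zero[OF S R this] nz show False by blast
qed

text \<open>A form of Schur's lemma that uses the highest weight vector in place of eigenvalues.\<close>

lemma equivariant_proportional:
  assumes S1: "linear_on_Pol k S1" and S2: "linear_on_Pol k S2"
    and R1: "\<And>g p. g \<in> SL \<Longrightarrow> p \<in> Pol k \<Longrightarrow> S1 (pol_comp p g) = R g *v S1 p"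
    and R2: "\<And>g p. g \<in> SL \<Longrightarrow> p \<in> Pol k \<Longrightarrow> S2 (pol_comp p g) = R g *v S2 p"
    and surj: "S2 ` Pol k = UNIV"
  obtains c where "\<And>p. p \<in> Pol k \<Longrightarrow> S1 p = c *s S2 p"
proof -
  fix i :: 'a
  obtain q where q: "q \<in> Pol k" "S1 (\<lambda>z. z $ i ^ k) = S2 q"
    using surj by (metis UNIV_I imageE)
  define c where "c = q (cvec (axis i 1))"
  have eq: "S1 (\<lambda>z. z $ i ^ k) = c *s S2 (\<lambda>z. z $ i ^ k)"
    using highest_weight_vector[OF S1 S2 R1 R2 q] q(2) by (simp add: c_def)
  define S where "S p = S1 p + (- c) *s S2 p" for p
  have "linear_on_Pol k S"
    using S1 S2 unfolding linear_on_Pol_def S_def by (auto simp: vec_eq_iff algebra_simps)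
  moreover have "S (pol_comp p g) = R g *v S p" if "g \<in> SL" "p \<in> Pol k" for g p
    unfolding S_def R1[OF that] R2[OF that]
    by (simp only: matrix_vector_right_distrib vector_scalar_commute)
  moreover have "S (\<lambda>z. z $ i ^ k) = 0" by (simp add: S_def eq)
  ultimately have "S p = 0" if "p \<in> Pol k" for p
    using highest_weight_vector_zero[OF _ _ _ that] by metis
  then have "S1 p = c *s S2 p" if "p \<in> Pol k" for p
    using that by (simp add: S_def vec_eq_iff)
  then show thesis by (rule that)
qed

section \<open>Isomorphisms with representations on polynomials\<close>

text \<open>An isomorphism is described by its inverse, from polynomials to the representation space, since this is the direction in which
  the operators provide it.\<close>

definition pol_iso ::
  "(real^'m^'m) set \<Rightarrow> (real^'m^'m \<Rightarrow> complex) \<Rightarrow> (real^'m^'m \<Rightarrow> complex^'d^'d) \<Rightarrow> nat \<Rightarrow>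
    ((complex^'m \<Rightarrow> complex) \<Rightarrow> complex^'d) \<Rightarrow> bool" where
  "pol_iso H c \<sigma> k S \<longleftrightarrow> linear_on_Pol k S \<and> bij_betw S (Pol k) UNIV \<and>
     (\<forall>g\<in>H. \<forall>p\<in>Pol k. c g *s S (pol_act g p) = \<sigma> g *v S p)"

lemma vector_space_fun_scale: "vector_space fun_scale"
  by unfold_locales (simp_all add: fun_scale_def fun_eq_iff algebra_simps)

lemma rep_equiv_iff_pol_iso:
  "rep_equiv H \<sigma> fun_scale (Pol k) (\<lambda>g p. fun_scale (c g) (pol_act g p)) \<longleftrightarrow> (\<exists>S. pol_iso H c \<sigma> k S)"
proof
  assume "rep_equiv H \<sigma> fun_scale (Pol k) (\<lambda>g p. fun_scale (c g) (pol_act g p))"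
  then obtain T where T: "Vector_Spaces.linear (*s) fun_scale T" "bij_betw T UNIV (Pol k)"
    "\<And>g v. g \<in> H \<Longrightarrow> T (\<sigma> g *v v) = fun_scale (c g) (pol_act g (T v))"
    unfolding rep_equiv_def by blast
  have add: "T (v + w) = (\<lambda>z. T v z + T w z)" and scale: "T (a *s v) = (\<lambda>z. a * T v z)" for v w a
    using T(1) by (simp_all add: Vector_Spaces.linear_iff plus_fun_def fun_scale_def)
  define S where "S = inv_into UNIV T"
  have ST: "S (T v) = v" for v
    unfolding S_def by (rule inv_into_f_f) (use T(2) in \<open>auto simp: bij_betw_def\<close>)
  have TS: "T (S p) = p" if "p \<in> Pol k" for p
    unfolding S_def by (rule f_inv_into_f) (use T(2) that in \<open>auto simp: bij_betw_def\<close>)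
  have lin: "linear_on_Pol k S"
    unfolding linear_on_Pol_def
  proof (intro conjI ballI allI)
    fix p q :: "complex^'a \<Rightarrow> complex" and a assume p: "p \<in> Pol k" and q: "q \<in> Pol k"
    show "S (\<lambda>z. p z + q z) = S p + S q"
      using ST[of "S p + S q"] by (simp add: add TS p q)
    show "S (\<lambda>z. a * p z) = a *s S p"
      using ST[of "a *s S p"] by (simp add: scale TS p)
  qed
  moreover have "bij_betw S (Pol k) UNIV"
    unfolding S_def by (rule bij_betw_inv_into[OF T(2)])
  moreover have "c g *s S (pol_act g p) = \<sigma> g *v S p" if "g \<in> H" "p \<in> Pol k" for g p
  proof -
    have "\<sigma> g *v S p = S (T (\<sigma> g *v S p))" by (simp only: ST)
    also have "\<dots> = S (\<lambda>z. c g * pol_act g p z)"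
      by (simp add: T(3)[OF that(1)] TS[OF that(2)] fun_scale_def)
    also have "\<dots> = c g *s S (pol_act g p)"
      by (rule linear_on_Pol_cmult[OF lin pol_act_in_Pol[OF that(2)]])
    finally show ?thesis by simp
  qed
  ultimately show "\<exists>S. pol_iso H c \<sigma> k S" unfolding pol_iso_def by blast
next
  assume "\<exists>S. pol_iso H c \<sigma> k S"
  then obtain S where lin: "linear_on_Pol k S" and bij: "bij_betw S (Pol k) UNIV"
    and eq: "\<And>g p. g \<in> H \<Longrightarrow> p \<in> Pol k \<Longrightarrow> c g *s S (pol_act g p) = \<sigma> g *v S p"
    unfolding pol_iso_def by blast
  define T where "T = inv_into (Pol k) S"
  have TP: "T v \<in> Pol k" for v
    unfolding T_def by (rule inv_into_into) (use bij in \<open>simp add: bij_betw_def\<close>)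
  have ST: "S (T v) = v" for v
  proof -
    have "v \<in> S ` Pol k" using bij by (simp add: bij_betw_def)
    then show ?thesis unfolding T_def by (rule f_inv_into_f)
  qed
  have TI: "T v = p" if "p \<in> Pol k" "S p = v" for p v
    unfolding T_def using that bij by (auto simp: bij_betw_def)
  have "T (v + w) = T v + T w" for v w
    unfolding plus_fun_def
    by (rule TI) (simp_all add: Pol_add TP linear_on_Pol_add[OF lin] ST)
  moreover have "T (a *s v) = fun_scale a (T v)" for a v
    unfolding fun_scale_def
    by (rule TI) (simp_all add: Pol_cmult TP linear_on_Pol_cmult[OF lin] ST)
  ultimately have "Vector_Spaces.linear (*s) fun_scale T"
    by (simp add: Vector_Spaces.linear_iff vector_space_fun_scale vec.vector_space_axioms)
  moreover have "bij_betw T UNIV (Pol k)"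
    unfolding T_def by (rule bij_betw_inv_into[OF bij])
  moreover have "T (\<sigma> g *v v) = fun_scale (c g) (pol_act g (T v))" if "g \<in> H" for g v
    unfolding fun_scale_def
    by (rule TI) (simp_all add: Pol_cmult pol_act_in_Pol TP linear_on_Pol_cmult[OF lin] eq[OF that TP] ST)
  ultimately show "rep_equiv H \<sigma> fun_scale (Pol k) (\<lambda>g p. fun_scale (c g) (pol_act g p))"
    unfolding rep_equiv_def by blast
qed

lemma is_poly_iff_pol_iso: "is_poly H k \<rho> \<longleftrightarrow> (\<exists>S. pol_iso H (\<lambda>_. 1) \<rho> k S)"
proof -
  have "is_poly H k \<rho> \<longleftrightarrow> rep_equiv H \<rho> fun_scale (Pol k) (\<lambda>g p. fun_scale 1 (pol_act g p))"
    by (simp add: is_poly_def fun_scale_def)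
  also have "\<dots> \<longleftrightarrow> (\<exists>S. pol_iso H (\<lambda>_. 1) \<rho> k S)"
    by (rule rep_equiv_iff_pol_iso)
  finally show ?thesis .
qed

lemma Pol_0_constant:
  assumes "p \<in> Pol 0"
  shows "p = (\<lambda>_. p 0)"
proof
  fix z show "p z = p 0"
    using Pol_homogeneous[OF assms, of 0 z] by simp
qed

text \<open>Polynomials of degree \<open>0\<close> are constants, on which the group acts trivially.\<close>

lemma is_triv_iff_is_poly_0: "is_triv H \<rho> \<longleftrightarrow> is_poly H 0 \<rho>"
proof
  assume "is_triv H \<rho>"
  then obtain T where T: "Vector_Spaces.linear (*s) (*) T" "bij_betw T UNIV (UNIV :: complex set)"
    "\<And>g v. g \<in> H \<Longrightarrow> T (\<rho> g *v v) = T v"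
    unfolding is_triv_def rep_equiv_def by blast
  have "Vector_Spaces.linear (*s) fun_scale (\<lambda>v (_ :: complex^'a). T v)"
    using T(1) by (simp add: Vector_Spaces.linear_iff vector_space_fun_scale fun_scale_def plus_fun_def)
  moreover have "bij_betw (\<lambda>v (_ :: complex^'a). T v) UNIV (Pol 0)"
    unfolding bij_betw_def
  proof
    show "inj (\<lambda>v (_ :: complex^'a). T v)"
      using T(2) by (auto simp: bij_betw_def inj_on_def fun_eq_iff)
    have "p \<in> range (\<lambda>v _. T v)" if p: "p \<in> Pol 0" for p :: "complex^'a \<Rightarrow> complex"
    proof -
      obtain v where "p 0 = T v" using T(2) by (metis UNIV_I bij_betw_imp_surj_on imageE)
      then show ?thesis using Pol_0_constant[OF p] by auto
    qed
    then show "range (\<lambda>v (_ :: complex^'a). T v) = Pol 0"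
      by (auto simp: Pol_const)
  qed
  ultimately show "is_poly H 0 \<rho>"
    unfolding is_poly_def rep_equiv_def using T(3) by (auto simp: pol_act_def)
next
  assume "is_poly H 0 \<rho>"
  then obtain T where T: "Vector_Spaces.linear (*s) fun_scale T" "bij_betw T UNIV (Pol 0)"
    "\<And>g v. g \<in> H \<Longrightarrow> T (\<rho> g *v v) = pol_act g (T v)"
    unfolding is_poly_def rep_equiv_def by blast
  have const: "T v = (\<lambda>_. T v 0)" for v
    using Pol_0_constant T(2) by (metis UNIV_I bij_betw_imp_surj_on image_eqI)
  have "vector_space ((*) :: complex \<Rightarrow> complex \<Rightarrow> complex)"
    by unfold_locales (simp_all add: algebra_simps)
  then have "Vector_Spaces.linear (*s) (*) (\<lambda>v. T v 0)"
    using T(1) by (simp add: Vector_Spaces.linear_iff fun_scale_def)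
  moreover have "bij (\<lambda>v. T v 0)"
  proof (rule bijI)
    show "inj (\<lambda>v. T v 0)"
      using T(2) const unfolding bij_betw_def inj_on_def by metis
    show "surj (\<lambda>v. T v 0)"
      unfolding surj_def
    proof
      fix a :: complex
      obtain v where "T v = (\<lambda>_. a)"
        using T(2) Pol_const by (metis bij_betw_imp_surj_on imageE)
      then show "\<exists>v. a = T v 0" by (intro exI[of _ v]) simp
    qed
  qed
  moreover have "T (\<rho> g *v v) 0 = T v 0" if "g \<in> H" for g v
    unfolding T(3)[OF that] pol_act_def using fun_cong[OF const] by metis
  ultimately show "is_triv H \<rho>"
    unfolding is_triv_def rep_equiv_def by blast
qed

lemma pol_act_matrix_inv: "det g \<noteq> 0 \<Longrightarrow> pol_act (matrix_inv g) p = pol_comp p g"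
  by (simp add: pol_act_def matrix_inv_matrix_inv)

lemma pol_iso_surj: "pol_iso H c \<sigma> k S \<Longrightarrow> S ` Pol k = UNIV"
  by (simp add: pol_iso_def bij_betw_def)

lemma det_matrix_inv_SLpm: "g \<in> SLpm \<Longrightarrow> det (matrix_inv g) = det g"
  using SLpm_det_nz[of g] by (auto simp: det_matrix_inv SLpm_def)

lemma mat_rep_inv:
  assumes "mat_rep SLpm \<rho>" "g \<in> SLpm"
  shows "matrix_inv (\<rho> g) = \<rho> (matrix_inv g)" "\<rho> g ** matrix_inv (\<rho> g) = mat 1"
proof -
  have *: "\<rho> g ** \<rho> (matrix_inv g) = mat 1"
    using assms SLpm_inv[OF assms(2)] matrix_inv_cancel(1)[OF SLpm_det_nz[OF assms(2)]]
    unfolding mat_rep_def by metis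
  then show "matrix_inv (\<rho> g) = \<rho> (matrix_inv g)" by (rule matrix_inv_unique)
  with * show "\<rho> g ** matrix_inv (\<rho> g) = mat 1" by simp
qed

abbreviation twist :: "sign \<Rightarrow> (real^'m^'m \<Rightarrow> complex^'d^'d) \<Rightarrow> real^'m^'m \<Rightarrow> complex^'d^'d" where
  "twist \<beta> \<rho> \<equiv> \<lambda>g. mat (sign_char \<beta> g) ** \<rho> g"

lemma twist_apply: "twist \<beta> \<rho> g *v v = sgn_char \<beta> (det g) *s (\<rho> g *v v)"
  by (simp add: sign_char_eq mat_vector_mult flip: matrix_vector_mul_assoc)

text \<open>The equivariance of an isomorphism in the form that \<open>taylor_op_in_Diff\<close> uses: functions on the group transform
  under right translation by the inverse of the inducing representation.\<close>

lemma pol_iso_comp: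
  assumes \<rho>: "mat_rep SLpm \<rho>" and iso: "pol_iso SLpm (sign_char \<gamma>) (twist \<beta> \<rho>) k S" and g: "g \<in> SLpm" and p: "p \<in> Pol k"
  shows "sgn_char \<gamma> (det g) *s S (pol_comp p g) = sgn_char \<beta> (det g) *s (matrix_inv (\<rho> g) *v S p)"
proof -
  have "sign_char \<gamma> (matrix_inv g) *s S (pol_act (matrix_inv g) p) = twist \<beta> \<rho> (matrix_inv g) *v S p"
    using iso SLpm_inv[OF g] p unfolding pol_iso_def by blast
  then show ?thesis
    unfolding twist_apply
    by (simp only: sign_char_eq det_matrix_inv_SLpm[OF g] pol_act_matrix_inv[OF SLpm_det_nz[OF g]]
        mat_rep_inv(1)[OF \<rho> g])
qed

text \<open>Over \<open>SL\<close> the signs disappear, so \<open>S\<close> is proportional to an untwisted isomorphism \<open>S'\<close>. A matrix of determinant \<open>-1\<close> then tells the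
  sign characters apart.\<close>

lemma pol_iso_sign:
  fixes \<rho> :: "real^'m^'m \<Rightarrow> complex^'d^'d"
  assumes \<rho>: "mat_rep SLpm \<rho>" and iso: "pol_iso SLpm (sign_char \<gamma>) (twist \<beta> \<rho>) k S"
    and poly: "is_poly SLpm k \<rho>"
  shows "\<beta> = \<gamma>"
proof -
  obtain S' where S': "pol_iso SLpm (\<lambda>_. 1) \<rho> k S'"
    using poly is_poly_iff_pol_iso by blast
  then have iso': "pol_iso SLpm (sign_char Plus) (twist Plus \<rho>) k S'"
    by (simp add: pol_iso_def)
  have R: "S'' (pol_comp p g) = matrix_inv (\<rho> g) *v S'' p"
    if "pol_iso SLpm (sign_char \<gamma>) (twist \<beta> \<rho>) k S''" "g \<in> SL" "p \<in> Pol k" for \<gamma> \<beta> S'' g p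
    using pol_iso_comp[OF \<rho> that(1) SL_subset_SLpm[OF that(2)] that(3)] that(2) by (simp add: SL_def)
  obtain c where c: "\<And>p. p \<in> Pol k \<Longrightarrow> S p = c *s S' p"
  proof (rule equivariant_proportional)
    show "linear_on_Pol k S" "linear_on_Pol k S'" "S' ` Pol k = UNIV"
      using iso S' by (auto simp: pol_iso_def bij_betw_def)
  qed (use R[OF iso] R[OF iso'] in auto)
  have surj: "S ` Pol k = UNIV" by (rule pol_iso_surj[OF iso])
  then obtain p where p: "p \<in> Pol k" "S p = axis undefined 1"
    by (metis UNIV_I imageE)
  then have nz: "c *s S' p \<noteq> 0"
    using c[OF p(1)] by (simp add: axis_eq_0_iff)
  fix i :: 'm
  let ?g = "(\<chi> j l. if j = l then (if j = i then -1 else 1) else 0) :: real^'m^'m"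
  have "det ?g = (\<Prod>j\<in>UNIV. if j = i then -1 else 1)"
    by (subst det_diagonal) auto
  then have det: "det ?g = -1" by (simp add: prod.delta)
  then have g: "?g \<in> SLpm" by (simp add: SLpm_def)
  have cancel: "\<rho> ?g *v (matrix_inv (\<rho> ?g) *v (c *s S' p)) = c *s S' p"
    by (simp only: matrix_vector_mul_assoc mat_rep_inv(2)[OF \<rho> g] matrix_vector_mul_lid)
  have nz': "matrix_inv (\<rho> ?g) *v (c *s S' p) \<noteq> 0"
  proof
    assume "matrix_inv (\<rho> ?g) *v (c *s S' p) = 0"
    with cancel nz show False by (simp only: matrix_vector_mult_0_right)
  qed
  have "S' (pol_comp p ?g) = matrix_inv (\<rho> ?g) *v S' p"
    using pol_iso_comp[OF \<rho> iso' g p(1)] by (simp add: sgn_char_def)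
  then have "S (pol_comp p ?g) = matrix_inv (\<rho> ?g) *v (c *s S' p)"
    by (simp only: c[OF Pol_substitute[OF p(1)]] vector_scalar_commute)
  then have "sgn_char \<gamma> (-1) *s (matrix_inv (\<rho> ?g) *v (c *s S' p)) = sgn_char \<beta> (-1) *s (matrix_inv (\<rho> ?g) *v (c *s S' p))"
    using pol_iso_comp[OF \<rho> iso g p(1)] by (simp only: det c[OF p(1)])
  then have "sgn_char \<gamma> (-1) = sgn_char \<beta> (-1)"
    using nz' by (simp only: vec.scale_cancel_right) simp
  then show ?thesis
    by (cases \<beta>; cases \<gamma>) (auto simp: sgn_char_def)
qed

text \<open>The data for which \<open>taylor_op\<close> with \<open>k\<close> and \<open>S\<close> is a nonzero intertwining operator, if the target is irreducible. The sign \<open>\<alpha> + k\<close> comes from the \<open>k\<close> derivatives.\<close>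

definition admissible ::
  "sign \<Rightarrow> sign \<Rightarrow> (real^'m^'m \<Rightarrow> complex^'d^'d) \<Rightarrow> complex \<Rightarrow> complex \<Rightarrow> nat \<Rightarrow>
    ((complex^'m \<Rightarrow> complex) \<Rightarrow> complex^'d) \<Rightarrow> bool" where
  "admissible \<alpha> \<beta> \<rho> lam \<nu> k S \<longleftrightarrow> pol_iso SLpm (sign_char (sign_shift \<alpha> k)) (twist \<beta> \<rho>) k S \<and>
     (k = 0 \<or> lam = 1 - of_nat k) \<and> \<nu> = lam + of_nat k * (1 + 1 / of_nat CARD('m))"

lemma sign_shift_0: "sign_shift \<alpha> 0 = \<alpha>"
  by (cases \<alpha>) (simp_all add: sign_shift_def)

text \<open>For \<open>m \<ge> 2\<close> the extension to \<open>SL\<^sup>\<plusminus>\<close> is again \<open>Pol k\<close>, hence \<open>\<beta> = \<alpha> + k\<close>. For \<open>m = 1\<close> the twisted isomorphism is literally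
  the condition in \<open>in_Lambda\<close>, except when \<open>k = 0\<close> and \<open>lam\<close> is arbitrary; then the extension is trivial and \<open>\<beta> = \<alpha>\<close>.\<close>

lemma ex_admissible_iff:
  fixes \<omega> \<omega>' :: "real^'m^'m \<Rightarrow> complex^'d^'d"
  assumes ext: "extension_of \<omega> \<omega>'"
  shows "(\<exists>k S. admissible \<alpha> \<beta> \<omega>' lam \<nu> k S) \<longleftrightarrow>
    (\<beta> = \<alpha> \<and> is_triv SL \<omega> \<and> \<nu> = lam) \<or> in_Lambda \<alpha> \<beta> \<omega> \<omega>' lam \<nu>"
proof -
  let ?iso = "\<lambda>\<beta> k S. pol_iso SLpm (sign_char (sign_shift \<alpha> k)) (twist \<beta> \<omega>') k S"
  have \<omega>': "mat_rep SLpm \<omega>'" and same: "\<And>g. g \<in> SL \<Longrightarrow> \<omega>' g = \<omega> g"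
    and poly: "\<And>k. 2 \<le> CARD('m) \<Longrightarrow> is_poly SL k \<omega> \<Longrightarrow> is_poly SLpm k \<omega>'"
    and one: "\<And>g. CARD('m) = 1 \<Longrightarrow> g \<in> SLpm \<Longrightarrow> \<omega>' g = mat 1"
    using ext unfolding extension_of_def by blast+
  have card: "CARD('m) = 1 \<or> 2 \<le> CARD('m)"
    using zero_less_card_finite[where 'a = 'm] by linarith
  have restrict: "is_poly SL k \<omega>" if iso: "?iso \<beta> k S" for k S
  proof -
    have "S (pol_act g p) = \<omega> g *v S p" if "g \<in> SL" "p \<in> Pol k" for g p
    proof -
      have "sign_char (sign_shift \<alpha> k) g *s S (pol_act g p) = twist \<beta> \<omega>' g *v S p"
        using iso SL_subset_SLpm[OF that(1)] that(2) unfolding pol_iso_def by blast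
      moreover have "det g = 1" using that by (simp add: SL_def)
      ultimately show ?thesis
        unfolding twist_apply sign_char_eq by (simp add: same[OF that(1)])
    qed
    then have "pol_iso SL (\<lambda>_. 1) \<omega> k S"
      using iso by (simp add: pol_iso_def)
    then show ?thesis using is_poly_iff_pol_iso by blast
  qed
  have triv: "is_poly SLpm 0 \<omega>'" if "is_triv SL \<omega>"
    using card
  proof
    assume c1: "CARD('m) = 1"
    have "is_triv SLpm \<omega>'"
      using that one[OF c1] unfolding is_triv_def rep_equiv_def by auto
    then show ?thesis by (simp add: is_triv_iff_is_poly_0)
  next
    assume "2 \<le> CARD('m)"
    then show ?thesis using that poly by (simp add: is_triv_iff_is_poly_0)
  qed
  have induce: "\<exists>S. ?iso (sign_shift \<alpha> k) k S" if p: "is_poly SLpm k \<omega>'" for k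
  proof -
    obtain S where S: "pol_iso SLpm (\<lambda>_. 1) \<omega>' k S"
      using p is_poly_iff_pol_iso by blast
    then have "?iso (sign_shift \<alpha> k) k S"
      unfolding pol_iso_def twist_apply by (simp add: sign_char_eq)
    then show ?thesis by blast
  qed
  show ?thesis
  proof
    assume "\<exists>k S. admissible \<alpha> \<beta> \<omega>' lam \<nu> k S"
    then obtain k S where iso: "?iso \<beta> k S"
      and lam: "k = 0 \<or> lam = 1 - of_nat k" and \<nu>: "\<nu> = lam + of_nat k * (1 + 1 / of_nat CARD('m))"
      unfolding admissible_def by blast
    show "(\<beta> = \<alpha> \<and> is_triv SL \<omega> \<and> \<nu> = lam) \<or> in_Lambda \<alpha> \<beta> \<omega> \<omega>' lam \<nu>"
    proof (cases "k = 0")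
      case True
      then have "is_triv SL \<omega>"
        using restrict[OF iso] by (simp add: is_triv_iff_is_poly_0)
      moreover have "\<beta> = \<alpha>"
        using pol_iso_sign[OF \<omega>' iso] triv[OF calculation] by (simp add: True sign_shift_0)
      ultimately show ?thesis by (simp add: \<nu> True)
    next
      case False
      then have lam: "lam = 1 - of_nat k" using lam by simp
      then have \<nu>: "\<nu> = 1 + of_nat k / of_nat CARD('m)"
        by (simp add: \<nu> algebra_simps)
      have "if 2 \<le> CARD('m) then \<beta> = sign_shift \<alpha> k \<and> is_poly SL k \<omega>
        else rep_equiv SLpm (twist \<beta> \<omega>') fun_scale (Pol k) (\<lambda>g p. fun_scale (sign_char (sign_shift \<alpha> k) g) (pol_act g p))"
      proof (cases "2 \<le> CARD('m)")
        case True
        have "\<beta> = sign_shift \<alpha> k"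
          by (rule pol_iso_sign[OF \<omega>' iso poly[OF True restrict[OF iso]]])
        with True show ?thesis using restrict[OF iso] by simp
      next
        case False
        have "\<exists>S. ?iso \<beta> k S" using iso by blast
        with False show ?thesis by (simp only: rep_equiv_iff_pol_iso if_False)
      qed
      then show ?thesis
        unfolding in_Lambda_def using lam \<nu> by blast
    qed
  next
    assume "(\<beta> = \<alpha> \<and> is_triv SL \<omega> \<and> \<nu> = lam) \<or> in_Lambda \<alpha> \<beta> \<omega> \<omega>' lam \<nu>"
    then show "\<exists>k S. admissible \<alpha> \<beta> \<omega>' lam \<nu> k S"
    proof
      assume a: "\<beta> = \<alpha> \<and> is_triv SL \<omega> \<and> \<nu> = lam"
      then obtain S where "?iso (sign_shift \<alpha> 0) 0 S"
        using induce[OF triv] by blast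
      then have "admissible \<alpha> \<beta> \<omega>' lam \<nu> 0 S"
        unfolding admissible_def using a by (simp add: sign_shift_0)
      then show ?thesis by blast
    next
      assume "in_Lambda \<alpha> \<beta> \<omega> \<omega>' lam \<nu>"
      then obtain k where k: "if 2 \<le> CARD('m) then \<beta> = sign_shift \<alpha> k \<and> is_poly SL k \<omega>
        else rep_equiv SLpm (twist \<beta> \<omega>') fun_scale (Pol k) (\<lambda>g p. fun_scale (sign_char (sign_shift \<alpha> k) g) (pol_act g p))"
        and lam: "lam = 1 - of_nat k" and \<nu>: "\<nu> = 1 + of_nat k / of_nat CARD('m)"
        unfolding in_Lambda_def by blast
      have "\<exists>S. ?iso \<beta> k S"
      proof (cases "2 \<le> CARD('m)")
        case True
        then show ?thesis using k induce[OF poly[OF True]] by simp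
      next
        case False
        then show ?thesis using k by (simp only: rep_equiv_iff_pol_iso if_False)
      qed
      then obtain S where "?iso \<beta> k S" by blast
      then have "admissible \<alpha> \<beta> \<omega>' lam \<nu> k S"
        unfolding admissible_def using lam \<nu> by (simp add: algebra_simps)
      then show ?thesis by blast
    qed
  qed
qed

section \<open>The classification\<close>

lemma taylor_op_nonzero:
  fixes S :: "(complex^'m \<Rightarrow> complex) \<Rightarrow> complex^'d"
  assumes S: "linear_on_Pol k S" and p: "p \<in> Pol k" "S p \<noteq> 0"
  shows "taylor_op (Ind \<alpha> (triv_rep :: real^'m^'m \<Rightarrow> complex^1^1) lam) k S \<noteq> 0"
proof -
  let ?I = "Ind \<alpha> (triv_rep :: real^'m^'m \<Rightarrow> complex^1^1) lam"
  define D where "D = (if even k \<longleftrightarrow> \<alpha> = Plus then k else Suc k)"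
  have D: "k \<le> D" "even D \<longleftrightarrow> \<alpha> = Plus" by (auto simp: D_def)
  let ?f = "test_ind lam k p D"
  have f: "?f \<in> ?I" by (rule test_ind_in_Ind[OF p(1) D])
  have "taylor_form k (chart ?f (P_elt (mat 1) 0 0)) = (\<lambda>z. fact k * p z)"
    by (rule Pol_eqI[OF taylor_form_in_Pol Pol_cmult[OF p(1)]]) (simp add: taylor_form_test(1)[OF p(1) D SLpm_one])
  then have "taylor_op ?I k S ?f (P_elt (mat 1) 0 0) = fact k *s S p"
    using f by (simp add: taylor_op_def linear_on_Pol_cmult[OF S p(1)])
  also have "\<dots> \<noteq> 0" using p(2) by simp
  finally show ?thesis by (auto simp: fun_eq_iff)
qed

lemma admissible_imp_Diff:
  fixes \<rho> :: "real^'m^'m \<Rightarrow> complex^'d^'d"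
  assumes \<rho>: "mat_rep SLpm \<rho>" and ad: "admissible \<alpha> \<beta> \<rho> lam \<nu> k S"
  defines "I \<equiv> Ind \<alpha> (triv_rep :: real^'m^'m \<Rightarrow> complex^1^1) lam"
  shows "taylor_op I k S \<in> Diff_G I (Ind \<beta> \<rho> \<nu>)" "taylor_op I k S \<noteq> 0"
proof -
  have iso: "pol_iso SLpm (sign_char (sign_shift \<alpha> k)) (twist \<beta> \<rho>) k S"
    and par: "k = 0 \<or> lam = 1 - of_nat k" "\<nu> = lam + of_nat k * (1 + 1 / of_nat CARD('m))"
    using ad by (auto simp: admissible_def)
  then have S: "linear_on_Pol k S" by (simp add: pol_iso_def)
  show "taylor_op I k S \<in> Diff_G I (Ind \<beta> \<rho> \<nu>)"
    unfolding I_def by (rule taylor_op_in_Diff[OF S pol_iso_comp[OF \<rho> iso] mat_rep_inv(2)[OF \<rho>] par])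
  obtain p where p: "p \<in> Pol k" "S p = axis undefined 1"
    using pol_iso_surj[OF iso] by (metis UNIV_I imageE)
  then have "S p \<noteq> 0" by (simp add: axis_eq_0_iff)
  then show "taylor_op I k S \<noteq> 0"
    unfolding I_def by (rule taylor_op_nonzero[OF S p(1)])
qed

text \<open>The map \<open>S\<close> from \<open>Diff_imp_taylor_op\<close> is injective by \<open>equivariant_injective\<close>, and its image is an invariant subspace of an irreducible
  representation.\<close>

lemma Diff_imp_admissible:
  fixes \<rho> :: "real^'m^'m \<Rightarrow> complex^'d^'d" and \<alpha> :: sign and lam :: complex
  assumes \<rho>: "mat_rep SLpm \<rho>" and irr: "irreducible_rep SL \<omega>" and same: "\<And>g. g \<in> SL \<Longrightarrow> \<rho> g = \<omega> g"
  defines "I \<equiv> Ind \<alpha> (triv_rep :: real^'m^'m \<Rightarrow> complex^1^1) lam"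
  assumes T: "T \<in> Diff_G I (Ind \<beta> \<rho> \<nu>)" "T \<noteq> 0"
  obtains k S where "admissible \<alpha> \<beta> \<rho> lam \<nu> k S" "T = taylor_op I k S"
proof -
  have \<rho>1: "\<rho> (mat 1) = mat 1" using \<rho> by (simp add: mat_rep_def)
  obtain k S where S: "linear_on_Pol k S" "T = taylor_op I k S" "\<exists>p\<in>Pol k. S p \<noteq> 0"
    and par: "k = 0 \<or> lam = 1 - of_nat k" "\<nu> = lam + of_nat k * (1 + 1 / of_nat CARD('m))"
    and eq: "\<And>g p. g \<in> SLpm \<Longrightarrow> p \<in> Pol k \<Longrightarrow>
      sgn_char (sign_shift \<alpha> k) (det g) *s S (pol_comp p g) = sgn_char \<beta> (det g) *s (matrix_inv (\<rho> g) *v S p)"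
  proof (rule Diff_imp_taylor_op[OF mat_rep_inv(2)[OF \<rho>] \<rho>1 T[unfolded I_def], folded I_def])
    fix k S
    assume "linear_on_Pol k S" "T = taylor_op I k S" "\<exists>p\<in>Pol k. S p \<noteq> 0" "k = 0 \<or> lam = 1 - of_nat k"
      "\<nu> = lam + of_nat k * (1 + 1 / of_nat CARD('m))"
      "\<And>g p. g \<in> SLpm \<Longrightarrow> p \<in> Pol k \<Longrightarrow>
      sgn_char (sign_shift \<alpha> k) (det g) *s S (pol_comp p g) = sgn_char \<beta> (det g) *s (matrix_inv (\<rho> g) *v S p)"
    then show thesis by (rule that)
  qed
  have R: "S (pol_comp p g) = matrix_inv (\<rho> g) *v S p" if "g \<in> SL" "p \<in> Pol k" for g p
    using eq[OF SL_subset_SLpm[OF that(1)] that(2)] that(1) by (simp add: SL_def)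
  have inj: "inj_on S (Pol k)"
  proof (rule inj_onI)
    fix p q assume p: "p \<in> Pol k" and q: "q \<in> Pol k" and "S p = S q"
    have "S (\<lambda>z. p z + (- 1) * q z) = S p + (- 1) *s S q"
      by (simp only: linear_on_Pol_add[OF S(1) p Pol_cmult[OF q]] linear_on_Pol_cmult[OF S(1) q])
    then have "S (\<lambda>z. p z + (- 1) * q z) = 0"
      using \<open>S p = S q\<close> by (simp add: vec_eq_iff)
    with equivariant_injective[OF S(1) R S(3) Pol_add[OF p Pol_cmult[OF q]]]
    have "(\<lambda>z. p z + (- 1) * q z) = (\<lambda>z. 0)" by blast
    then show "p = q" by (simp add: fun_eq_iff)
  qed
  have "vec.subspace (S ` Pol k)"
    unfolding vec.subspace_def
  proof (intro conjI ballI allI)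
    show "0 \<in> S ` Pol k"
      using linear_on_Pol_zero[OF S(1)] Pol_zero by (metis image_eqI)
    show "x + y \<in> S ` Pol k" if "x \<in> S ` Pol k" "y \<in> S ` Pol k" for x y
      using that by (auto simp: Pol_add simp flip: linear_on_Pol_add[OF S(1)])
    show "c *s x \<in> S ` Pol k" if "x \<in> S ` Pol k" for c x
      using that by (auto simp: Pol_cmult simp flip: linear_on_Pol_cmult[OF S(1)])
  qed
  moreover have "\<omega> g *v u \<in> S ` Pol k" if g: "g \<in> SL" and u: "u \<in> S ` Pol k" for g u
  proof -
    obtain p where p: "p \<in> Pol k" "u = S p" using u by blast
    have "\<omega> g *v u = S (pol_comp p (matrix_inv g))"
      using R[OF SL_inv[OF g] p(1)] mat_rep_inv(1)[OF \<rho> SLpm_inv[OF SL_subset_SLpm[OF g]]] same[OF g]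
      by (simp add: p(2) matrix_inv_matrix_inv SL_det_nz[OF g])
    then show ?thesis using Pol_substitute[OF p(1)] by blast
  qed
  ultimately have "S ` Pol k = {0} \<or> S ` Pol k = UNIV"
    using irr unfolding irreducible_rep_def by blast
  then have "S ` Pol k = UNIV" using S(3) by auto
  then have bij: "bij_betw S (Pol k) UNIV" using inj by (simp add: bij_betw_def)
  have "sign_char (sign_shift \<alpha> k) g *s S (pol_act g p) = twist \<beta> \<rho> g *v S p" if "g \<in> SLpm" "p \<in> Pol k" for g p
  proof -
    have "det (matrix_inv g) = det g" by (rule det_matrix_inv_SLpm[OF that(1)])
    moreover have "matrix_inv (\<rho> (matrix_inv g)) = \<rho> g"
      using mat_rep_inv(1)[OF \<rho> SLpm_inv[OF that(1)]] by (simp add: matrix_inv_matrix_inv SLpm_det_nz[OF that(1)])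
    ultimately show ?thesis
      using eq[OF SLpm_inv[OF that(1)] that(2)] unfolding twist_apply by (simp only: sign_char_eq pol_act_def)
  qed
  then have "admissible \<alpha> \<beta> \<rho> lam \<nu> k S"
    unfolding admissible_def pol_iso_def using S(1) bij par by blast
  then show thesis using S(2) by (rule that)
qed

text \<open>The order \<open>k\<close> is determined by \<open>\<nu> - lam\<close>, and the map \<open>S\<close> up to a scalar by \<open>equivariant_proportional\<close>.\<close>

lemma admissible_unique:
  fixes \<rho> :: "real^'m^'m \<Rightarrow> complex^'d^'d"
  assumes \<rho>: "mat_rep SLpm \<rho>" and a1: "admissible \<alpha> \<beta> \<rho> lam \<nu> k1 S1" and a2: "admissible \<alpha> \<beta> \<rho> lam \<nu> k2 S2"
  shows "\<exists>c. taylor_op I k2 S2 = op_scale c (taylor_op I k1 S1)"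
proof -
  have "of_nat k1 * (1 + 1 / of_nat CARD('m)) = of_nat k2 * (1 + 1 / of_nat CARD('m) :: complex)"
    using a1 a2 by (simp add: admissible_def)
  moreover have "1 + 1 / of_nat CARD('m) \<noteq> (0 :: complex)"
  proof -
    have "1 + 1 / real CARD('m) \<noteq> 0" by (smt (verit) of_nat_0_le_iff divide_nonneg_nonneg)
    then have "complex_of_real (1 + 1 / real CARD('m)) \<noteq> 0" unfolding of_real_eq_0_iff .
    moreover have "complex_of_real (1 + 1 / real CARD('m)) = 1 + 1 / of_nat CARD('m)" by simp
    ultimately show ?thesis by metis
  qed
  ultimately have k: "k2 = k1" by simp
  have R: "S (pol_comp p g) = matrix_inv (\<rho> g) *v S p"
    if "admissible \<alpha> \<beta> \<rho> lam \<nu> k1 S" "g \<in> SL" "p \<in> Pol k1" for S g p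
    using pol_iso_comp[OF \<rho> _ SL_subset_SLpm[OF that(2)] that(3), of "sign_shift \<alpha> k1" \<beta> S] that(1,2)
    by (simp add: SL_def admissible_def)
  note a2 = a2[unfolded k]
  obtain c where c: "\<And>p. p \<in> Pol k1 \<Longrightarrow> S2 p = c *s S1 p"
  proof (rule equivariant_proportional)
    show "linear_on_Pol k1 S2" "linear_on_Pol k1 S1" "S1 ` Pol k1 = UNIV"
      using a1 a2 by (auto simp: admissible_def pol_iso_def bij_betw_def)
  qed (use R[OF a1] R[OF a2] in auto)
  have "taylor_op I k2 S2 = op_scale c (taylor_op I k1 S1)"
    by (simp add: k taylor_op_def op_scale_def fun_eq_iff c[OF taylor_form_in_Pol])
  then show ?thesis ..
qed

lemma zero_in_Diff:
  fixes \<rho> :: "real^'m^'m \<Rightarrow> complex^'d^'d" and I :: "(real^('m option)^('m option) \<Rightarrow> complex^'e) set"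
  shows "0 \<in> Diff_G I (Ind \<beta> \<rho> \<nu>)"
proof -
  have "smooth_on (\<lambda>x::real^('m option)^('m option). 0 :: complex^'d) UNIV" by (rule smooth_on_const) simp
  then have "smooth_on_SL (0 :: real^('m option)^('m option) \<Rightarrow> complex^'d)"
    unfolding smooth_on_SL_def by (intro ballI exI[of _ UNIV] exI[of _ "\<lambda>x. 0"]) simp
  then have "0 \<in> Ind \<beta> \<rho> \<nu>" by (simp add: Ind_def)
  moreover have "diff_op_on I (0 :: (real^('m option)^('m option) \<Rightarrow> complex^'e) \<Rightarrow> real^('m option)^('m option) \<Rightarrow> complex^'d)"
    unfolding diff_op_on_def
    by (intro exI[of _ 0] ballI exI[of _ "\<lambda>js x. 0"]) (simp add: smooth_on_const)
  ultimately show ?thesis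
    by (simp add: Diff_G_def linear_op_on_def left_trans_def fun_eq_iff)
qed

theorem theorem4p2:
  fixes \<alpha> \<beta> :: sign
    and \<omega> \<omega>' :: "real^'m^'m \<Rightarrow> complex^'d^'d"
    and lam \<nu> :: complex
  assumes "irreducible_rep SL \<omega>"
    and "extension_of \<omega> \<omega>'"
  defines "Diff \<equiv> Diff_G (Ind \<alpha> (triv_rep :: real^'m^'m \<Rightarrow> complex^1^1) lam) (Ind \<beta> \<omega>' \<nu>)"
  shows "(Diff \<noteq> {0} \<longleftrightarrow> op_dim Diff = 1) \<and>
         (op_dim Diff = 1 \<longleftrightarrow>
            (\<beta> = \<alpha> \<and> is_triv SL \<omega> \<and> \<nu> = lam) \<or> in_Lambda \<alpha> \<beta> \<omega> \<omega>' lam \<nu>)"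
proof -
  have \<omega>': "mat_rep SLpm \<omega>'" and same: "\<And>g. g \<in> SL \<Longrightarrow> \<omega>' g = \<omega> g"
    using assms(2) unfolding extension_of_def by blast+
  have zero: "0 \<in> Diff" unfolding Diff_def by (rule zero_in_Diff)
  have to_ad: "\<exists>k S. admissible \<alpha> \<beta> \<omega>' lam \<nu> k S \<and> T = taylor_op (Ind \<alpha> triv_rep lam) k S"
    if "T \<in> Diff" "T \<noteq> 0" for T
    by (rule Diff_imp_admissible[OF \<omega>' assms(1) same that[unfolded Diff_def]]) blast+
  have ex_nonzero: "\<exists>T. T \<in> Diff \<and> T \<noteq> 0" if "Diff \<noteq> {0}"
  proof (rule ccontr)
    assume "\<nexists>T. T \<in> Diff \<and> T \<noteq> 0"
    then have "Diff = {0}" by (intro equalityI subsetI) (auto simp: zero)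
    with that show False by contradiction
  qed
  have nonzero_iff: "Diff \<noteq> {0} \<longleftrightarrow> (\<exists>k S. admissible \<alpha> \<beta> \<omega>' lam \<nu> k S)"
  proof
    assume "Diff \<noteq> {0}"
    from ex_nonzero[OF this] obtain T where "T \<in> Diff" "T \<noteq> 0" by (elim exE conjE)
    then show "\<exists>k S. admissible \<alpha> \<beta> \<omega>' lam \<nu> k S" using to_ad by blast
  next
    assume "\<exists>k S. admissible \<alpha> \<beta> \<omega>' lam \<nu> k S"
    then show "Diff \<noteq> {0}"
      using admissible_imp_Diff[OF \<omega>'] unfolding Diff_def by blast
  qed
  have "op_dim Diff = 1" if ne: "Diff \<noteq> {0}"
  proof -
    obtain T where T: "T \<in> Diff" "T \<noteq> 0" using ex_nonzero[OF ne] by (elim exE conjE)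
    have "Diff \<subseteq> ops.span {T}"
    proof
      fix T' assume T': "T' \<in> Diff"
      show "T' \<in> ops.span {T}"
      proof (cases "T' = 0")
        case True
        then show ?thesis by (simp add: ops.span_zero)
      next
        case False
        obtain k' S' where 1: "admissible \<alpha> \<beta> \<omega>' lam \<nu> k' S'" "T' = taylor_op (Ind \<alpha> triv_rep lam) k' S'"
          using to_ad[OF T' False] by blast
        obtain k S where 2: "admissible \<alpha> \<beta> \<omega>' lam \<nu> k S" "T = taylor_op (Ind \<alpha> triv_rep lam) k S"
          using to_ad[OF T] by blast
        obtain c where "T' = op_scale c T"
          using admissible_unique[OF \<omega>' 2(1) 1(1)] unfolding 1(2) 2(2) by blast
        then show ?thesis by (simp add: ops.span_scale ops.span_base)
      qed
    qed
    then show ?thesis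
      using T by (intro ops.dim_unique[of "{T}"]) simp_all
  qed
  moreover have "op_dim Diff \<noteq> 1" if "Diff = {0}"
  proof -
    have "op_dim Diff = 0"
      by (rule ops.dim_unique[of "{}"]) (simp_all add: that ops.independent_empty)
    then show ?thesis by simp
  qed
  ultimately show ?thesis
    using nonzero_iff ex_admissible_iff[OF assms(2), of \<alpha> \<beta> lam \<nu>] by blast
qed

end
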